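(* Fix $i\in I$. Let $\beta\in Q^+\setminus\{0\}$ be such that $s_i(\beta)\in Q^+$. Then $H_\beta^i$ is not finitely generated as a $K$-module.
   Context: Let $I$ be a nonempty set and $\cdot:\mathbb{Z}I\otimes\mathbb{Z}I\to\mathbb{Z}$ a symmetric bilinear form with $i\cdot i\in 2\mathbb{Z}_{>0}$ for all $i\in I$ and $c_{i,j}:=2(i\cdot j)/(i\cdot i)\in\mathbb{Z}_{\le 0}$ for $i\neq j$ (and $c_{i,i}=2$). Put $d_i=(i\cdot i)/2$, $Q=\bigoplus_{i\in I}\mathbb{Z}i$, $Q^+=\bigoplus_{i\in I}\mathbb{Z}_{\ge 0}i$, let $\langle i^\vee,-\rangle:Q\to\mathbb{Z}$ be the linear map with $\langle i^\vee,j\rangle=c_{i,j}$, and $s_i(\beta)=\beta-\langle i^\vee,\beta\rangle i$ for $\beta\in Q$. The height of $\beta=\sum n_i i\in Q^+$ is $|\beta|=\sum n_i$, and $I^\beta=\{\nu\in I^{|\beta|}:\sum_k\nu_k=\beta\}$. Components of tuples are numbered from right to left, $\nu=(\nu_n,\dots,\nu_1)$, and the transposition $s_k=(k\ k+1)$ exchanges $\nu_k$ and $\nu_{k+1}$. $K$ is a nonzero commutative ring. For $i,j\in I$ fix $Q_{i,j}(u,v)\in K[u,v]$ with $Q_{i,i}=0$, $Q_{i,j}(u,v)=Q_{j,i}(v,u)$, and for $i\ne j$: if $c_{i,j}<0$, $Q_{i,j}(u,v)\in t_{i,j}u^{-c_{i,j}}+t_{j,i}v^{-c_{j,i}}+\sum_{s,t>0,\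 d_is+d_jt=-i\cdot j}Ku^sv^t$ with $t_{i,j},t_{j,i}\in K^\times$; if $c_{i,j}=0$, $Q_{i,j}$ is an invertible constant. KLR algebra. For $\beta\in Q^+$ of height $n$, $H_\beta$ is the unital $K$-algebra generated by $1_\nu$ ($\nu\in I^\beta$), $x_1,\dots,x_n$, $\tau_1,\dots,\tau_{n-1}$ with relations: $1_\nu1_{\nu'}=\delta_{\nu,\nu'}1_\nu$, $\sum_\nu1_\nu=1_\beta$ (the unit); $x_k1_\nu=1_\nu x_k$; $\tau_k1_\nu=1_{s_k(\nu)}\tau_k$; $x_kx_\ell=x_\ell x_k$; $\tau_k^21_\nu=Q_{\nu_k,\nu_{k+1}}(x_k,x_{k+1})1_\nu$; $(\tau_kx_\ell-x_{s_k(\ell)}\tau_k)1_\nu$ equals $1_\nu$ if $\ell=k+1,\nu_k=\nu_{k+1}$, equals $-1_\nu$ if $\ell=k,\nu_k=\nu_{k+1}$, and is $0$ otherwise; $\tau_k\tau_\ell=\tau_\ell\tau_k$ if $|k-\ell|>1$; $(\tau_{k+1}\tau_k\tau_{k+1}-\tau_k\tau_{k+1}\tau_k)1_\nu=\delta_{\nu_k,\nu_{k+2}}\frac{Q_{\nu_k,\nu_{k+1}}(x_{k+2},x_{k+1})-Q_{\nu_k,\nu_{k+1}}(x_k,x_{k+1})}{x_{k+2}-x_k}1_\nu$. Let $1_{\beta-i,i}=\sum_{\nu\in I^\beta,\ \nu_1=i}1_\nu\in H_\beta$ (equal to $0$ if $\beta-i\notin Q^+$), and $H_\beta^i=H_\beta/(1_{\beta-i,i})$,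 the quotient by the two-sided ideal generated by $1_{\beta-i,i}$. *)

theory Defs
  imports
    "HOL-Combinatorics.Permutations"
    "HOL-Computational_Algebra.Polynomial"
    "HOL-Library.Poly_Mapping"
    "HOL-Algebra.QuotRing"
    "HOL-Algebra.Module"
begin

section \<open>Root data\<close>

text \<open>The index set \<open>I\<close> is the type \<open>'i\<close>, and the lattice \<open>Q\<close> with basis \<open>I\<close> is
  the type of finitely supported functions from \<open>'i\<close> to the integers.\<close>

type_synonym 'i lattice = "'i \<Rightarrow>\<^sub>0 int"

definition simple :: "'i \<Rightarrow> 'i lattice"
  where "simple i = Poly_Mapping.single i 1"

definition pos_cone :: "'i lattice set"
  where "pos_cone = {\<beta>. \<forall>i. 0 \<le> Poly_Mapping.lookup \<beta> i}"

definition height :: "'i lattice \<Rightarrow> nat"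
  where "height \<beta> = nat (\<Sum>i\<in>Poly_Mapping.keys \<beta>. Poly_Mapping.lookup \<beta> i)"

definition cartan :: "('i lattice \<Rightarrow> 'i lattice \<Rightarrow> int) \<Rightarrow> 'i \<Rightarrow> 'i \<Rightarrow> int"
  where "cartan B i j = 2 * B (simple i) (simple j) div B (simple i) (simple i)"

text \<open>Biadditive maps are the same as bilinear maps over the integers.\<close>

definition cartan_datum :: "('i lattice \<Rightarrow> 'i lattice \<Rightarrow> int) \<Rightarrow> bool"
  where "cartan_datum B \<longleftrightarrow>
    (\<forall>x y z. B (x + y) z = B x z + B y z) \<and>
    (\<forall>x y z. B x (y + z) = B x y + B x z) \<and>
    (\<forall>x y. B x y = B y x) \<and>
    (\<forall>i. even (B (simple i) (simple i)) \<and> 0 < B (simple i) (simple i)) \<and>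
    (\<forall>i j. i \<noteq> j \<longrightarrow>
       B (simple i) (simple i) dvd 2 * B (simple i) (simple j) \<and>
       cartan B i j \<le> 0)"

definition half_norm :: "('i lattice \<Rightarrow> 'i lattice \<Rightarrow> int) \<Rightarrow> 'i \<Rightarrow> int"
  where "half_norm B i = B (simple i) (simple i) div 2"

definition coroot :: "('i lattice \<Rightarrow> 'i lattice \<Rightarrow> int) \<Rightarrow> 'i \<Rightarrow> 'i lattice \<Rightarrow> int"
  where "coroot B i \<beta> = (\<Sum>j\<in>Poly_Mapping.keys \<beta>. Poly_Mapping.lookup \<beta> j * cartan B i j)"

definition simple_reflection :: "('i lattice \<Rightarrow> 'i lattice \<Rightarrow> int) \<Rightarrow> 'i \<Rightarrow> 'i lattice \<Rightarrow> 'i lattice"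
  where "simple_reflection B i \<beta> = \<beta> - Poly_Mapping.single i (coroot B i \<beta>)"

text \<open>A sequence \<open>(\<nu>\<^sub>n, \<dots>, \<nu>\<^sub>1)\<close> is represented by the list \<open>[\<nu>\<^sub>1, \<dots>, \<nu>\<^sub>n]\<close>; its entries
  are numbered from 1.\<close>

definition seqs :: "'i lattice \<Rightarrow> 'i list set"
  where "seqs \<beta> = {\<nu>. length \<nu> = height \<beta> \<and> sum_list (map simple \<nu>) = \<beta>}"

definition entry :: "'i list \<Rightarrow> nat \<Rightarrow> 'i"
  where "entry \<nu> k = \<nu> ! (k - 1)"

definition swap_seq :: "nat \<Rightarrow> 'i list \<Rightarrow> 'i list"
  where "swap_seq k \<nu> = permute_list (transpose (k - 1) k) \<nu>"

lemma finite_seqs: "finite (seqs \<beta>)"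
proof (rule finite_subset)
  show "seqs \<beta> \<subseteq> {\<nu>. set \<nu> \<subseteq> Poly_Mapping.keys \<beta> \<and> length \<nu> = height \<beta>}"
  proof clarify
    fix \<nu> :: "'a list" assume "\<nu> \<in> seqs \<beta>"
    moreover have "Poly_Mapping.lookup (sum_list (map simple \<nu>)) i = int (count_list \<nu> i)" for i
      by (induction \<nu>) (auto simp: simple_def lookup_add lookup_single when_def)
    ultimately show "set \<nu> \<subseteq> Poly_Mapping.keys \<beta> \<and> length \<nu> = height \<beta>"
      by (auto simp: seqs_def in_keys_iff count_list_0_iff)
  qed
qed (simp add: finite_lists_length_eq)


section \<open>The polynomials \<open>Q\<^sub>i\<^sub>,\<^sub>j\<close>\<close>

text \<open>\<open>K[u,v]\<close> is \<open>'k poly poly\<close> with inner variable \<open>u\<close> and outer variable \<open>v\<close>.\<close>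

definition bimonom :: "'k::comm_ring_1 \<Rightarrow> nat \<Rightarrow> nat \<Rightarrow> 'k poly poly"
  where "bimonom a s t = monom (monom a s) t"

definition bicoeff :: "'k::comm_ring_1 poly poly \<Rightarrow> nat \<Rightarrow> nat \<Rightarrow> 'k"
  where "bicoeff p s t = coeff (coeff p t) s"

definition klr_polynomials ::
    "('i lattice \<Rightarrow> 'i lattice \<Rightarrow> int) \<Rightarrow> ('i \<Rightarrow> 'i \<Rightarrow> 'k::comm_ring_1 poly poly) \<Rightarrow> bool"
  where "klr_polynomials B Q \<longleftrightarrow>
    (\<forall>i. Q i i = 0) \<and>
    (\<forall>i j s t. bicoeff (Q i j) s t = bicoeff (Q j i) t s) \<and>
    (\<exists>\<theta> :: 'i \<Rightarrow> 'i \<Rightarrow> 'k. \<forall>i j. i \<noteq> j \<longrightarrow>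
      (cartan B i j < 0 \<longrightarrow>
        \<theta> i j dvd 1 \<and> \<theta> j i dvd 1 \<and>
        (\<exists>r. (\<forall>s t. bicoeff r s t \<noteq> 0 \<longrightarrow>
                0 < s \<and> 0 < t \<and>
                half_norm B i * int s + half_norm B j * int t = - B (simple i) (simple j)) \<and>
             Q i j = bimonom (\<theta> i j) (nat (- cartan B i j)) 0
                   + bimonom (\<theta> j i) 0 (nat (- cartan B j i)) + r))) \<and>
    (\<forall>i j. i \<noteq> j \<longrightarrow> cartan B i j = 0 \<longrightarrow> (\<exists>a. a dvd 1 \<and> Q i j = bimonom a 0 0))"

text \<open>Evaluation of \<open>p\<close> at \<open>u = a\<close>, \<open>v = b\<close> in a ring whose scalars are given by \<open>\<phi>\<close>, and
  the polynomial \<open>(p(a,b) - p(c,b)) / (a - c)\<close>, where each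
  \<open>(a\<^sup>s - c\<^sup>s) / (a - c)\<close> is written as \<open>\<Sum>r<s. a\<^sup>r c\<^sup>s\<^sup>-\<^sup>1\<^sup>-\<^sup>r\<close>. The target ring need
  not be commutative; the order of the factors is immaterial once \<open>a\<close>, \<open>b\<close>, \<open>c\<close> commute.\<close>

definition bieval :: "('k \<Rightarrow> 'r) \<Rightarrow> 'k::comm_ring_1 poly poly \<Rightarrow> 'r \<Rightarrow> 'r \<Rightarrow> 'r::ring_1"
  where "bieval \<phi> p a b =
    (\<Sum>t\<le>degree p. \<Sum>s\<le>degree (coeff p t). \<phi> (bicoeff p s t) * a ^ s * b ^ t)"

definition bidivdiff :: "('k \<Rightarrow> 'r) \<Rightarrow> 'k::comm_ring_1 poly poly \<Rightarrow> 'r \<Rightarrow> 'r \<Rightarrow> 'r \<Rightarrow> 'r::ring_1"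
  where "bidivdiff \<phi> p a c b =
    (\<Sum>t\<le>degree p. \<Sum>s\<le>degree (coeff p t).
       \<phi> (bicoeff p s t) * (\<Sum>r<s. a ^ r * c ^ (s - 1 - r)) * b ^ t)"

lemma bidivdiff:
  fixes a b c :: "'r::comm_ring_1"
  shows "(a - c) * bidivdiff \<phi> p a c b = bieval \<phi> p a b - bieval \<phi> p c b"
proof -
  have "(a - c) * (\<phi> q * (\<Sum>r<s. a ^ r * c ^ (s - 1 - r)) * b ^ t) =
        \<phi> q * a ^ s * b ^ t - \<phi> q * c ^ s * b ^ t" for q s t
  proof -
    have *: "a ^ s - c ^ s = (a - c) * (\<Sum>r<s. a ^ r * c ^ (s - 1 - r))"
      using power_diff_sumr2[of a s c] by (simp add: mult.commute)
    have "\<phi> q * a ^ s * b ^ t - \<phi> q * c ^ s * b ^ t = \<phi> q * (a ^ s - c ^ s) * b ^ t"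
      by (simp only: left_diff_distrib right_diff_distrib)
    then show ?thesis
      by (simp only: * mult_ac)
  qed
  then show ?thesis
    by (simp add: bidivdiff_def bieval_def sum_distrib_left sum_subtractf)
qed


section \<open>Algebras over \<open>K\<close>\<close>

text \<open>Bridge from the type class to the record-based structures of HOL-Algebra.\<close>

definition scalar_ring :: "'k::comm_ring_1 ring"
  where "scalar_ring = \<lparr>carrier = UNIV, mult = (*), one = 1, zero = 0, add = (+)\<rparr>"

text \<open>The quotient of a \<open>K\<close>-algebra by a two-sided ideal, with the induced scalar action.\<close>

definition alg_quot :: "('k, 'a) module \<Rightarrow> 'a set \<Rightarrow> ('k, 'a set) module"
  where "alg_quot A J =
    ring.extend (A Quot J) (module.fields (\<lambda>c X. \<Union>x\<in>X. J +>\<^bsub>A\<^esub> (c \<odot>\<^bsub>A\<^esub> x)))"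

definition finitely_generated_module :: "'k ring \<Rightarrow> ('k, 'a) module \<Rightarrow> bool"
  where "finitely_generated_module R M \<longleftrightarrow>
    (\<exists>S. finite S \<and> S \<subseteq> carrier M \<and>
      (\<forall>m\<in>carrier M. \<exists>a\<in>S \<rightarrow> carrier R. m = (\<Oplus>\<^bsub>M\<^esub>s\<in>S. a s \<odot>\<^bsub>M\<^esub> s)))"

text \<open>Lists form the free monoid, written additively so that
  \<^typ>\<open>'g list \<Rightarrow>\<^sub>0 'k\<close> with its convolution product is the free algebra on \<open>'g\<close>.\<close>

instantiation list :: (type) monoid_add
begin
definition zero_list :: "'a list" where "zero_list = []"
definition plus_list :: "'a list \<Rightarrow> 'a list \<Rightarrow> 'a list" where "plus_list = (@)"
instance by standard (simp_all add: zero_list_def plus_list_def)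
end

type_synonym ('g, 'k) free = "'g list \<Rightarrow>\<^sub>0 'k"

definition scalar :: "'k::comm_ring_1 \<Rightarrow> ('g, 'k) free"
  where "scalar c = Poly_Mapping.single [] c"

definition gen :: "'g \<Rightarrow> ('g, 'k::comm_ring_1) free"
  where "gen g = Poly_Mapping.single [g] 1"

definition free_algebra :: "'g set \<Rightarrow> ('k::comm_ring_1, ('g, 'k) free) module"
  where "free_algebra G =
    \<lparr>carrier = {p. Poly_Mapping.keys p \<subseteq> lists G}, mult = (*), one = 1, zero = 0, add = (+),
     smult = (\<lambda>c p. scalar c * p)\<rparr>"


lemma scalar_simps: "scalar 1 = 1" "scalar (a * b) = scalar a * scalar b"
   "scalar (a + b) = scalar a + scalar b"
  by (simp_all add: scalar_def mult_single single_add flip: zero_list_def)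

lemma free_algebra_simps [simp]:
  "mult (free_algebra G) = (*)" "one (free_algebra G) = 1" "zero (free_algebra G) = 0"
  "add (free_algebra G) = (+)" "smult (free_algebra G) = (\<lambda>c p. scalar c * p)"
  by (simp_all add: free_algebra_def)

lemma keys_mult_lists: "Poly_Mapping.keys p \<subseteq> lists G \<Longrightarrow> Poly_Mapping.keys q \<subseteq> lists G \<Longrightarrow>
  Poly_Mapping.keys (p * q) \<subseteq> lists G"
  using keys_mult[of p q] by (fastforce simp: plus_list_def)

lemma free_carrier:
  "0 \<in> carrier (free_algebra G)" "1 \<in> carrier (free_algebra G)"
  "scalar c \<in> carrier (free_algebra G)"
  "g \<in> G \<Longrightarrow> gen g \<in> carrier (free_algebra G)"
  "\<lbrakk>p \<in> carrier (free_algebra G); q \<in> carrier (free_algebra G)\<rbrakk> \<Longrightarrow> p + q \<in> carrier (free_algebra G)"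
  "\<lbrakk>p \<in> carrier (free_algebra G); q \<in> carrier (free_algebra G)\<rbrakk> \<Longrightarrow> p - q \<in> carrier (free_algebra G)"
  "p \<in> carrier (free_algebra G) \<Longrightarrow> - p \<in> carrier (free_algebra G)"
  "\<lbrakk>p \<in> carrier (free_algebra G); q \<in> carrier (free_algebra G)\<rbrakk> \<Longrightarrow> p * q \<in> carrier (free_algebra G)"
proof -
  have C: "carrier (free_algebra G) = {p. Poly_Mapping.keys p \<subseteq> lists G}"
    by (simp add: free_algebra_def)
  show "\<lbrakk>p \<in> carrier (free_algebra G); q \<in> carrier (free_algebra G)\<rbrakk> \<Longrightarrow> p + q \<in> carrier (free_algebra G)"
    using Poly_Mapping.keys_add[of p q] unfolding C by blast
  show "\<lbrakk>p \<in> carrier (free_algebra G); q \<in> carrier (free_algebra G)\<rbrakk> \<Longrightarrow> p - q \<in> carrier (free_algebra G)"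
    using keys_diff[of p q] unfolding C by blast
  show "\<lbrakk>p \<in> carrier (free_algebra G); q \<in> carrier (free_algebra G)\<rbrakk> \<Longrightarrow> p * q \<in> carrier (free_algebra G)"
    unfolding C using keys_mult_lists by blast
qed (simp_all add: free_algebra_def scalar_def gen_def zero_list_def)

lemma free_carrier_sum: "(\<And>a. a \<in> A \<Longrightarrow> f a \<in> carrier (free_algebra G)) \<Longrightarrow> sum f A \<in> carrier (free_algebra G)"
  by (induction A rule: infinite_finite_induct) (auto intro: free_carrier)

lemma free_carrier_power: "p \<in> carrier (free_algebra G) \<Longrightarrow> p ^ n \<in> carrier (free_algebra G)"
  by (induction n) (auto intro: free_carrier)

lemma free_algebra_ring: "ring (free_algebra G)"
proof (intro ringI abelian_groupI monoidI)
  fix x assume "x \<in> carrier (free_algebra G)"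
  then show "\<exists>y\<in>carrier (free_algebra G). y \<oplus>\<^bsub>free_algebra G\<^esub> x = \<zero>\<^bsub>free_algebra G\<^esub>"
    by (intro bexI[of _ "- x"]) (auto intro: free_carrier)
qed (auto simp: algebra_simps intro: free_carrier)

lemma scalar_ring: "cring scalar_ring"
  apply (intro cringI abelian_groupI comm_monoidI)
  apply (auto simp: scalar_ring_def algebra_simps)
  by (metis add.right_inverse)

lemma free_algebra_module: "module scalar_ring (free_algebra G)"
  using free_algebra_ring scalar_ring
  by (intro module.intro module_axioms.intro)
    (auto simp: ring_def algebra_simps scalar_simps scalar_ring_def intro: free_carrier)

lemma alg_quot_simps:
  "carrier (alg_quot A J) = carrier (A Quot J)"
  "mult (alg_quot A J) = mult (A Quot J)" "one (alg_quot A J) = one (A Quot J)"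
  "zero (alg_quot A J) = zero (A Quot J)" "add (alg_quot A J) = add (A Quot J)"
  by (simp_all add: alg_quot_def ring.defs module.defs)

text \<open>The locale \<open>algebra\<close> of HOL-Algebra covers commutative algebras only.\<close>

definition assoc_algebra :: "'k ring \<Rightarrow> ('k, 'a) module \<Rightarrow> bool"
  where "assoc_algebra R A \<longleftrightarrow> ring A \<and> module R A \<and>
    (\<forall>c\<in>carrier R. \<forall>x\<in>carrier A. \<forall>y\<in>carrier A.
      c \<odot>\<^bsub>A\<^esub> (x \<otimes>\<^bsub>A\<^esub> y) = (c \<odot>\<^bsub>A\<^esub> x) \<otimes>\<^bsub>A\<^esub> y)"

lemma alg_quot_ring: "ring (A Quot J) \<Longrightarrow> ring (alg_quot A J)"
proof -
  assume "ring (A Quot J)"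
  then interpret r: ring "A Quot J" .
  show ?thesis
  proof (intro ringI abelian_groupI monoidI)
    fix x assume "x \<in> carrier (alg_quot A J)"
    then show "\<exists>y\<in>carrier (alg_quot A J). y \<oplus>\<^bsub>alg_quot A J\<^esub> x = \<zero>\<^bsub>alg_quot A J\<^esub>"
      using r.add.l_inv_ex[of x] by (simp add: alg_quot_simps)
  qed (simp_all add: alg_quot_simps r.a_ac r.m_assoc r.l_distr r.r_distr)
qed

lemma alg_quot_smult:
  assumes "assoc_algebra R A" "ideal J A" "c \<in> carrier R" "x \<in> carrier A"
  shows "c \<odot>\<^bsub>alg_quot A J\<^esub> (J +>\<^bsub>A\<^esub> x) = J +>\<^bsub>A\<^esub> (c \<odot>\<^bsub>A\<^esub> x)"
proof -
  interpret ideal J A by fact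
  interpret M: module R A using assms by (simp add: assoc_algebra_def)
  have cJ: "c \<odot>\<^bsub>A\<^esub> j \<in> J" if "j \<in> J" for j
  proof -
    have "c \<odot>\<^bsub>A\<^esub> j = (c \<odot>\<^bsub>A\<^esub> \<one>\<^bsub>A\<^esub>) \<otimes>\<^bsub>A\<^esub> j"
    proof -
      have "c \<odot>\<^bsub>A\<^esub> (\<one>\<^bsub>A\<^esub> \<otimes>\<^bsub>A\<^esub> j) = (c \<odot>\<^bsub>A\<^esub> \<one>\<^bsub>A\<^esub>) \<otimes>\<^bsub>A\<^esub> j"
        using assms(1,3) Icarr[OF that] one_closed unfolding assoc_algebra_def by blast
      then show ?thesis using Icarr[OF that] by simp
    qed
    then show ?thesis using that assms by (simp add: I_l_closed)
  qed
  have "J +>\<^bsub>A\<^esub> (c \<odot>\<^bsub>A\<^esub> y) = J +>\<^bsub>A\<^esub> (c \<odot>\<^bsub>A\<^esub> x)" if y: "y \<in> J +>\<^bsub>A\<^esub> x" for y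
  proof -
    obtain j where j: "j \<in> J" "y = j \<oplus>\<^bsub>A\<^esub> x" using y by (auto simp: a_r_coset_def')
    then have "c \<odot>\<^bsub>A\<^esub> y = c \<odot>\<^bsub>A\<^esub> j \<oplus>\<^bsub>A\<^esub> c \<odot>\<^bsub>A\<^esub> x"
      using assms by (simp add: M.smult_r_distr Icarr)
    then have "c \<odot>\<^bsub>A\<^esub> y \<in> J +>\<^bsub>A\<^esub> (c \<odot>\<^bsub>A\<^esub> x)"
      using cJ[OF j(1)] by (auto simp: a_r_coset_def')
    from a_repr_independence[OF this M.smult_closed a_subgroup] assms show ?thesis
      by simp
  qed
  moreover have "J +>\<^bsub>A\<^esub> x \<noteq> {}" using assms a_rcos_self by blast
  ultimately have "(\<Union>y\<in>J +>\<^bsub>A\<^esub> x. J +>\<^bsub>A\<^esub> (c \<odot>\<^bsub>A\<^esub> y)) = J +>\<^bsub>A\<^esub> (c \<odot>\<^bsub>A\<^esub> x)"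
    by (intro SUP_eq_const)
  then show ?thesis
    by (simp only: alg_quot_def ring.defs module.defs module.simps)
qed

lemma assoc_algebra_quot:
  assumes "assoc_algebra R A" "ideal J A"
  shows "assoc_algebra R (alg_quot A J)"
proof -
  interpret ideal J A by fact
  interpret M: module R A using assms by (simp add: assoc_algebra_def)
  have r: "ring (alg_quot A J)" using quotient_is_ring by (rule alg_quot_ring)
  have carr: "carrier (alg_quot A J) = (\<lambda>x. J +>\<^bsub>A\<^esub> x) ` carrier A"
    by (auto simp: alg_quot_simps FactRing_def A_RCOSETS_def')
  note sm = alg_quot_smult[OF assms]
  have ad: "(J +>\<^bsub>A\<^esub> x) \<oplus>\<^bsub>alg_quot A J\<^esub> (J +>\<^bsub>A\<^esub> y) = J +>\<^bsub>A\<^esub> (x \<oplus>\<^bsub>A\<^esub> y)"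
    and mu: "(J +>\<^bsub>A\<^esub> x) \<otimes>\<^bsub>alg_quot A J\<^esub> (J +>\<^bsub>A\<^esub> y) = J +>\<^bsub>A\<^esub> (x \<otimes>\<^bsub>A\<^esub> y)"
    if "x \<in> carrier A" "y \<in> carrier A" for x y
    using that by (simp_all add: alg_quot_simps FactRing_def a_rcos_sum rcoset_mult_add)
  have 1: "module R (alg_quot A J)"
  proof (intro module.intro module_axioms.intro)
    show "cring R" by (rule M.R.is_cring)
    show "abelian_group (alg_quot A J)" using r by (simp add: ring_def)
  next
    fix a x assume "a \<in> carrier R" "x \<in> carrier (alg_quot A J)"
    then show "a \<odot>\<^bsub>alg_quot A J\<^esub> x \<in> carrier (alg_quot A J)"
      by (auto simp: carr sm)
  next
    fix a b x assume "a \<in> carrier R" "b \<in> carrier R" "x \<in> carrier (alg_quot A J)"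
    then show "(a \<oplus>\<^bsub>R\<^esub> b) \<odot>\<^bsub>alg_quot A J\<^esub> x =
        a \<odot>\<^bsub>alg_quot A J\<^esub> x \<oplus>\<^bsub>alg_quot A J\<^esub> b \<odot>\<^bsub>alg_quot A J\<^esub> x"
      and "(a \<otimes>\<^bsub>R\<^esub> b) \<odot>\<^bsub>alg_quot A J\<^esub> x = a \<odot>\<^bsub>alg_quot A J\<^esub> (b \<odot>\<^bsub>alg_quot A J\<^esub> x)"
      by (auto simp: carr sm ad M.smult_l_distr M.smult_assoc1)
  next
    fix a x y assume "a \<in> carrier R" "x \<in> carrier (alg_quot A J)" "y \<in> carrier (alg_quot A J)"
    then show "a \<odot>\<^bsub>alg_quot A J\<^esub> (x \<oplus>\<^bsub>alg_quot A J\<^esub> y) =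
        a \<odot>\<^bsub>alg_quot A J\<^esub> x \<oplus>\<^bsub>alg_quot A J\<^esub> a \<odot>\<^bsub>alg_quot A J\<^esub> y"
      by (auto simp: carr sm ad M.smult_r_distr)
  next
    fix x assume "x \<in> carrier (alg_quot A J)"
    then show "\<one>\<^bsub>R\<^esub> \<odot>\<^bsub>alg_quot A J\<^esub> x = x" by (auto simp: carr sm)
  qed
  have 2: "c \<odot>\<^bsub>alg_quot A J\<^esub> (x \<otimes>\<^bsub>alg_quot A J\<^esub> y) = (c \<odot>\<^bsub>alg_quot A J\<^esub> x) \<otimes>\<^bsub>alg_quot A J\<^esub> y"
    if "c \<in> carrier R" "x \<in> carrier (alg_quot A J)" "y \<in> carrier (alg_quot A J)" for c x y
    using that assms(1) by (auto simp: carr sm mu assoc_algebra_def)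
  show ?thesis unfolding assoc_algebra_def using r 1 2 by blast
qed


section \<open>KLR algebras\<close>

datatype 'i klr_gen = Idem_Gen "'i list" | X_Gen nat | Tau_Gen nat

definition klr_gens :: "'i lattice \<Rightarrow> 'i klr_gen set"
  where "klr_gens \<beta> = Idem_Gen ` seqs \<beta> \<union> X_Gen ` {1..height \<beta>} \<union> Tau_Gen ` {1..<height \<beta>}"

abbreviation idem :: "'i list \<Rightarrow> ('i klr_gen, 'k::comm_ring_1) free"
  where "idem \<nu> \<equiv> gen (Idem_Gen \<nu>)"
abbreviation xgen :: "nat \<Rightarrow> ('i klr_gen, 'k::comm_ring_1) free"
  where "xgen k \<equiv> gen (X_Gen k)"
abbreviation tau :: "nat \<Rightarrow> ('i klr_gen, 'k::comm_ring_1) free"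
  where "tau k \<equiv> gen (Tau_Gen k)"

text \<open>Each relation \<open>a = b\<close> is given as the element \<open>a - b\<close> of the free algebra.\<close>

inductive_set klr_relations ::
    "('i \<Rightarrow> 'i \<Rightarrow> 'k::comm_ring_1 poly poly) \<Rightarrow> 'i lattice \<Rightarrow> ('i klr_gen, 'k) free set"
  for Q :: "'i \<Rightarrow> 'i \<Rightarrow> 'k poly poly" and \<beta> :: "'i lattice"
  where
    idem_mult: "\<lbrakk>\<nu> \<in> seqs \<beta>; \<nu>' \<in> seqs \<beta>\<rbrakk> \<Longrightarrow>
      idem \<nu> * idem \<nu>' - (if \<nu> = \<nu>' then idem \<nu> else 0) \<in> klr_relations Q \<beta>"
  | idem_sum: "(\<Sum>\<nu>\<in>seqs \<beta>. idem \<nu>) - 1 \<in> klr_relations Q \<beta>"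
  | x_idem: "\<lbrakk>\<nu> \<in> seqs \<beta>; k \<in> {1..height \<beta>}\<rbrakk> \<Longrightarrow>
      xgen k * idem \<nu> - idem \<nu> * xgen k \<in> klr_relations Q \<beta>"
  | tau_idem: "\<lbrakk>\<nu> \<in> seqs \<beta>; k \<in> {1..<height \<beta>}\<rbrakk> \<Longrightarrow>
      tau k * idem \<nu> - idem (swap_seq k \<nu>) * tau k \<in> klr_relations Q \<beta>"
  | x_x: "\<lbrakk>k \<in> {1..height \<beta>}; l \<in> {1..height \<beta>}\<rbrakk> \<Longrightarrow>
      xgen k * xgen l - xgen l * xgen k \<in> klr_relations Q \<beta>"
  | tau_square: "\<lbrakk>\<nu> \<in> seqs \<beta>; k \<in> {1..<height \<beta>}\<rbrakk> \<Longrightarrow>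
      (tau k)\<^sup>2 * idem \<nu> - bieval scalar (Q (entry \<nu> k) (entry \<nu> (k + 1))) (xgen k) (xgen (k + 1)) * idem \<nu>
        \<in> klr_relations Q \<beta>"
  | tau_x: "\<lbrakk>\<nu> \<in> seqs \<beta>; k \<in> {1..<height \<beta>}; l \<in> {1..height \<beta>}\<rbrakk> \<Longrightarrow>
      (tau k * xgen l - xgen (transpose k (k + 1) l) * tau k) * idem \<nu>
        - (if l = k + 1 \<and> entry \<nu> k = entry \<nu> (k + 1) then idem \<nu>
           else if l = k \<and> entry \<nu> k = entry \<nu> (k + 1) then - idem \<nu> else 0)
        \<in> klr_relations Q \<beta>"
  | tau_tau: "\<lbrakk>k \<in> {1..<height \<beta>}; l \<in> {1..<height \<beta>}; k + 1 < l \<or> l + 1 < k\<rbrakk> \<Longrightarrow>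
      tau k * tau l - tau l * tau k \<in> klr_relations Q \<beta>"
  | braid: "\<lbrakk>\<nu> \<in> seqs \<beta>; k \<in> {1..<height \<beta>}; k + 1 \<in> {1..<height \<beta>}\<rbrakk> \<Longrightarrow>
      (tau (k + 1) * tau k * tau (k + 1) - tau k * tau (k + 1) * tau k) * idem \<nu>
        - (if entry \<nu> k = entry \<nu> (k + 2)
           then bidivdiff scalar (Q (entry \<nu> k) (entry \<nu> (k + 1))) (xgen (k + 2)) (xgen k) (xgen (k + 1)) * idem \<nu>
           else 0)
        \<in> klr_relations Q \<beta>"

text \<open>Ideals are generated inside the carrier, so the relations have to lie there.\<close>

lemma seqs_swap: "\<lbrakk>\<nu> \<in> seqs \<beta>; k \<in> {1..<height \<beta>}\<rbrakk> \<Longrightarrow> swap_seq k \<nu> \<in> seqs \<beta>"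
proof -
  assume a: "\<nu> \<in> seqs \<beta>" "k \<in> {1..<height \<beta>}"
  then have "transpose (k - 1) k permutes {..<length \<nu>}"
    by (intro permutes_swap_id) (auto simp: seqs_def)
  then have "mset (swap_seq k \<nu>) = mset \<nu>"
    unfolding swap_seq_def by (rule mset_permute_list)
  then show ?thesis using a
    by (metis (mono_tags, lifting) mem_Collect_eq mset_map seqs_def size_mset sum_mset_sum_list)
qed

lemma klr_relations_carrier: "klr_relations Q \<beta> \<subseteq> carrier (free_algebra (klr_gens \<beta>))"
proof
  have [simp]: "\<nu> \<in> seqs \<beta> \<Longrightarrow> Idem_Gen \<nu> \<in> klr_gens \<beta>"
    "X_Gen k \<in> klr_gens \<beta> \<longleftrightarrow> k \<in> {1..height \<beta>}"
    "Tau_Gen k \<in> klr_gens \<beta> \<longleftrightarrow> k \<in> {1..<height \<beta>}" for \<nu> k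
    by (auto simp: klr_gens_def)
  fix p assume "p \<in> klr_relations Q \<beta>"
  then show "p \<in> carrier (free_algebra (klr_gens \<beta>))"
    by cases (auto simp: bieval_def bidivdiff_def transpose_def
      intro!: free_carrier free_carrier_sum free_carrier_power dest: seqs_swap)
qed

definition klr_ideal ::
    "('i \<Rightarrow> 'i \<Rightarrow> 'k::comm_ring_1 poly poly) \<Rightarrow> 'i lattice \<Rightarrow> ('i klr_gen, 'k) free set"
  where "klr_ideal Q \<beta> = Idl\<^bsub>free_algebra (klr_gens \<beta>)\<^esub> (klr_relations Q \<beta>)"

definition klr_algebra ::
    "('i \<Rightarrow> 'i \<Rightarrow> 'k::comm_ring_1 poly poly) \<Rightarrow> 'i lattice \<Rightarrow> ('k, ('i klr_gen, 'k) free set) module"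
  where "klr_algebra Q \<beta> = alg_quot (free_algebra (klr_gens \<beta>)) (klr_ideal Q \<beta>)"

text \<open>The element \<open>1\<^sub>\<beta>\<^sub>-\<^sub>i\<^sub>,\<^sub>i\<close>; the sum is empty if \<open>\<beta> - i\<close> is not in the positive cone.\<close>

definition last_idem ::
    "('i \<Rightarrow> 'i \<Rightarrow> 'k::comm_ring_1 poly poly) \<Rightarrow> 'i lattice \<Rightarrow> 'i \<Rightarrow> ('i klr_gen, 'k) free set"
  where "last_idem Q \<beta> i =
    klr_ideal Q \<beta> +>\<^bsub>free_algebra (klr_gens \<beta>)\<^esub> (\<Sum>\<nu> | \<nu> \<in> seqs \<beta> \<and> \<nu> \<noteq> [] \<and> entry \<nu> 1 = i. idem \<nu>)"

definition klr_quotient ::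
    "('i \<Rightarrow> 'i \<Rightarrow> 'k::comm_ring_1 poly poly) \<Rightarrow> 'i lattice \<Rightarrow> 'i \<Rightarrow>
     ('k, ('i klr_gen, 'k) free set set) module"
  where "klr_quotient Q \<beta> i =
    alg_quot (klr_algebra Q \<beta>) (Idl\<^bsub>klr_algebra Q \<beta>\<^esub> {last_idem Q \<beta> i})"

lemma klr_quotient_module: "module scalar_ring (klr_quotient Q \<beta> i)"
proof -
  let ?F = "free_algebra (klr_gens \<beta>)"
  have 0: "assoc_algebra scalar_ring ?F"
    by (simp add: assoc_algebra_def mult.assoc free_algebra_ring free_algebra_module)
  have id: "ideal (klr_ideal Q \<beta>) ?F"
    unfolding klr_ideal_def by (rule ring.genideal_ideal[OF free_algebra_ring klr_relations_carrier])
  have 1: "assoc_algebra scalar_ring (klr_algebra Q \<beta>)"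
    unfolding klr_algebra_def by (rule assoc_algebra_quot[OF 0 id])
  have "last_idem Q \<beta> i \<in> carrier (klr_algebra Q \<beta>)"
    unfolding klr_algebra_def last_idem_def
    by (auto simp: alg_quot_simps FactRing_def A_RCOSETS_def' klr_gens_def intro!: imageI free_carrier free_carrier_sum)
  then have "assoc_algebra scalar_ring (klr_quotient Q \<beta> i)"
    unfolding klr_quotient_def using 1
    by (intro assoc_algebra_quot ring.genideal_ideal) (auto simp: assoc_algebra_def)
  then show ?thesis by (simp add: assoc_algebra_def)
qed

end

theory Submission
  imports
    Defs
    "HOL-Algebra.Algebraic_Closure_Type"
    "HOL-Library.Nat_Bijection"
begin

text \<open>
  Reducing \<open>K\<close> modulo a maximal ideal and enlarging the residue field \<open>k\<close>, let \<open>E\<close> be an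
  algebraic closure of \<open>k(Y)\<close>. The condition \<open>s\<^sub>i(\<beta>) \<in> Q\<^sup>+\<close> says that the number of letters \<open>i\<close> in \<open>\<beta>\<close>
  is at most \<open>\<Sum> -c\<^sub>i\<^sub>,\<^sub>j\<close>, summed over the letters \<open>j \<noteq> i\<close>. So attach to the letters \<open>j \<noteq> i\<close>
  distinct values \<open>y\<close> in \<open>E\<close>, the first of which is \<open>Y\<close>, and to the letters \<open>i\<close> roots \<open>z\<close> of the polynomials
  \<open>Q\<^sub>j\<^sub>,\<^sub>i(y, z)\<close> (of degree \<open>-c\<^sub>i\<^sub>,\<^sub>j\<close> in \<open>z\<close>); call \<open>y\<close> the parent of its roots.

  If all these values are distinct, the polynomial representation can be evaluated at the orderings of these
  coloured points: \<open>x\<^sub>k\<close> multiplies by the \<open>k\<close>-th value, and \<open>\<tau>\<^sub>k\<close> is a divided difference for equal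
  colours and otherwise the exchange of neighbours, times \<open>1\<close> or \<open>Q\<^sub>j\<^sub>,\<^sub>i\<close>. Exchanging a root with its parent
  costs the factor \<open>Q\<^sub>j\<^sub>,\<^sub>i(y, z) = 0\<close>, so the functions on the orderings in which every root comes after its
  parent form a quotient module. No such ordering starts with \<open>i\<close>, hence this is a module over
  the quotient algebra, and \<open>x\<^sub>1\<close> has the eigenvalue \<open>Y\<close>, which is transcendental over \<open>k\<close>.

  The roots need not be distinct (think of \<open>Q = u + v\<^sup>p\<close> in characteristic \<open>p\<close>). Therefore the roots and the
  polynomials \<open>Q\<^sub>j\<^sub>,\<^sub>i\<close> are deformed over \<open>E[[\<epsilon>]]\<close> so that the deformed roots are distinct, the functions are
  restricted to those given by polynomials in the values with coefficients in \<open>E[[\<epsilon>]]\<close>, which is possible since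
  divided differences preserve polynomials, and the result is reduced modulo \<open>\<epsilon>\<close>.
\<close>

section \<open>The residue field at a maximal ideal\<close>

definition proper_ideal :: "'a::comm_ring_1 set \<Rightarrow> bool"
  where "proper_ideal I \<longleftrightarrow> 0 \<in> I \<and> 1 \<notin> I \<and> (\<forall>a\<in>I. \<forall>b\<in>I. a + b \<in> I) \<and> (\<forall>a\<in>I. \<forall>r. r * a \<in> I)"

text \<open>The maximal ideal is chosen once for each ring, so that its residue field can be a type.\<close>

definition max_ideal :: "'a::comm_ring_1 set"
  where "max_ideal = (SOME M. proper_ideal M \<and> (\<forall>I. proper_ideal I \<longrightarrow> M \<subseteq> I \<longrightarrow> I = M))"

text \<open>Zorn's lemma applies because 1 lies in no member of a chain of proper ideals, hence not
  in the union. The zero ideal is proper since \<open>0 \<noteq> 1\<close> in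
  \<open>comm_ring_1\<close>.\<close>

lemma max_ideal:
  "proper_ideal (max_ideal :: 'a::comm_ring_1 set)"
  "proper_ideal I \<Longrightarrow> (max_ideal :: 'a set) \<subseteq> I \<Longrightarrow> I = max_ideal"
proof -
  have "\<exists>M\<in>Collect proper_ideal. \<forall>I\<in>Collect proper_ideal. M \<subseteq> I \<longrightarrow> I = (M :: 'a set)"
  proof (rule subset_Zorn_nonempty)
    show "Collect proper_ideal \<noteq> ({} :: 'a set set)"
      by (auto simp: proper_ideal_def intro!: exI[of _ "{0}"])
  next
    fix C :: "'a set set"
    assume C: "C \<noteq> {}" "subset.chain (Collect proper_ideal) C"
    have "a + b \<in> \<Union>C" if ab: "a \<in> \<Union>C" "b \<in> \<Union>C" for a b
    proof -
      obtain U V where UV: "U \<in> C" "a \<in> U" "V \<in> C" "b \<in> V" using ab by blast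
      moreover have "U \<subseteq> V \<or> V \<subseteq> U" using UV C(2) by (auto simp: subset_chain_def)
      moreover have "proper_ideal U" "proper_ideal V" using UV C(2) by (auto simp: subset_chain_def)
      ultimately show ?thesis unfolding proper_ideal_def by (meson UnionI subsetD)
    qed
    moreover have CI: "proper_ideal U" if "U \<in> C" for U
      using C(2) that by (auto simp: subset_chain_def)
    moreover have "0 \<in> \<Union>C" "1 \<notin> \<Union>C"
      using CI C(1) unfolding proper_ideal_def by auto
    moreover have "r * a \<in> \<Union>C" if "a \<in> \<Union>C" for a r
      using CI that unfolding proper_ideal_def by (meson Union_iff)
    ultimately show "\<Union>C \<in> Collect proper_ideal"
      by (simp only: proper_ideal_def mem_Collect_eq) blast
  qed
  then have "\<exists>M. proper_ideal M \<and> (\<forall>I. proper_ideal I \<longrightarrow> M \<subseteq> I \<longrightarrow> I = (M :: 'a set))"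
    by blast
  from someI_ex[OF this] show "proper_ideal (max_ideal :: 'a set)"
    "proper_ideal I \<Longrightarrow> (max_ideal :: 'a set) \<subseteq> I \<Longrightarrow> I = max_ideal"
    unfolding max_ideal_def by blast+
qed

lemma max_ideal_simps:
  "0 \<in> (max_ideal :: 'a::comm_ring_1 set)" "1 \<notin> (max_ideal :: 'a set)"
  "a \<in> max_ideal \<Longrightarrow> b \<in> max_ideal \<Longrightarrow> a + b \<in> (max_ideal :: 'a set)"
  "a \<in> max_ideal \<Longrightarrow> r * a \<in> (max_ideal :: 'a set)"
  "a \<in> max_ideal \<Longrightarrow> a * r \<in> (max_ideal :: 'a set)"
  "a \<in> max_ideal \<Longrightarrow> - a \<in> (max_ideal :: 'a set)"
  "a \<in> max_ideal \<Longrightarrow> b \<in> max_ideal \<Longrightarrow> a - b \<in> (max_ideal :: 'a set)"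
proof -
  note * = max_ideal(1)[where 'a='a, unfolded proper_ideal_def]
  show "0 \<in> (max_ideal :: 'a set)" "1 \<notin> (max_ideal :: 'a set)"
    and 1: "\<And>a b. a \<in> max_ideal \<Longrightarrow> b \<in> max_ideal \<Longrightarrow> a + b \<in> (max_ideal :: 'a set)"
    and 2: "\<And>a r. a \<in> max_ideal \<Longrightarrow> r * a \<in> (max_ideal :: 'a set)"
    using * by auto
  show 3: "\<And>a r. a \<in> max_ideal \<Longrightarrow> a * r \<in> (max_ideal :: 'a set)"
    using 2 by (simp add: mult.commute)
  show 4: "\<And>a. a \<in> max_ideal \<Longrightarrow> - a \<in> (max_ideal :: 'a set)"
    using 2[of _ "-1"] by simp
  show "\<And>a b. a \<in> max_ideal \<Longrightarrow> b \<in> max_ideal \<Longrightarrow> a - b \<in> (max_ideal :: 'a set)"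
    using 1[OF _ 4] by simp
qed

text \<open>Without such a \<open>b\<close>, the ideal generated by \<open>max_ideal\<close> and
  \<open>a\<close> would be proper, so by maximality \<open>a\<close> would already lie in
  \<open>max_ideal\<close>.\<close>

lemma max_ideal_inverse:
  assumes "(a :: 'a::comm_ring_1) \<notin> max_ideal"
  shows "\<exists>b. a * b - 1 \<in> max_ideal"
proof (rule ccontr)
  assume no: "\<not> ?thesis"
  let ?I = "{m + r * a | m r. m \<in> max_ideal}"
  have "x \<in> ?I" if "x \<in> max_ideal" for x
    using that by (intro CollectI exI[of _ x] exI[of _ 0]) simp
  then have sub: "max_ideal \<subseteq> ?I" by blast
  have "proper_ideal ?I"
    unfolding proper_ideal_def
  proof (intro conjI ballI allI notI)
    show "0 \<in> ?I" using sub max_ideal_simps(1) by blast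
  next
    assume "1 \<in> ?I"
    then obtain m r where mr: "1 = m + r * a" and m: "m \<in> max_ideal" by blast
    from mr have "a * r - 1 = - m" by (simp add: algebra_simps)
    with max_ideal_simps(6)[OF m] have "a * r - 1 \<in> max_ideal" by metis
    then show False using no by blast
  next
    fix x y assume "x \<in> ?I" "y \<in> ?I"
    then obtain m r m' r' where "x = m + r * a" "m \<in> max_ideal" "y = m' + r' * a" "m' \<in> max_ideal"
      by blast
    then show "x + y \<in> ?I"
      by (intro CollectI exI[of _ "m + m'"] exI[of _ "r + r'"])
        (auto simp: algebra_simps intro: max_ideal_simps)
  next
    fix x s assume "x \<in> ?I"
    then obtain m r where "x = m + r * a" "m \<in> max_ideal" by blast
    then show "s * x \<in> ?I"
      by (intro CollectI exI[of _ "s * m"] exI[of _ "s * r"])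
        (auto simp: algebra_simps intro: max_ideal_simps)
  qed
  from max_ideal(2)[OF this sub] have "?I = max_ideal" .
  moreover have "a \<in> ?I"
    by (intro CollectI exI[of _ 0] exI[of _ 1]) (simp add: max_ideal_simps)
  ultimately show False using assms by blast
qed

quotient_type (overloaded) 'a residue = "'a::comm_ring_1" / "\<lambda>a b. a - b \<in> max_ideal"
proof (rule equivpI)
  show "reflp (\<lambda>a b. a - b \<in> (max_ideal :: 'a set))"
    by (auto simp: reflp_def max_ideal_simps)
  show "symp (\<lambda>a b. a - b \<in> (max_ideal :: 'a set))"
    using max_ideal_simps(6) by (fastforce simp: symp_def)
  show "transp (\<lambda>a b. a - b \<in> (max_ideal :: 'a set))"
    using max_ideal_simps(3) by (fastforce simp: transp_def)
qed

instantiation residue :: (comm_ring_1) field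
begin

lift_definition zero_residue :: "'a residue" is 0 .
lift_definition one_residue :: "'a residue" is 1 .
lift_definition plus_residue :: "'a residue \<Rightarrow> 'a residue \<Rightarrow> 'a residue" is "(+)"
  by (metis add_diff_add max_ideal_simps(3))
lift_definition minus_residue :: "'a residue \<Rightarrow> 'a residue \<Rightarrow> 'a residue" is "(-)"
proof -
  fix a b c d :: 'a assume "a - b \<in> max_ideal" "c - d \<in> max_ideal"
  then have "(a - b) - (c - d) \<in> max_ideal" by (rule max_ideal_simps)
  then show "a - c - (b - d) \<in> max_ideal" by (simp add: algebra_simps)
qed
lift_definition uminus_residue :: "'a residue \<Rightarrow> 'a residue" is uminus
  by (metis minus_diff_minus max_ideal_simps(6))
lift_definition times_residue :: "'a residue \<Rightarrow> 'a residue \<Rightarrow> 'a residue" is "(*)"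
proof -
  fix a b c d :: 'a assume "a - b \<in> max_ideal" "c - d \<in> max_ideal"
  then have "(a - b) * c + b * (c - d) \<in> max_ideal" by (blast intro: max_ideal_simps(3,4,5))
  then show "a * c - b * d \<in> max_ideal" by (simp add: algebra_simps)
qed
lift_definition inverse_residue :: "'a residue \<Rightarrow> 'a residue"
  is "\<lambda>a. if a \<in> max_ideal then 0 else SOME b. a * b - 1 \<in> max_ideal"
proof -
  fix a b :: 'a assume ab: "a - b \<in> max_ideal"
  define c where "c = (SOME c. a * c - 1 \<in> max_ideal)"
  define d where "d = (SOME c. b * c - 1 \<in> max_ideal)"
  have iff: "a \<in> max_ideal \<longleftrightarrow> b \<in> max_ideal"
    using ab max_ideal_simps(3)[of "a - b" b] max_ideal_simps(7)[of a "a - b"] by auto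
  have "c - d \<in> max_ideal" if "a \<notin> max_ideal"
  proof -
    have "a * c - 1 \<in> max_ideal" "b * d - 1 \<in> max_ideal"
      unfolding c_def d_def using max_ideal_inverse that iff by (metis (no_types, lifting) someI_ex)+
    \<comment> \<open>Expanding the products, this combination equals \<open>c - d\<close>: the
      inverses chosen for two representatives agree modulo the maximal ideal.\<close>
    then have "d * (a * c - 1) - c * (b * d - 1) - (a - b) * (c * d) \<in> max_ideal"
      using ab by (blast intro: max_ideal_simps(4,5,7))
    then show ?thesis by (simp add: algebra_simps)
  qed
  then show "(if a \<in> max_ideal then 0 else c) - (if b \<in> max_ideal then 0 else d) \<in> max_ideal"
    using iff by (auto simp: max_ideal_simps)
qed
definition divide_residue :: "'a residue \<Rightarrow> 'a residue \<Rightarrow> 'a residue"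
  where "divide_residue a b = a * inverse b"

instance
proof
  fix a b c :: "'a residue"
  show "a * b * c = a * (b * c)" "a * b = b * a" "1 * a = a" "a + b + c = a + (b + c)" "a + b = b + a"
    "0 + a = a" "- a + a = 0" "a - b = a + - b" "(a + b) * c = a * c + b * c"
    by (transfer; simp add: algebra_simps max_ideal_simps)+
  show "(0 :: 'a residue) \<noteq> 1"
    by transfer (use max_ideal_simps(2,6)[where 'a='a] in fastforce)
  show "inverse (0 :: 'a residue) = 0" by transfer (auto simp: max_ideal_simps)
  show "a div b = a * inverse b" by (simp add: divide_residue_def)
  have inv: "(if a \<in> max_ideal then 0 else SOME b. a * b - 1 \<in> max_ideal) * a - 1 \<in> max_ideal"
    if a: "a \<notin> max_ideal" for a :: 'a
  proof -
    have "a * (SOME b. a * b - 1 \<in> max_ideal) - 1 \<in> max_ideal"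
      using max_ideal_inverse[OF a] by (rule someI_ex)
    with a show "(if a \<in> max_ideal then 0 else SOME b. a * b - 1 \<in> max_ideal) * a - 1 \<in> max_ideal"
      by (simp add: mult.commute)
  qed
  then show "a \<noteq> 0 \<Longrightarrow> inverse a * a = 1" by transfer simp
qed

end

lift_definition to_residue :: "'a::comm_ring_1 \<Rightarrow> 'a residue" is "\<lambda>x. x" .

locale comm_ring_hom =
  fixes \<phi> :: "'a::comm_ring_1 \<Rightarrow> 'b::comm_ring_1"
  assumes hom_add: "\<phi> (x + y) = \<phi> x + \<phi> y"
    and hom_mult: "\<phi> (x * y) = \<phi> x * \<phi> y"
    and hom_1: "\<phi> 1 = 1"

lemma (in comm_ring_hom) hom_zero [simp]: "\<phi> 0 = 0"
  using hom_add[of 0 0] by simp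

lemma to_residue_hom: "comm_ring_hom to_residue"
  by standard (transfer; simp add: max_ideal_simps)+

section \<open>Finite generation of the quotient\<close>

text \<open>\<open>alg_quot\<close> is \<open>Quot\<close> with a scalar action added, so the known
  statement for images of ideals in \<open>Quot\<close> transfers through the shared ring
  operations.\<close>

lemma alg_quot_ideal:
  assumes "ring A" "ideal I A" "ideal J A"
  shows "ideal ((\<lambda>x. I +>\<^bsub>A\<^esub> x) ` J) (alg_quot A I)"
proof -
  interpret A: ring A by fact
  interpret I: ideal I A by fact
  have *: "ideal ((\<lambda>x. I +>\<^bsub>A\<^esub> x) ` J) (A Quot I)"
    by (rule A.ring_ideal_imp_quot_ideal[OF assms(2,3)])
  show ?thesis
  proof (rule idealI)
    show "ring (alg_quot A I)" by (rule alg_quot_ring[OF I.quotient_is_ring])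
    show "subgroup ((\<lambda>x. I +>\<^bsub>A\<^esub> x) ` J) (add_monoid (alg_quot A I))"
      using additive_subgroup.a_subgroup[OF ideal.axioms(1)[OF *]]
      by (simp add: subgroup_def m_inv_def alg_quot_simps)
  qed (use ideal.I_l_closed[OF *] ideal.I_r_closed[OF *] in \<open>auto simp: alg_quot_simps\<close>)
qed

lemma alg_quot_carrier: "carrier (alg_quot A I) = (\<lambda>x. I +>\<^bsub>A\<^esub> x) ` carrier A"
  by (auto simp: alg_quot_simps FactRing_def A_RCOSETS_def')

lemma alg_quot_add:
  assumes "ideal I A" "x \<in> carrier A" "y \<in> carrier A"
  shows "(I +>\<^bsub>A\<^esub> x) \<oplus>\<^bsub>alg_quot A I\<^esub> (I +>\<^bsub>A\<^esub> y) = I +>\<^bsub>A\<^esub> (x \<oplus>\<^bsub>A\<^esub> y)"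
proof -
  interpret ideal I A by fact
  show ?thesis using assms by (simp add: alg_quot_simps FactRing_def a_rcos_sum)
qed

lemma a_rcos_eq_imp_diff:
  assumes "ideal I A" "x \<in> carrier A" "y \<in> carrier A" "I +>\<^bsub>A\<^esub> x = I +>\<^bsub>A\<^esub> y"
  shows "x \<ominus>\<^bsub>A\<^esub> y \<in> I"
proof -
  interpret ideal I A by fact
  have "x \<in> I +>\<^bsub>A\<^esub> y" using a_rcos_self[OF assms(2)] assms(4) by simp
  then show ?thesis using a_rcos_module_minus[OF ring_axioms assms(3,2)] by simp
qed

context
  fixes Q :: "'i \<Rightarrow> 'i \<Rightarrow> 'k::comm_ring_1 poly poly" and \<beta> :: "'i lattice" and i :: 'i
begin

private abbreviation "\<F> \<equiv> free_algebra (klr_gens \<beta>) :: ('k, ('i klr_gen, 'k) free) module"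
private abbreviation "I1 \<equiv> klr_ideal Q \<beta>"
private abbreviation "A1 \<equiv> klr_algebra Q \<beta>"
private abbreviation "I2 \<equiv> Idl\<^bsub>A1\<^esub> {last_idem Q \<beta> i}"

lemma free_assoc_algebra: "assoc_algebra scalar_ring \<F>"
  by (simp add: assoc_algebra_def mult.assoc free_algebra_ring free_algebra_module)

lemma klr_ideal_ideal: "ideal I1 \<F>"
  unfolding klr_ideal_def by (rule ring.genideal_ideal[OF free_algebra_ring klr_relations_carrier])

lemma klr_assoc_algebra: "assoc_algebra scalar_ring A1"
  unfolding klr_algebra_def by (rule assoc_algebra_quot[OF free_assoc_algebra klr_ideal_ideal])

lemma last_idem_sum_carrier: "(\<Sum>\<nu> | \<nu> \<in> seqs \<beta> \<and> \<nu> \<noteq> [] \<and> entry \<nu> 1 = i. idem \<nu>) \<in> carrier \<F>"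
  by (auto simp: klr_gens_def intro!: free_carrier free_carrier_sum)

lemma last_idem_ideal: "ideal I2 A1"
proof -
  have "last_idem Q \<beta> i \<in> carrier A1"
    unfolding klr_algebra_def last_idem_def alg_quot_carrier by (rule imageI last_idem_sum_carrier)+
  then show ?thesis using klr_assoc_algebra
    by (intro ring.genideal_ideal) (auto simp: assoc_algebra_def)
qed

text \<open>The composite of the two quotient maps. It allows calculations in the quotient algebra
  to be made with representatives in the free algebra instead of cosets of cosets.\<close>

definition klr_quotient_class :: "('i klr_gen, 'k) free \<Rightarrow> ('i klr_gen, 'k) free set set"
  where "klr_quotient_class h = I2 +>\<^bsub>A1\<^esub> (I1 +>\<^bsub>\<F>\<^esub> h)"

lemma klr_class_carrier: "h \<in> carrier \<F> \<Longrightarrow> I1 +>\<^bsub>\<F>\<^esub> h \<in> carrier A1"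
  by (simp add: klr_algebra_def alg_quot_carrier)

lemma klr_quotient_carrier: "carrier (klr_quotient Q \<beta> i) = klr_quotient_class ` carrier \<F>"
  unfolding klr_quotient_def alg_quot_carrier klr_quotient_class_def
  by (simp add: klr_algebra_def alg_quot_carrier image_image)

lemma klr_quotient_class_add:
  assumes "h \<in> carrier \<F>" "h' \<in> carrier \<F>"
  shows "klr_quotient_class h \<oplus>\<^bsub>klr_quotient Q \<beta> i\<^esub> klr_quotient_class h' = klr_quotient_class (h + h')"
proof -
  have "(I1 +>\<^bsub>\<F>\<^esub> h) \<oplus>\<^bsub>A1\<^esub> (I1 +>\<^bsub>\<F>\<^esub> h') = I1 +>\<^bsub>\<F>\<^esub> (h + h')"
    unfolding klr_algebra_def using alg_quot_add[OF klr_ideal_ideal assms] by simp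
  then show ?thesis
    unfolding klr_quotient_def klr_quotient_class_def
    using alg_quot_add[OF last_idem_ideal klr_class_carrier klr_class_carrier] assms by simp
qed

lemma klr_quotient_class_scale:
  assumes "h \<in> carrier \<F>"
  shows "c \<odot>\<^bsub>klr_quotient Q \<beta> i\<^esub> klr_quotient_class h = klr_quotient_class (scalar c * h)"
proof -
  have c: "c \<in> carrier scalar_ring" by (simp add: scalar_ring_def)
  have "c \<odot>\<^bsub>A1\<^esub> (I1 +>\<^bsub>\<F>\<^esub> h) = I1 +>\<^bsub>\<F>\<^esub> (scalar c * h)"
    unfolding klr_algebra_def
    using alg_quot_smult[OF free_assoc_algebra klr_ideal_ideal c assms] by simp
  then show ?thesis
    unfolding klr_quotient_def klr_quotient_class_def
    using alg_quot_smult[OF klr_assoc_algebra last_idem_ideal c klr_class_carrier] assms by simp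
qed

lemma klr_quotient_class_sum:
  assumes "finite S" "\<And>s. s \<in> S \<Longrightarrow> f s \<in> carrier \<F>"
  shows "(\<Oplus>\<^bsub>klr_quotient Q \<beta> i\<^esub>s\<in>S. klr_quotient_class (f s)) = klr_quotient_class (\<Sum>s\<in>S. f s)"
proof -
  interpret M: module scalar_ring "klr_quotient Q \<beta> i" by (rule klr_quotient_module)
  have car: "klr_quotient_class h \<in> carrier (klr_quotient Q \<beta> i)" if "h \<in> carrier \<F>" for h
    using that by (simp add: klr_quotient_carrier)
  have 0: "klr_quotient_class 0 = \<zero>\<^bsub>klr_quotient Q \<beta> i\<^esub>"
  proof -
    have z: "(0 :: ('i klr_gen, 'k) free) \<in> carrier \<F>" by (rule free_carrier)
    have "klr_quotient_class 0 \<oplus>\<^bsub>klr_quotient Q \<beta> i\<^esub> klr_quotient_class 0 = klr_quotient_class 0"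
      using klr_quotient_class_add[OF z z] by simp
    then show ?thesis using car[OF z] by (metis M.add.l_cancel_one)
  qed
  from assms show ?thesis
  proof (induction S rule: finite_induct)
    case empty
    then show ?case by (simp add: 0)
  next
    case (insert s S)
    then show ?case
      by (subst M.finsum_insert) (simp_all add: car klr_quotient_class_add free_carrier_sum Pi_def)
  qed
qed

text \<open>\<open>J\<close> contains the kernel of the composite quotient map: minimality of
  generated ideals gives first \<open>I1 \<subseteq> J\<close> and then \<open>I2\<close> inside the
  image of \<open>J\<close>. Lifting back changes the element only by a member of \<open>I1\<close>,
  which is again in \<open>J\<close>.\<close>

lemma klr_quotient_class_eqD:
  assumes J: "ideal J \<F>" "klr_relations Q \<beta> \<subseteq> J"
      "(\<Sum>\<nu> | \<nu> \<in> seqs \<beta> \<and> \<nu> \<noteq> [] \<and> entry \<nu> 1 = i. idem \<nu>) \<in> J"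
    and h: "h \<in> carrier \<F>" "h' \<in> carrier \<F>"
    and eq: "klr_quotient_class h = klr_quotient_class h'"
  shows "h - h' \<in> J"
proof -
  interpret F: ring \<F> by (rule free_algebra_ring)
  interpret J: ideal J \<F> by fact
  interpret A1: ring A1 using klr_assoc_algebra by (simp add: assoc_algebra_def)
  have I1J: "I1 \<subseteq> J" unfolding klr_ideal_def by (rule F.genideal_minimal[OF J(1,2)])
  have minus: "a_inv \<F> x = - x" if "x \<in> carrier \<F>" for x
    using F.minus_equality[of "- x" x] that free_carrier(7)[OF that] by simp
  have *: "(I1 +>\<^bsub>\<F>\<^esub> h) \<ominus>\<^bsub>A1\<^esub> (I1 +>\<^bsub>\<F>\<^esub> h') \<in> I2"
    using a_rcos_eq_imp_diff[OF last_idem_ideal klr_class_carrier klr_class_carrier] h eq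
    by (simp add: klr_quotient_class_def)
  have "(I1 +>\<^bsub>\<F>\<^esub> (h - h')) \<oplus>\<^bsub>A1\<^esub> (I1 +>\<^bsub>\<F>\<^esub> h') = I1 +>\<^bsub>\<F>\<^esub> h"
    unfolding klr_algebra_def using alg_quot_add[OF klr_ideal_ideal free_carrier(6)[OF h] h(2)] by simp
  then have "(I1 +>\<^bsub>\<F>\<^esub> h) \<ominus>\<^bsub>A1\<^esub> (I1 +>\<^bsub>\<F>\<^esub> h') = I1 +>\<^bsub>\<F>\<^esub> (h - h')"
    using klr_class_carrier[OF free_carrier(6)[OF h]] klr_class_carrier[OF h(2)]
    by (metis A1.a_assoc A1.minus_eq A1.r_neg A1.r_zero A1.a_inv_closed)
  moreover have "I2 \<subseteq> (\<lambda>x. I1 +>\<^bsub>\<F>\<^esub> x) ` J"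
  proof (rule A1.genideal_minimal)
    show "ideal ((\<lambda>x. I1 +>\<^bsub>\<F>\<^esub> x) ` J) A1"
      unfolding klr_algebra_def by (rule alg_quot_ideal[OF free_algebra_ring klr_ideal_ideal J(1)])
    show "{last_idem Q \<beta> i} \<subseteq> (\<lambda>x. I1 +>\<^bsub>\<F>\<^esub> x) ` J"
      using J(3) by (auto simp: last_idem_def)
  qed
  ultimately obtain j where j: "j \<in> J" "I1 +>\<^bsub>\<F>\<^esub> (h - h') = I1 +>\<^bsub>\<F>\<^esub> j" using * by auto
  have jc: "j \<in> carrier \<F>" using j(1) by (rule J.a_Hcarr)
  have "(h - h') \<ominus>\<^bsub>\<F>\<^esub> j \<in> I1"
    by (rule a_rcos_eq_imp_diff[OF klr_ideal_ideal free_carrier(6)[OF h] jc j(2)])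
  then have "((h - h') \<ominus>\<^bsub>\<F>\<^esub> j) \<oplus>\<^bsub>\<F>\<^esub> j \<in> J"
    using I1J j(1) by (intro J.a_closed) auto
  then show ?thesis by (simp add: F.minus_eq minus[OF jc])
qed

text \<open>The free algebra modulo \<open>J\<close> is a quotient of \<open>klr_quotient\<close>,
  so representatives of finitely many generators still generate it over \<open>K\<close>. The
  generators in \<open>S\<close> themselves serve from here on only as indices.\<close>

lemma finitely_generated_klr_quotientD:
  assumes "finitely_generated_module scalar_ring (klr_quotient Q \<beta> i)"
  assumes J: "ideal J \<F>" "klr_relations Q \<beta> \<subseteq> J"
      "(\<Sum>\<nu> | \<nu> \<in> seqs \<beta> \<and> \<nu> \<noteq> [] \<and> entry \<nu> 1 = i. idem \<nu>) \<in> J"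
  obtains S :: "('i klr_gen, 'k) free set set set" and r
  where "finite S" "\<And>s. s \<in> S \<Longrightarrow> r s \<in> carrier \<F>"
    "\<And>h. h \<in> carrier \<F> \<Longrightarrow> \<exists>a. h - (\<Sum>s\<in>S. scalar (a s) * r s) \<in> J"
proof -
  obtain S where S: "finite S" "S \<subseteq> carrier (klr_quotient Q \<beta> i)" and
    gen: "\<And>m. m \<in> carrier (klr_quotient Q \<beta> i) \<Longrightarrow> \<exists>a\<in>S \<rightarrow> carrier scalar_ring.
      m = (\<Oplus>\<^bsub>klr_quotient Q \<beta> i\<^esub>s\<in>S. a s \<odot>\<^bsub>klr_quotient Q \<beta> i\<^esub> s)"
    using assms(1) unfolding finitely_generated_module_def by blast
  have "\<forall>s\<in>S. \<exists>h. h \<in> carrier \<F> \<and> klr_quotient_class h = s"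
    using S(2) by (auto simp: klr_quotient_carrier)
  then obtain r where r: "\<And>s. s \<in> S \<Longrightarrow> r s \<in> carrier \<F>" "\<And>s. s \<in> S \<Longrightarrow> klr_quotient_class (r s) = s"
    by metis
  show thesis
  proof (rule that[OF S(1) r(1)])
    fix h assume h: "h \<in> carrier \<F>"
    then have "klr_quotient_class h \<in> carrier (klr_quotient Q \<beta> i)" by (simp add: klr_quotient_carrier)
    from gen[OF this] obtain a where
      "klr_quotient_class h = (\<Oplus>\<^bsub>klr_quotient Q \<beta> i\<^esub>s\<in>S. a s \<odot>\<^bsub>klr_quotient Q \<beta> i\<^esub> s)" by blast
    also have "\<dots> = (\<Oplus>\<^bsub>klr_quotient Q \<beta> i\<^esub>s\<in>S. klr_quotient_class (scalar (a s) * r s))"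
    proof -
      interpret M: module scalar_ring "klr_quotient Q \<beta> i" by (rule klr_quotient_module)
      have "a s \<odot>\<^bsub>klr_quotient Q \<beta> i\<^esub> s = klr_quotient_class (scalar (a s) * r s)" if "s \<in> S" for s
        using klr_quotient_class_scale[OF r(1)[OF that], of "a s"] r(2)[OF that] by simp
      then show ?thesis
        by (intro M.finsum_cong') (auto simp: klr_quotient_carrier r(1) intro!: imageI free_carrier)
    qed
    also have "\<dots> = klr_quotient_class (\<Sum>s\<in>S. scalar (a s) * r s)"
      using S(1) r(1) by (intro klr_quotient_class_sum) (auto intro: free_carrier)
    finally have "h - (\<Sum>s\<in>S. scalar (a s) * r s) \<in> J"
      using r(1) h by (intro klr_quotient_class_eqD[OF J]) (auto intro!: free_carrier free_carrier_sum)
    then show "\<exists>a. h - (\<Sum>s\<in>S. scalar (a s) * r s) \<in> J" by blast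
  qed
qed

end

section \<open>Actions of the free algebra\<close>

text \<open>Any choice of linear operators for the generators extends to the free algebra. Linearity
  is over the target ring of \<open>\<phi>\<close>, which is larger than what an action of
  \<open>K\<close> alone would give.\<close>

locale free_action = comm_ring_hom \<phi>
  for \<phi> :: "'k::comm_ring_1 \<Rightarrow> 'f::comm_ring_1" +
  fixes T :: "'g \<Rightarrow> ('w \<Rightarrow> 'f) \<Rightarrow> 'w \<Rightarrow> 'f"
  assumes T_add: "T g (\<lambda>w. f w + f' w) = (\<lambda>w. T g f w + T g f' w)"
    and T_scale: "T g (\<lambda>w. c * f w) = (\<lambda>w. c * T g f w)"
begin

definition act :: "('g, 'k) free \<Rightarrow> ('w \<Rightarrow> 'f) \<Rightarrow> 'w \<Rightarrow> 'f"
  where "act h f = (\<lambda>w. \<Sum>u\<in>Poly_Mapping.keys h. \<phi> (Poly_Mapping.lookup h u) * foldr T u f w)"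

lemma act_superset:
  assumes "finite A" "Poly_Mapping.keys h \<subseteq> A"
  shows "act h f w = (\<Sum>u\<in>A. \<phi> (Poly_Mapping.lookup h u) * foldr T u f w)"
  unfolding act_def using assms by (intro sum.mono_neutral_left) (auto simp: in_keys_iff)

lemma act_plus: "act (p + q) f w = act p f w + act q f w"
proof -
  let ?A = "Poly_Mapping.keys p \<union> Poly_Mapping.keys q"
  have "act (p + q) f w = (\<Sum>u\<in>?A. \<phi> (Poly_Mapping.lookup (p + q) u) * foldr T u f w)"
    by (rule act_superset) (auto dest: subsetD[OF Poly_Mapping.keys_add])
  also have "\<dots> = act p f w + act q f w"
    by (subst (1 2) act_superset[of ?A]) (auto simp: lookup_add hom_add algebra_simps sum.distrib)
  finally show ?thesis .
qed

lemma act_zero [simp]: "act 0 f w = 0"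
  by (simp add: act_def)

lemma act_sum: "act (\<Sum>x\<in>A. h x) f w = (\<Sum>x\<in>A. act (h x) f w)"
  by (induction A rule: infinite_finite_induct) (auto simp: act_plus)

lemma act_single: "act (Poly_Mapping.single u c) f w = \<phi> c * foldr T u f w"
  by (simp add: act_def)

lemma act_scalar [simp]: "act (scalar c) f w = \<phi> c * f w"
  by (simp add: scalar_def act_single)

lemma act_one [simp]: "act 1 f w = f w"
  using act_scalar[of 1] by (simp add: scalar_simps hom_1)

lemma act_gen [simp]: "act (gen g) f = T g f"
  by (rule ext) (simp add: gen_def act_single hom_1)

lemma act_diff: "act (p - q) f w = act p f w - act q f w"
  using act_plus[of "p - q" q] by (simp add: algebra_simps)

lemma act_uminus: "act (- p) f w = - act p f w"
  using act_diff[of 0 p] by simp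

lemma foldr_add: "foldr T u (\<lambda>w. f w + f' w) = (\<lambda>w. foldr T u f w + foldr T u f' w)"
  by (induction u) (simp_all add: T_add)

lemma foldr_scale: "foldr T u (\<lambda>w. c * f w) = (\<lambda>w. c * foldr T u f w)"
  by (induction u) (simp_all add: T_scale)

lemma foldr_zero: "foldr T u (\<lambda>w. 0) = (\<lambda>w. 0)"
  using foldr_scale[of u 0 "\<lambda>w. 0"] by simp

lemma foldr_sum: "foldr T u (\<lambda>w. \<Sum>x\<in>A. F x w) = (\<lambda>w. \<Sum>x\<in>A. foldr T u (F x) w)"
  by (induction A rule: infinite_finite_induct) (simp_all add: foldr_zero foldr_add)

text \<open>Products of words are concatenations, and \<open>foldr\<close> turns concatenation into
  composition of operators. Linearity reduces the claim to this case.\<close>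

lemma act_mult: "act (p * q) f = act p (act q f)"
proof (rule ext)
  fix w
  let ?P = "Poly_Mapping.keys p" and ?Q = "Poly_Mapping.keys q"
  let ?s = "Poly_Mapping.single" and ?l = "Poly_Mapping.lookup"
  \<comment> \<open>Every element is the finite sum of its monomials, so the product can be expanded
    word by word.\<close>
  have dec: "(\<Sum>u\<in>Poly_Mapping.keys r. ?s u (?l r u)) = r" for r :: "('g, 'k) free"
    by (rule poly_mapping_eqI) (auto simp: lookup_sum lookup_single when_def in_keys_iff)
  have "p * q = (\<Sum>u\<in>?P. ?s u (?l p u)) * (\<Sum>v\<in>?Q. ?s v (?l q v))"
    by (simp only: dec)
  also have "\<dots> = (\<Sum>u\<in>?P. \<Sum>v\<in>?Q. ?s (u @ v) (?l p u * ?l q v))"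
    by (simp add: sum_product mult_single plus_list_def)
  finally have "act (p * q) f w = (\<Sum>u\<in>?P. \<Sum>v\<in>?Q. \<phi> (?l p u) * (\<phi> (?l q v) * foldr T u (foldr T v f) w))"
    by (simp add: act_sum act_single hom_mult mult_ac)
  also have "\<dots> = (\<Sum>u\<in>?P. \<phi> (?l p u) * foldr T u (\<lambda>w. \<Sum>v\<in>?Q. \<phi> (?l q v) * foldr T v f w) w)"
    by (simp add: sum_distrib_left foldr_sum foldr_scale)
  finally show "act (p * q) f w = act p (act q f) w"
    by (simp add: act_def)
qed

end

section \<open>Exchanges of neighbours in a list\<close>

lemma length_swap_seq [simp]: "length (swap_seq k w) = length w"
  by (simp add: swap_seq_def)

text \<open>Entries are numbered from 1 but list positions from 0, so \<open>swap_seq k\<close>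
  exchanges the positions \<open>k - 1\<close> and \<open>k\<close>. This shift persists in all
  operators below.\<close>

lemma nth_swap_seq:
  "\<lbrakk>1 \<le> k; k < length w; m < length w\<rbrakk> \<Longrightarrow> swap_seq k w ! m = w ! transpose (k - 1) k m"
  unfolding swap_seq_def
  by (rule permute_list_nth) (auto intro: permutes_swap_id)

lemma transpose_less: "\<lbrakk>a < n; b < n; m < n\<rbrakk> \<Longrightarrow> transpose a b m < (n::nat)"
  by (simp add: transpose_def)

lemma map_swap_seq: "\<lbrakk>1 \<le> k; k < length w\<rbrakk> \<Longrightarrow> map f (swap_seq k w) = swap_seq k (map f w)"
  by (rule nth_equalityI) (auto simp: nth_swap_seq transpose_less)

lemma swap_seq_swap_seq: "\<lbrakk>1 \<le> k; k < length w\<rbrakk> \<Longrightarrow> swap_seq k (swap_seq k w) = w"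
  by (rule nth_equalityI) (auto simp: nth_swap_seq transpose_less)

lemma swap_seq_commute:
  "\<lbrakk>1 \<le> k; k + 1 < l; l < length w\<rbrakk> \<Longrightarrow> swap_seq k (swap_seq l w) = swap_seq l (swap_seq k w)"
  by (rule nth_equalityI) (auto simp: nth_swap_seq transpose_def)

lemma swap_seq_braid:
  "\<lbrakk>1 \<le> k; k + 1 < length w\<rbrakk> \<Longrightarrow> swap_seq k (swap_seq (k + 1) (swap_seq k w)) =
    swap_seq (k + 1) (swap_seq k (swap_seq (k + 1) w))"
  by (rule nth_equalityI) (auto simp: nth_swap_seq transpose_def)

section \<open>Functions on the orderings of coloured points\<close>

lemma bieval_zero: "bieval \<psi> 0 x y = \<psi> 0"
  by (simp add: bieval_def bicoeff_def)

text \<open>An ordering is a list \<open>w\<close> of points \<open>p\<close> with colour \<open>col p\<close> and value \<open>val p\<close>. The polynomials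
  \<open>Q + eps D\<close> are the deformation of \<open>Q\<close>, and \<open>R\<close> is the ring of integers. Assumption \<open>Om_swap\<close> says that
  an exchange that leads from \<open>Om\<close> out of \<open>Om\<close> has coefficient 0, so that the functions vanishing on
  \<open>Om\<close> form a submodule.\<close>

locale klr_points = comm_ring_hom \<phi>
  for \<phi> :: "'k::comm_ring_1 \<Rightarrow> 'f::field" +
  fixes Q :: "'i \<Rightarrow> 'i \<Rightarrow> 'k poly poly" and \<beta> :: "'i lattice"
    and R :: "'f set" and eps :: 'f
    and D :: "'i \<Rightarrow> 'i \<Rightarrow> 'f poly poly" and prec :: "'i \<Rightarrow> 'i \<Rightarrow> bool"
    and col :: "'p \<Rightarrow> 'i" and val :: "'p \<Rightarrow> 'f" and W Om :: "'p list set"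
  assumes R: "1 \<in> R" "a \<in> R \<Longrightarrow> b \<in> R \<Longrightarrow> a + b \<in> R" "a \<in> R \<Longrightarrow> b \<in> R \<Longrightarrow> a * b \<in> R" "a \<in> R \<Longrightarrow> - a \<in> R"
    and R_\<phi>: "\<phi> c \<in> R" and R_val: "val p \<in> R" and R_D: "bicoeff (D a' b') s t \<in> R"
    and R_eps: "eps \<in> R"
    and W_seqs: "w \<in> W \<Longrightarrow> map col w \<in> seqs \<beta>"
    and W_swap: "w \<in> W \<Longrightarrow> 1 \<le> k \<Longrightarrow> k < height \<beta> \<Longrightarrow> swap_seq k w \<in> W"
    and val_inj: "w \<in> W \<Longrightarrow> k < height \<beta> \<Longrightarrow> l < height \<beta> \<Longrightarrow> k \<noteq> l \<Longrightarrow> col (w ! k) = col (w ! l) \<Longrightarrow> val (w ! k) \<noteq> val (w ! l)"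
    and Q_diag: "Q j j = 0"
    and Q_sym: "bieval \<phi> (Q a' b') x y = bieval \<phi> (Q b' a') y x"
    and D_sym: "bieval id (D a' b') x y = bieval id (D b' a') y x"
    and prec: "a' \<noteq> b' \<Longrightarrow> prec a' b' \<longleftrightarrow> \<not> prec b' a'"
    and Om_W: "Om \<subseteq> W"
    and Om_swap: "w \<in> Om \<Longrightarrow> 1 \<le> k \<Longrightarrow> k < height \<beta> \<Longrightarrow> swap_seq k w \<notin> Om \<Longrightarrow>
      col (w ! (k - 1)) \<noteq> col (w ! k) \<and> prec (col (w ! (k - 1))) (col (w ! k)) \<and>
      bieval \<phi> (Q (col (w ! (k - 1))) (col (w ! k))) (val (w ! (k - 1))) (val (w ! k)) +
        eps * bieval id (D (col (w ! (k - 1))) (col (w ! k))) (val (w ! (k - 1))) (val (w ! k)) = 0"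
begin

abbreviation "n \<equiv> height \<beta>"

definition Qt :: "'i \<Rightarrow> 'i \<Rightarrow> 'f \<Rightarrow> 'f \<Rightarrow> 'f"
  where "Qt a b x y = bieval \<phi> (Q a b) x y + eps * bieval id (D a b) x y"

text \<open>The relations only constrain the product \<open>cross p q * cross q p\<close>, so the factor \<open>Qt\<close> may be
  put on either side.\<close>

definition cross :: "'p \<Rightarrow> 'p \<Rightarrow> 'f"
  where "cross p q = (if prec (col p) (col q) then Qt (col p) (col q) (val p) (val q) else 1)"

text \<open>The divided difference part of \<open>tau_op\<close>, kept apart because its integrality
  needs a proof by the Leibniz rule. On \<open>W\<close> the denominator is nonzero by
  \<open>val_inj\<close>.\<close>

definition demazure :: "nat \<Rightarrow> ('p list \<Rightarrow> 'f) \<Rightarrow> 'p list \<Rightarrow> 'f"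
  where "demazure k f w = (if col (w ! (k - 1)) = col (w ! k)
     then (f (swap_seq k w) - f w) / (val (w ! (k - 1)) - val (w ! k)) else 0)"

definition tau_op :: "nat \<Rightarrow> ('p list \<Rightarrow> 'f) \<Rightarrow> 'p list \<Rightarrow> 'f"
  where "tau_op k f w = (if col (w ! (k - 1)) = col (w ! k)
     then (f (swap_seq k w) - f w) / (val (w ! (k - 1)) - val (w ! k))
     else cross (w ! (k - 1)) (w ! k) * f (swap_seq k w))"

text \<open>Indices out of range act by the default 0, which keeps every operator linear and lets
  all of them preserve the integral functions defined later.\<close>

fun gen_op :: "'i klr_gen \<Rightarrow> ('p list \<Rightarrow> 'f) \<Rightarrow> 'p list \<Rightarrow> 'f" where
  "gen_op (Idem_Gen \<nu>) f w = (if map col w = \<nu> then f w else 0)"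
| "gen_op (X_Gen k) f w = (if k \<in> {1..n} then val (w ! (k - 1)) * f w else 0)"
| "gen_op (Tau_Gen k) f w = (if k \<in> {1..<n} then tau_op k f w else 0)"

sublocale free_action \<phi> gen_op
proof
  show "gen_op g (\<lambda>w. f w + f' w) = (\<lambda>w. gen_op g f w + gen_op g f' w)" for g f f'
    by (cases g) (auto simp: tau_op_def fun_eq_iff field_simps add_divide_distrib diff_divide_distrib)
  show "gen_op g (\<lambda>w. c * f w) = (\<lambda>w. c * gen_op g f w)" for g c f
    by (cases g) (auto simp: tau_op_def fun_eq_iff right_diff_distrib)
qed

lemma W_length: "w \<in> W \<Longrightarrow> length w = n"
  using W_seqs[of w] by (simp add: seqs_def)

lemma Qt_sym: "Qt a b x y = Qt b a y x"
  unfolding Qt_def using Q_sym D_sym by metis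

lemma cross_mult: "col p \<noteq> col q \<Longrightarrow> cross p q * cross q p = Qt (col p) (col q) (val p) (val q)"
  using prec[of "col p" "col q"] by (auto simp: cross_def Qt_sym[of "col q"])

section \<open>The relations between the operators \<open>tau_op\<close> and the values\<close>

lemma tau_op_eval:
  assumes "w ! (k - 1) = p" "w ! k = q" "swap_seq k w = v"
  shows "tau_op k f w = (if col p = col q then (f v - f w) / (val p - val q) else cross p q * f v)"
  using assms by (auto simp: tau_op_def)

lemma tau_op_square:
  assumes w: "w \<in> W" and k: "1 \<le> k" "k < n"
  shows "tau_op k (tau_op k f) w = (if col (w ! (k - 1)) = col (w ! k) then 0
    else Qt (col (w ! (k - 1))) (col (w ! k)) (val (w ! (k - 1))) (val (w ! k)) * f w)"
proof -
  define v p q where "v = swap_seq k w" and "p = w ! (k - 1)" and "q = w ! k"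
  have v: "v ! (k - 1) = q" "v ! k = p" "swap_seq k v = w"
    unfolding v_def p_def q_def using k W_length[OF w] by (simp_all add: nth_swap_seq swap_seq_swap_seq)
  have 1: "tau_op k g w = (if col p = col q then (g v - g w) / (val p - val q) else cross p q * g v)" for g
    by (rule tau_op_eval) (simp_all add: v_def p_def q_def)
  have 2: "tau_op k g v = (if col q = col p then (g w - g v) / (val q - val p) else cross q p * g w)" for g
    by (rule tau_op_eval) (rule v)+
  \<comment> \<open>For equal colours, a divided difference takes the same value at \<open>w\<close>
    and at its exchange \<open>v\<close>, so applying the operator a second time gives 0.\<close>
  have 3: "(f w - f v) / (val q - val p) = (f v - f w) / (val p - val q)"
    by (metis minus_diff_eq minus_divide_divide)
  show ?thesis
    unfolding p_def[symmetric] q_def[symmetric] 1 2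
    using cross_mult[of p q] by (auto simp: mult.assoc[symmetric] 3)
qed

text \<open>The twisted Leibniz rule. For equal colours, moving the value past the divided
  difference leaves \<open>f w\<close> times a quotient of two opposite or equal differences of
  values, which is the correction -1 or 1; for different colours nothing is left.\<close>

lemma tau_op_val:
  assumes w: "w \<in> W" and k: "1 \<le> k" "k < n" and l: "1 \<le> l" "l \<le> n"
  shows "tau_op k (\<lambda>w. val (w ! (l - 1)) * f w) w =
    val (w ! (transpose k (k + 1) l - 1)) * tau_op k f w +
    (if l = k + 1 \<and> col (w ! (k - 1)) = col (w ! k) then f w
     else if l = k \<and> col (w ! (k - 1)) = col (w ! k) then - f w else 0)"
proof -
  define v p q where "v = swap_seq k w" and "p = w ! (k - 1)" and "q = w ! k"
  have ev: "tau_op k g w = (if col p = col q then (g v - g w) / (val p - val q) else cross p q * g v)" for g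
    by (rule tau_op_eval) (simp_all add: v_def p_def q_def)
  have v: "v ! (l - 1) = w ! (transpose k (k + 1) l - 1)"
    unfolding v_def using k l W_length[OF w] by (auto simp: nth_swap_seq transpose_def)
  have neq: "val p - val q \<noteq> 0" if "col p = col q"
    unfolding p_def q_def
    using val_inj[OF w, of "k - 1" k] k that by (simp add: p_def q_def)
  consider "l = k" | "l = k + 1" | "l \<noteq> k" "l \<noteq> k + 1" by blast
  then show ?thesis
  proof cases
    case 1
    then have "w ! (l - 1) = p" "w ! (transpose k (k + 1) l - 1) = q" by (simp_all add: p_def q_def)
    then show ?thesis
      unfolding ev v p_def[symmetric] q_def[symmetric] using 1 neq by (auto simp: field_simps)
  next
    case 2
    then have "w ! (l - 1) = q" "w ! (transpose k (k + 1) l - 1) = p" by (simp_all add: p_def q_def)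
    then show ?thesis
      unfolding ev v p_def[symmetric] q_def[symmetric] using 2 neq by (auto simp: field_simps)
  next
    case 3
    then have "transpose k (k + 1) l = l" by (simp add: transpose_def)
    then show ?thesis
      unfolding ev v p_def[symmetric] q_def[symmetric] using 3 by (auto simp: right_diff_distrib)
  qed
qed

lemma tau_op_commute:
  assumes w: "w \<in> W" and k: "1 \<le> k" "k + 1 < l" "l < n"
  shows "tau_op k (tau_op l f) w = tau_op l (tau_op k f) w"
proof -
  define v z p q r t where "v = swap_seq k w" and "z = swap_seq l w"
    and "p = w ! (k - 1)" and "q = w ! k" and "r = w ! (l - 1)" and "t = w ! l"
  note defs = v_def z_def p_def q_def r_def t_def
  have 1: "v ! (l - 1) = r" "v ! l = t" "z ! (k - 1) = p" "z ! k = q"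
      "w ! (k - 1) = p" "w ! k = q" "w ! (l - 1) = r" "w ! l = t" "swap_seq k w = v" "swap_seq l w = z"
    using k W_length[OF w] by (auto simp: defs nth_swap_seq transpose_def)
  have 2: "swap_seq k z = swap_seq l v"
    unfolding defs using k W_length[OF w] by (intro swap_seq_commute) simp_all
  have ev:
    "tau_op k g w = (if col p = col q then (g v - g w) / (val p - val q) else cross p q * g v)"
    "tau_op l g w = (if col r = col t then (g z - g w) / (val r - val t) else cross r t * g z)"
    "tau_op l g v = (if col r = col t then (g (swap_seq l v) - g v) / (val r - val t) else cross r t * g (swap_seq l v))"
    "tau_op k g z = (if col p = col q then (g (swap_seq l v) - g z) / (val p - val q) else cross p q * g (swap_seq l v))"
    for g by (rule tau_op_eval; simp only: 1 2)+
  show ?thesis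
    by (simp add: ev diff_divide_distrib right_diff_distrib mult.commute mult.left_commute)
qed

text \<open>The braid relation for divided differences, with \<open>u\<close>, \<open>v\<close>, \<open>t\<close> the inverses of the three differences.\<close>

lemma demazure_braid:
  fixes u v t :: "'a::comm_ring_1"
  assumes "u * v = t * (u + v)"
  shows "(((a - b) * u + (w - c) * v) * t - ((d - e) * t - (c - w) * v) * u) * v =
    (((a - d) * v + (w - e) * u) * t - ((b - c) * t - (e - w) * u) * v) * u"
    (is "?l = ?r")
proof -
  have "?l = ?r + (u * v - t * (u + v)) * (w * (u - v) + c * v - e * u)"
    by (simp add: algebra_simps)
  then show ?thesis using assms by simp
qed

text \<open>Both sides are expanded over the orderings obtained from \<open>w\<close> by permuting
  three neighbours, and compared according to which colours agree. Only the pattern with equal outer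
  colours and a different middle one produces a correction.\<close>

lemma tau_op_braid:
  assumes w: "w \<in> W" and k: "1 \<le> k" "k + 1 < n"
  shows "tau_op (k + 1) (tau_op k (tau_op (k + 1) f)) w - tau_op k (tau_op (k + 1) (tau_op k f)) w =
    (if col (w ! (k - 1)) = col (w ! (k + 1)) \<and> col (w ! (k - 1)) \<noteq> col (w ! k)
     then (Qt (col (w ! (k - 1))) (col (w ! k)) (val (w ! (k + 1))) (val (w ! k)) -
           Qt (col (w ! (k - 1))) (col (w ! k)) (val (w ! (k - 1))) (val (w ! k))) /
          (val (w ! (k + 1)) - val (w ! (k - 1))) * f w
     else 0)"
proof -
  define p q r where "p = w ! (k - 1)" and "q = w ! k" and "r = w ! (k + 1)"
  have len: "length w = n" by (rule W_length[OF w])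
  define s1 where "s1 = swap_seq k w"
  define s2 where "s2 = swap_seq (k + 1) w"
  define s21 where "s21 = swap_seq (k + 1) s1"
  define s12 where "s12 = swap_seq k s2"
  define s121 where "s121 = swap_seq k s21"
  note defs = s1_def s2_def s21_def s12_def s121_def p_def q_def r_def
  have len': "length s1 = n" "length s2 = n" "length s21 = n" "length s12 = n" "length s121 = n"
    by (simp_all add: defs len)
  have n: "s1 ! (k - 1) = q" "s1 ! k = p" "s1 ! (k + 1) = r"
    "s2 ! (k - 1) = p" "s2 ! k = r" "s2 ! (k + 1) = q"
    "s21 ! (k - 1) = q" "s21 ! k = r" "s21 ! (k + 1) = p"
    "s12 ! (k - 1) = r" "s12 ! k = p" "s12 ! (k + 1) = q"
    using k len by (auto simp: defs nth_swap_seq transpose_def)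
  have b: "swap_seq k s21 = s121" "swap_seq (k + 1) s12 = s121"
    unfolding defs using swap_seq_braid[of k w] k len by simp_all
  have i: "swap_seq k s1 = w" "swap_seq (k + 1) s2 = w" "swap_seq (k + 1) s21 = s1" "swap_seq k s12 = s2"
    using k len len' unfolding s21_def s12_def s1_def s2_def by (simp_all add: swap_seq_swap_seq)
  have d: "swap_seq k w = s1" "swap_seq (k + 1) w = s2" "swap_seq (k + 1) s1 = s21" "swap_seq k s2 = s12"
    by (simp_all add: defs)
  have neq: "col p = col q \<Longrightarrow> val p \<noteq> val q" "col q = col r \<Longrightarrow> val q \<noteq> val r" "col p = col r \<Longrightarrow> val p \<noteq> val r"
    unfolding defs using k val_inj[OF w] by auto
  have fold: "w ! (k - 1) = p" "w ! k = q" "w ! (k + 1) = r" by (simp_all add: defs)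
  have k1: "k + 1 - 1 = k" by simp
  have ev:
    "tau_op k g w = (if col p = col q then (g s1 - g w) / (val p - val q) else cross p q * g s1)"
    "tau_op (k + 1) g w = (if col q = col r then (g s2 - g w) / (val q - val r) else cross q r * g s2)"
    "tau_op (k + 1) g s1 = (if col p = col r then (g s21 - g s1) / (val p - val r) else cross p r * g s21)"
    "tau_op k g s1 = (if col q = col p then (g w - g s1) / (val q - val p) else cross q p * g w)"
    "tau_op k g s2 = (if col p = col r then (g s12 - g s2) / (val p - val r) else cross p r * g s12)"
    "tau_op (k + 1) g s2 = (if col r = col q then (g w - g s2) / (val r - val q) else cross r q * g w)"
    "tau_op k g s21 = (if col q = col r then (g s121 - g s21) / (val q - val r) else cross q r * g s121)"
    "tau_op (k + 1) g s12 = (if col p = col q then (g s121 - g s12) / (val p - val q) else cross p q * g s121)"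
    for g by (rule tau_op_eval; simp only: k1 n fold d i b)+
  have L: "tau_op (k + 1) (tau_op k (tau_op (k + 1) f)) w =
    (let A = (if col q = col r then (f s2 - f w) / (val q - val r) else cross q r * f s2);
         B = (if col p = col r then (f s21 - f s1) / (val p - val r) else cross p r * f s21);
         C = (if col r = col q then (f w - f s2) / (val r - val q) else cross r q * f w);
         E = (if col p = col q then (f s121 - f s12) / (val p - val q) else cross p q * f s121);
         G = (if col p = col q then (B - A) / (val p - val q) else cross p q * B);
         H = (if col p = col r then (E - C) / (val p - val r) else cross p r * E)
     in if col q = col r then (H - G) / (val q - val r) else cross q r * H)"
    by (simp only: ev Let_def)
  have R: "tau_op k (tau_op (k + 1) (tau_op k f)) w =
    (let A = (if col p = col q then (f s1 - f w) / (val p - val q) else cross p q * f s1);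
         B = (if col p = col r then (f s12 - f s2) / (val p - val r) else cross p r * f s12);
         C = (if col q = col p then (f w - f s1) / (val q - val p) else cross q p * f w);
         E = (if col q = col r then (f s121 - f s21) / (val q - val r) else cross q r * f s121);
         G = (if col q = col r then (B - A) / (val q - val r) else cross q r * B);
         H = (if col p = col r then (E - C) / (val p - val r) else cross p r * E)
     in if col p = col q then (H - G) / (val p - val q) else cross p q * H)"
    by (simp only: ev Let_def)
  consider "col p = col q" "col q = col r" | "col p = col q" "col q \<noteq> col r"
    | "col p \<noteq> col q" "col q = col r" | "col p = col r" "col p \<noteq> col q"
    | "col p \<noteq> col q" "col q \<noteq> col r" "col p \<noteq> col r"
    by metis
  then show ?thesis
  proof cases
    case 1
    then have ne: "val p - val q \<noteq> 0" "val q - val r \<noteq> 0" "val p - val r \<noteq> 0" using neq by auto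
    define u v t where "u = 1 / (val p - val q)" and "v = 1 / (val q - val r)" and "t = 1 / (val p - val r)"
    have "u * v = t * (u + v)" unfolding u_def v_def t_def using ne by (simp add: field_simps)
    moreover have "x / (val p - val q) = x * u" "x / (val q - val r) = x * v" "x / (val p - val r) = x * t"
      "x / (val r - val q) = - x * v" "x / (val q - val p) = - x * u" for x
      unfolding u_def v_def t_def by (simp_all add: minus_divide_right)
    ultimately show ?thesis unfolding L R fold using 1 demazure_braid[of u v t "f s121" "f s12" "f w" "f s2" "f s21" "f s1"]
      by (simp add: Let_def)
  next
    case 2
    then have "val p - val q \<noteq> 0" using neq by auto
    with 2 show ?thesis unfolding L R fold by (simp add: Let_def) (simp add: field_simps)
  next
    case 3
    then have "val q - val r \<noteq> 0" using neq by auto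
    with 3 show ?thesis unfolding L R fold by (simp add: Let_def) (simp add: field_simps)
  next
    case 4
    then have ne: "val p - val r \<noteq> 0" "col r \<noteq> col q" "col q \<noteq> col r" "col q \<noteq> col p"
      and rp: "val r - val p = - (val p - val r)" using neq by auto
    \<comment> \<open>The terms at \<open>s121\<close> cancel. At \<open>w\<close>, one side
      exchanges the middle point with \<open>r\<close> and back, the other with \<open>p\<close> and
      back, and these two products of crossing factors are the two values of
      \<open>Qt\<close>.\<close>
    have "Qt (col p) (col q) (val r) (val q) = cross q r * cross r q"
      using cross_mult[of r q] 4 by (simp add: mult.commute)
    moreover have "Qt (col p) (col q) (val p) (val q) = cross p q * cross q p"
      using cross_mult[of p q] 4 by simp
    ultimately show ?thesis
      unfolding L R fold rp using ne 4 by (simp add: Let_def del: minus_diff_eq) (simp add: divide_simps, simp add: algebra_simps)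
  next
    case 5
    then show ?thesis unfolding L R fold by (simp add: Let_def mult_ac)
  qed
qed

end

section \<open>Integral functions and their reduction\<close>

lemma swap_seq_same: "\<lbrakk>1 \<le> k; k < length w; w ! (k - 1) = w ! k\<rbrakk> \<Longrightarrow> swap_seq k w = w"
  by (rule nth_equalityI) (auto simp: nth_swap_seq transpose_def)

context klr_points
begin

text \<open>On \<open>W\<close> these are the functions that are, for each colour sequence, a
  polynomial in the values with coefficients in \<open>R\<close>. The rules replace polynomials in
  several variables by an induction principle, and \<open>lat_ext\<close> makes values outside
  \<open>W\<close> irrelevant.\<close>

inductive_set lat :: "('p list \<Rightarrow> 'f) set" where
  lat_col: "(\<And>\<nu>. c \<nu> \<in> R) \<Longrightarrow> (\<lambda>w. c (map col w)) \<in> lat"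
| lat_val: "m < n \<Longrightarrow> (\<lambda>w. val (w ! m)) \<in> lat"
| lat_add: "f \<in> lat \<Longrightarrow> g \<in> lat \<Longrightarrow> (\<lambda>w. f w + g w) \<in> lat"
| lat_mult: "f \<in> lat \<Longrightarrow> g \<in> lat \<Longrightarrow> (\<lambda>w. f w * g w) \<in> lat"
| lat_ext: "f \<in> lat \<Longrightarrow> (\<And>w. w \<in> W \<Longrightarrow> g w = f w) \<Longrightarrow> g \<in> lat"

lemma R_0: "0 \<in> R"
  using R(1) R(2)[of 1 "-1"] R(4)[of 1] by simp

lemma lat_R: "f \<in> lat \<Longrightarrow> w \<in> W \<Longrightarrow> f w \<in> R"
  by (induction rule: lat.induct) (auto intro: R R_val)

lemma lat_const: "c \<in> R \<Longrightarrow> (\<lambda>w. c) \<in> lat"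
  using lat_col[of "\<lambda>_. c"] by simp

lemma lat_sum: "(\<And>a. a \<in> A \<Longrightarrow> F a \<in> lat) \<Longrightarrow> (\<lambda>w. \<Sum>a\<in>A. F a w) \<in> lat"
  by (induction A rule: infinite_finite_induct) (auto intro: lat_const R_0 lat_add)

lemma lat_power: "f \<in> lat \<Longrightarrow> (\<lambda>w. f w ^ m) \<in> lat"
  by (induction m) (auto intro: lat_const R lat_mult)

lemma lat_bieval:
  assumes "\<And>s t. \<psi> (bicoeff p s t) \<in> R" "f \<in> lat" "g \<in> lat"
  shows "(\<lambda>w. bieval \<psi> p (f w) (g w)) \<in> lat"
  unfolding bieval_def using assms by (intro lat_sum lat_mult lat_power lat_const) auto

lemma lat_bidivdiff:
  assumes "\<And>s t. \<psi> (bicoeff p s t) \<in> R" "f \<in> lat" "g \<in> lat" "h \<in> lat"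
  shows "(\<lambda>w. bidivdiff \<psi> p (f w) (g w) (h w)) \<in> lat"
  unfolding bidivdiff_def using assms by (intro lat_sum lat_mult lat_power lat_const) auto

text \<open>The colour sequences of members of \<open>W\<close> form a finite set, and the indicator
  function of each is in \<open>lat\<close>; so a choice of integral function for each colour
  sequence can be glued.\<close>

lemma lat_cases:
  assumes "\<And>\<nu>. \<nu> \<in> seqs \<beta> \<Longrightarrow> F \<nu> \<in> lat"
  shows "(\<lambda>w. F (map col w) w) \<in> lat"
proof (rule lat_ext)
  show "(\<lambda>w. \<Sum>\<nu>\<in>seqs \<beta>. (if map col w = \<nu> then 1 else 0) * F \<nu> w) \<in> lat"
  proof (rule lat_sum, rule lat_mult)
    fix \<nu> assume "\<nu> \<in> seqs \<beta>"
    then show "F \<nu> \<in> lat" by (rule assms)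
    show "(\<lambda>w. if map col w = \<nu> then 1 else 0) \<in> lat"
      by (rule lat_col[of "\<lambda>\<mu>. if \<mu> = \<nu> then 1 else 0"]) (simp add: R(1) R_0)
  qed
  fix w assume w: "w \<in> W"
  have "(\<Sum>\<nu>\<in>seqs \<beta>. (if map col w = \<nu> then 1 else 0) * F \<nu> w) =
      (\<Sum>\<nu>\<in>seqs \<beta>. if \<nu> = map col w then F \<nu> w else 0)"
    by (rule sum.cong) auto
  also have "\<dots> = F (map col w) w"
    using W_seqs[OF w] by (simp add: sum.delta[OF finite_seqs])
  finally show "F (map col w) w = (\<Sum>\<nu>\<in>seqs \<beta>. (if map col w = \<nu> then 1 else 0) * F \<nu> w)" ..
qed

lemma lat_indicator: "f \<in> lat \<Longrightarrow> (\<lambda>w. if P (map col w) then f w else 0) \<in> lat"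
proof -
  assume "f \<in> lat"
  then have "(\<lambda>w. (if P (map col w) then f else (\<lambda>_. 0)) w) \<in> lat"
    using lat_cases[of "\<lambda>\<nu>. if P \<nu> then f else (\<lambda>_. 0)"] lat_const[OF R_0] by presburger
  then show ?thesis by (rule lat_ext) simp
qed

lemma lat_swap:
  assumes k: "1 \<le> k" "k < n" and "f \<in> lat"
  shows "(\<lambda>w. f (swap_seq k w)) \<in> lat"
  using assms(3)
proof (induction rule: lat.induct)
  case (lat_col c)
  show ?case
    by (rule lat_ext[OF lat.lat_col[of "\<lambda>\<nu>. c (swap_seq k \<nu>)"]]) (use k in \<open>simp_all add: lat_col map_swap_seq W_length\<close>)
next
  case (lat_val m)
  have "transpose (k - 1) k m < n" using lat_val k by (intro transpose_less) auto
  then show ?case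
    by (rule lat_ext[OF lat.lat_val]) (use k lat_val in \<open>simp add: nth_swap_seq W_length\<close>)
next
  case (lat_ext f g)
  show ?case
    by (rule lat.lat_ext[OF lat_ext(3)]) (use k in \<open>simp add: lat_ext W_swap\<close>)
next
  case (lat_add f g)
  show ?case by (rule lat.lat_add[OF lat_add(3,4)])
next
  case (lat_mult f g)
  show ?case by (rule lat.lat_mult[OF lat_mult(3,4)])
qed

text \<open>Division by a difference of values stays integral: constants for a colour sequence are
  killed, a value is sent to 0, 1 or -1, and the Leibniz rule handles products.\<close>

lemma lat_demazure:
  assumes k: "1 \<le> k" "k < n" and "f \<in> lat"
  shows "demazure k f \<in> lat"
  using assms(3)
proof (induction rule: lat.induct)
  case (lat_col c)
  show ?case
  proof (rule lat_ext[OF lat_const[OF R_0]])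
    fix w assume "w \<in> W"
    then have len: "length w = n" by (rule W_length)
    have "map col (swap_seq k w) = map col w" if "col (w ! (k - 1)) = col (w ! k)"
      using that k len by (simp add: map_swap_seq swap_seq_same)
    then show "demazure k (\<lambda>w. c (map col w)) w = 0" by (simp add: demazure_def)
  qed
next
  case (lat_val m)
  let ?c = "\<lambda>\<nu>. if \<nu> ! (k - 1) = \<nu> ! k then if m = k - 1 then - 1 else if m = k then 1 else 0 else (0 :: 'f)"
  show ?case
  proof (rule lat_ext[OF lat_col[of ?c]])
    show "?c \<nu> \<in> R" for \<nu> by (auto intro: R R_0)
    fix w assume w: "w \<in> W"
    then have len: "length w = n" by (rule W_length)
    define p q where "p = w ! (k - 1)" and "q = w ! k"
    have ne: "val p - val q \<noteq> 0" if "col p = col q"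
      using val_inj[OF w, of "k - 1" k] that k by (simp add: p_def q_def)
    have "swap_seq k w ! m = (if m = k - 1 then q else if m = k then p else w ! m)"
      using k len lat_val by (simp add: nth_swap_seq transpose_def p_def q_def)
    moreover have "w ! m = (if m = k - 1 then p else if m = k then q else w ! m)"
      by (simp add: p_def q_def)
    moreover have "map col w ! (k - 1) = col p" "map col w ! k = col q"
      using k len by (simp_all add: p_def q_def)
    moreover have "(val q - val p) / (val p - val q) = - 1" if "col p = col q"
      using ne[OF that] by (simp add: divide_simps)
    ultimately show "demazure k (\<lambda>w. val (w ! m)) w = ?c (map col w)"
      unfolding demazure_def p_def[symmetric] q_def[symmetric] using ne k by auto
  qed
next
  case (lat_add f g)
  show ?case
    by (rule lat_ext[OF lat.lat_add[OF lat_add(3,4)]]) (simp add: demazure_def diff_divide_distrib add_divide_distrib)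
next
  case (lat_mult f g)
  show ?case
  proof (rule lat_ext)
    show "(\<lambda>w. demazure k f w * g (swap_seq k w) + f w * demazure k g w) \<in> lat"
      using lat_mult by (intro lat.lat_add lat.lat_mult lat_swap[OF k, of g])
    show "demazure k (\<lambda>w. f w * g w) w = demazure k f w * g (swap_seq k w) + f w * demazure k g w" for w
      by (simp add: demazure_def diff_divide_distrib algebra_simps)
  qed
next
  case (lat_ext f g)
  show ?case
    by (rule lat.lat_ext[OF lat_ext(3)]) (use k in \<open>simp add: lat_ext W_swap demazure_def\<close>)
qed

lemma lat_tau_op:
  assumes k: "1 \<le> k" "k < n" and f: "f \<in> lat"
  shows "tau_op k f \<in> lat"
proof (rule lat_ext)
  \<comment> \<open>The crossing part depends on the colour sequence only through which polynomial
    occurs, so it is written with the sequence as a parameter and treated by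
    \<open>lat_cases\<close>.\<close>
  let ?F = "\<lambda>\<nu> w. if \<nu> ! (k - 1) = \<nu> ! k then 0 else if prec (\<nu> ! (k - 1)) (\<nu> ! k)
      then (bieval \<phi> (Q (\<nu> ! (k - 1)) (\<nu> ! k)) (val (w ! (k - 1))) (val (w ! k)) +
        eps * bieval id (D (\<nu> ! (k - 1)) (\<nu> ! k)) (val (w ! (k - 1))) (val (w ! k))) * f (swap_seq k w)
      else f (swap_seq k w)"
  have "?F \<nu> \<in> lat" for \<nu>
  proof -
    consider "\<nu> ! (k - 1) = \<nu> ! k" | "\<nu> ! (k - 1) \<noteq> \<nu> ! k" "prec (\<nu> ! (k - 1)) (\<nu> ! k)"
      | "\<nu> ! (k - 1) \<noteq> \<nu> ! k" "\<not> prec (\<nu> ! (k - 1)) (\<nu> ! k)" by blast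
    then show ?thesis
    proof cases
      case 2
      have "(\<lambda>w. (bieval \<phi> (Q (\<nu> ! (k - 1)) (\<nu> ! k)) (val (w ! (k - 1))) (val (w ! k)) +
        eps * bieval id (D (\<nu> ! (k - 1)) (\<nu> ! k)) (val (w ! (k - 1))) (val (w ! k))) * f (swap_seq k w)) \<in> lat"
        using k by (intro lat_mult[OF _ lat_swap[OF k f]] lat_add lat_mult[OF lat_const[OF R_eps]] lat_bieval lat_val)
          (auto simp: R_\<phi> R_D)
      then show ?thesis using 2 by simp
    qed (use lat_const[OF R_0] lat_swap[OF k f] in simp_all)
  qed
  then show "(\<lambda>w. demazure k f w + ?F (map col w) w) \<in> lat"
    by (rule lat_add[OF lat_demazure[OF k f] lat_cases[of ?F]])
  fix w assume w: "w \<in> W"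
  then have "map col w ! (k - 1) = col (w ! (k - 1))" "map col w ! k = col (w ! k)"
    using k W_length[OF w] by simp_all
  then show "tau_op k f w = demazure k f w + ?F (map col w) w"
    by (simp add: tau_op_def demazure_def cross_def Qt_def)
qed

lemma lat_gen_op: "f \<in> lat \<Longrightarrow> gen_op g f \<in> lat"
proof (cases g)
  case (Idem_Gen \<nu>)
  assume "f \<in> lat"
  from lat_indicator[OF this, of "\<lambda>\<mu>. \<mu> = \<nu>"] show ?thesis
    by (rule lat_ext) (simp add: Idem_Gen)
next
  case (X_Gen k)
  assume "f \<in> lat"
  moreover have "(\<lambda>w. 0) \<in> lat" by (rule lat_const[OF R_0])
  moreover have "(\<lambda>w. val (w ! (k - 1)) * f w) \<in> lat" if "k \<in> {1..n}" "f \<in> lat"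
    using that by (intro lat_mult lat_val) auto
  ultimately show ?thesis
    by (cases "k \<in> {1..n}") (auto simp: X_Gen intro: lat_ext)
next
  case (Tau_Gen k)
  assume f: "f \<in> lat"
  show ?thesis
  proof (cases "k \<in> {1..<n}")
    case True
    then show ?thesis using f lat_tau_op[of k f] by (auto simp: Tau_Gen intro: lat_ext)
  next
    case False
    then show ?thesis by (intro lat_ext[OF lat_const[OF R_0]]) (auto simp: Tau_Gen)
  qed
qed

lemma lat_act: "f \<in> lat \<Longrightarrow> act h f \<in> lat"
proof -
  assume f: "f \<in> lat"
  have "foldr gen_op u f \<in> lat" for u by (induction u) (auto intro: f lat_gen_op)
  then show ?thesis unfolding act_def by (intro lat_sum lat_mult lat_const R_\<phi>)
qed

text \<open>Congruent to 0 modulo \<open>eps\<close> on \<open>Om\<close>; the division takes place inside \<open>lat\<close>, not just pointwise.\<close>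

definition small :: "('p list \<Rightarrow> 'f) \<Rightarrow> bool"
  where "small f \<longleftrightarrow> (\<exists>g\<in>lat. \<forall>w\<in>Om. f w = eps * g w)"

lemma small_zero: "(\<And>w. w \<in> Om \<Longrightarrow> f w = 0) \<Longrightarrow> small f"
  unfolding small_def by (intro bexI[of _ "\<lambda>_. 0"]) (auto intro: lat_const R_0)

lemma small_add: "small f \<Longrightarrow> small g \<Longrightarrow> small (\<lambda>w. f w + g w)"
proof -
  assume "small f" "small g"
  then obtain f' g' where "f' \<in> lat" "\<And>w. w \<in> Om \<Longrightarrow> f w = eps * f' w"
      "g' \<in> lat" "\<And>w. w \<in> Om \<Longrightarrow> g w = eps * g' w"
    by (auto simp: small_def)
  then show ?thesis
    unfolding small_def
    by (intro bexI[of _ "\<lambda>w. f' w + g' w"] lat_add) (simp_all add: distrib_left)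
qed

lemma small_scale: "small f \<Longrightarrow> c \<in> R \<Longrightarrow> small (\<lambda>w. c * f w)"
proof -
  assume "small f" and c: "c \<in> R"
  then obtain g where g: "g \<in> lat" "\<And>w. w \<in> Om \<Longrightarrow> f w = eps * g w"
    by (auto simp: small_def)
  show ?thesis
    unfolding small_def
    by (rule bexI[OF _ lat_mult[OF lat_const[OF c] g(1)]]) (simp add: g(2) mult.left_commute)
qed

lemma small_sum: "(\<And>a. a \<in> A \<Longrightarrow> small (F a)) \<Longrightarrow> small (\<lambda>w. \<Sum>a\<in>A. F a w)"
proof (induction A rule: infinite_finite_induct)
  case (insert a A)
  then show ?case using small_add[of "F a" "\<lambda>w. \<Sum>a\<in>A. F a w"] by simp
qed (simp_all add: small_zero)

text \<open>The only values used at \<open>w\<close> are those at \<open>w\<close> and at its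
  exchange. If the exchange leaves \<open>Om\<close>, where nothing is known about \<open>f\<close>,
  its coefficient is 0 by \<open>Om_swap\<close>.\<close>

lemma small_gen_op:
  assumes "small f"
  shows "small (gen_op g f)"
proof -
  obtain h where h: "h \<in> lat" "\<And>w. w \<in> Om \<Longrightarrow> f w = eps * h w"
    using assms by (auto simp: small_def)
  have "gen_op g f w = eps * gen_op g h w" if w: "w \<in> Om" for w
  proof (cases g)
    case (Tau_Gen k)
    show ?thesis
    proof (cases "k \<in> {1..<n}")
      case k: True
      show ?thesis
      proof (cases "swap_seq k w \<in> Om")
        case True
        then show ?thesis using w k h(2) by (simp add: Tau_Gen tau_op_def right_diff_distrib)
      next
        case False
        then have "col (w ! (k - 1)) \<noteq> col (w ! k)" "cross (w ! (k - 1)) (w ! k) = 0"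
          using Om_swap[OF w _ _ False] k by (auto simp: cross_def Qt_def)
        then show ?thesis by (simp add: Tau_Gen tau_op_def)
      qed
    qed (auto simp: Tau_Gen)
  qed (use h w in auto)
  then show ?thesis unfolding small_def using lat_gen_op[OF h(1)] by blast
qed

lemma small_act: "small f \<Longrightarrow> small (act h f)"
proof -
  assume f: "small f"
  have "small (foldr gen_op u f)" for u by (induction u) (auto intro: f small_gen_op)
  then show ?thesis unfolding act_def by (intro small_sum small_scale R_\<phi>)
qed

text \<open>The annihilator of the module of integral functions modulo the small ones.\<close>

definition small_ideal :: "('i klr_gen, 'k) free set"
  where "small_ideal = {h \<in> carrier (free_algebra (klr_gens \<beta>)). \<forall>f\<in>lat. small (act h f)}"

lemma small_ideal_ideal: "ideal small_ideal (free_algebra (klr_gens \<beta>))"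
proof -
  let ?F = "free_algebra (klr_gens \<beta>) :: ('k, ('i klr_gen, 'k) free) module"
  interpret F: ring ?F by (rule free_algebra_ring)
  have minus: "a_inv ?F x = - x" if "x \<in> carrier ?F" for x
    using F.minus_equality[of "- x" x] that free_carrier(7)[OF that] by simp
  have s0: "0 \<in> small_ideal"
    by (auto simp: small_ideal_def free_carrier(1) intro: small_zero)
  show ?thesis
  proof (rule idealI)
    show "ring ?F" by (rule free_algebra_ring)
    show "subgroup small_ideal (add_monoid ?F)"
    proof (rule group.subgroupI)
      show "group (add_monoid ?F)" using F.a_group .
      show "small_ideal \<subseteq> carrier (add_monoid ?F)" by (auto simp: small_ideal_def)
      show "small_ideal \<noteq> {}" using s0 by blast
      fix a b assume a: "a \<in> small_ideal" and b: "b \<in> small_ideal"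
      show "a \<otimes>\<^bsub>add_monoid ?F\<^esub> b \<in> small_ideal"
        using a b by (auto simp: small_ideal_def act_plus[abs_def] free_carrier(5) intro: small_add)
      have "- 1 \<in> R" using R by blast
      then have "small (\<lambda>w. - 1 * act a f w)" if "f \<in> lat" for f
        using a that by (intro small_scale) (auto simp: small_ideal_def)
      then have "- a \<in> small_ideal"
        using a by (auto simp: small_ideal_def act_uminus[abs_def] free_carrier(7))
      moreover have "inv\<^bsub>add_monoid ?F\<^esub> a = - a"
        using minus[of a] a by (simp add: a_inv_def small_ideal_def)
      ultimately show "inv\<^bsub>add_monoid ?F\<^esub> a \<in> small_ideal" by simp
    qed
    fix a x assume ax: "a \<in> small_ideal" "x \<in> carrier ?F"
    then have "a \<in> carrier ?F" and sm: "\<And>f. f \<in> lat \<Longrightarrow> small (act a f)"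
      by (auto simp: small_ideal_def)
    then have "x * a \<in> carrier ?F" "a * x \<in> carrier ?F"
      using ax by (blast intro: free_carrier)+
    then show "x \<otimes>\<^bsub>?F\<^esub> a \<in> small_ideal" "a \<otimes>\<^bsub>?F\<^esub> x \<in> small_ideal"
      \<comment> \<open>Left multiples need the stability of small functions under the action, right
        multiples that of \<open>lat\<close>.\<close>
      using small_act[OF sm] sm[OF lat_act] by (simp_all add: small_ideal_def act_mult)
  qed
qed

section \<open>The KLR relations modulo \<open>eps\<close>\<close>

lemma act_x_power: "k \<in> {1..n} \<Longrightarrow> act (xgen k ^ s) f = (\<lambda>w. val (w ! (k - 1)) ^ s * f w)"
  by (induction s arbitrary: f) (auto simp: act_mult fun_eq_iff mult_ac simp del: power_Suc simp add: power_Suc)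

lemma act_bieval:
  assumes "k \<in> {1..n}" "l \<in> {1..n}"
  shows "act (bieval scalar q (xgen k) (xgen l)) f w = bieval \<phi> q (val (w ! (k - 1))) (val (w ! (l - 1))) * f w"
  using assms by (simp add: bieval_def act_sum act_mult act_x_power sum_distrib_right mult.assoc)

lemma act_bidivdiff:
  assumes "k \<in> {1..n}" "l \<in> {1..n}" "m \<in> {1..n}"
  shows "act (bidivdiff scalar q (xgen k) (xgen m) (xgen l)) f w =
    bidivdiff \<phi> q (val (w ! (k - 1))) (val (w ! (m - 1))) (val (w ! (l - 1))) * f w"
  using assms by (simp add: bidivdiff_def act_sum act_mult act_x_power sum_distrib_left sum_distrib_right mult.assoc)

lemma gen_op_Tau: "k \<in> {1..<n} \<Longrightarrow> gen_op (Tau_Gen k) = tau_op k"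
  by (simp add: fun_eq_iff)

lemma entry_map_col: "w \<in> W \<Longrightarrow> 1 \<le> k \<Longrightarrow> k \<le> n \<Longrightarrow> entry (map col w) k = col (w ! (k - 1))"
  using W_length[of w] by (simp add: entry_def)

text \<open>The operators satisfy the relations of the deformed polynomials
  \<open>Q + eps D\<close>. Relations without polynomials thus hold exactly on \<open>W\<close>,
  while the quadratic and the braid relation fail by \<open>eps\<close> times an integral function
  built from \<open>D\<close>.\<close>

lemma klr_relations_small: "klr_relations Q \<beta> \<subseteq> small_ideal"
proof
  fix p assume p: "p \<in> klr_relations Q \<beta>"
  have vanish: "p \<in> small_ideal" if "\<And>f w. w \<in> W \<Longrightarrow> act p f w = 0"
  proof -
    have "small (act p f)" for f
      using that Om_W by (intro small_zero) auto
    then show ?thesis using p klr_relations_carrier[of Q \<beta>] by (auto simp: small_ideal_def)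
  qed
  have eps: "p \<in> small_ideal" if g: "\<And>f. f \<in> lat \<Longrightarrow> g f \<in> lat" "\<And>f w. w \<in> W \<Longrightarrow> act p f w = eps * g f w" for g
  proof -
    have "small (act p f)" if f: "f \<in> lat" for f
      unfolding small_def using g Om_W f by (intro bexI[of _ "g f"]) auto
    then show ?thesis using p klr_relations_carrier[of Q \<beta>] by (auto simp: small_ideal_def)
  qed
  from p show "p \<in> small_ideal"
  proof cases
    case (idem_mult \<nu> \<nu>')
    then show ?thesis by (intro vanish) (simp add: act_diff act_mult)
  next
    case idem_sum
    have "(\<Sum>\<nu>\<in>seqs \<beta>. if map col w = \<nu> then f w else 0) = f w" if "w \<in> W" for f :: "'p list \<Rightarrow> 'f" and w
      using W_seqs[OF that] finite_seqs[of \<beta>] by simp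
    then show ?thesis using idem_sum by (intro vanish) (simp add: act_diff act_sum)
  next
    case (x_idem \<nu> k)
    then show ?thesis by (intro vanish) (auto simp add: act_diff act_mult)
  next
    case (tau_idem \<nu> k)
    show ?thesis
    proof (rule vanish)
      fix f w assume w: "w \<in> W"
      have len: "length w = n" "length \<nu> = n" using W_length[OF w] tau_idem by (simp_all add: seqs_def)
      have k: "1 \<le> k" "k < n" using tau_idem by auto
      have iff: "map col (swap_seq k w) = \<nu> \<longleftrightarrow> map col w = swap_seq k \<nu>"
        using len k by (metis length_map map_swap_seq swap_seq_swap_seq)
      have same: "swap_seq k (map col w) = map col w" if "col (w ! (k - 1)) = col (w ! k)"
        using that len k by (simp add: swap_seq_same)
      \<comment> \<open>The divided difference also uses \<open>f w\<close>, where the colour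
        sequence has not been exchanged; for equal colours the sequence is fixed by the exchange and
        the two conditions agree.\<close>
      have iff2: "map col w = \<nu> \<longleftrightarrow> map col w = swap_seq k \<nu>" if "col (w ! (k - 1)) = col (w ! k)"
        using same[OF that] len k by (metis length_map swap_seq_swap_seq)
      have "act p f w = tau_op k (gen_op (Idem_Gen \<nu>) f) w - gen_op (Idem_Gen (swap_seq k \<nu>)) (tau_op k f) w"
        unfolding tau_idem(1) act_diff act_mult act_gen gen_op_Tau[OF tau_idem(3)] ..
      also have "\<dots> = 0"
      proof (cases "col (w ! (k - 1)) = col (w ! k)")
        case True
        then show ?thesis unfolding tau_op_def gen_op.simps iff iff2[OF True] by simp
      next
        case False
        then show ?thesis unfolding tau_op_def gen_op.simps iff by simp
      qed
      finally show "act p f w = 0" .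
    qed
  next
    case (x_x k l)
    then show ?thesis by (intro vanish) (auto simp add: act_diff act_mult)
  next
    case (tau_square \<nu> k)
    have k: "1 \<le> k" "k < n" using tau_square by auto
    let ?a = "entry \<nu> k" and ?b = "entry \<nu> (k + 1)"
    \<comment> \<open>The error of the quadratic relation. For equal colours both sides are 0,
      whereas \<open>D\<close> is not assumed to vanish on the diagonal; hence the condition
      \<open>?a \<noteq> ?b\<close>.\<close>
    let ?g = "\<lambda>f w. if map col w = \<nu> \<and> ?a \<noteq> ?b then bieval id (D ?a ?b) (val (w ! (k - 1))) (val (w ! k)) * f w else 0"
    show ?thesis
    proof (rule eps)
      show "?g f \<in> lat" if "f \<in> lat" for f
        using k that
        by (intro lat_indicator[where P = "\<lambda>\<mu>. \<mu> = \<nu> \<and> ?a \<noteq> ?b"] lat_mult lat_bieval lat_val)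
          (auto simp: R_D)
      fix f w assume w: "w \<in> W"
      have e: "?a = col (w ! (k - 1))" "?b = col (w ! k)" if "map col w = \<nu>"
        using that k W_length[OF w] entry_map_col[OF w, of k] entry_map_col[OF w, of "k + 1"] by auto
      have "act p f w = (if map col w = \<nu> then (if ?a = ?b then 0 else Qt ?a ?b (val (w ! (k - 1))) (val (w ! k)) * f w)
          - bieval \<phi> (Q ?a ?b) (val (w ! (k - 1))) (val (w ! k)) * f w else 0)"
        using tau_square e k w
        by (auto simp add: power2_eq_square act_diff act_mult gen_op_Tau act_bieval tau_op_square)
      then show "act p f w = eps * ?g f w"
        using Q_diag by (auto simp: Qt_def bieval_zero algebra_simps)
    qed
  next
    case (tau_x \<nu> k l)
    have k: "1 \<le> k" "k < n" and l: "1 \<le> l" "l \<le> n" using tau_x by auto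
    show ?thesis
    proof (rule vanish)
      fix f w assume w: "w \<in> W"
      let ?f = "gen_op (Idem_Gen \<nu>) f"
      have e: "entry \<nu> k = col (w ! (k - 1))" "entry \<nu> (k + 1) = col (w ! k)" if "map col w = \<nu>"
        using that k W_length[OF w] entry_map_col[OF w, of k] entry_map_col[OF w, of "k + 1"] by auto
      have x: "gen_op (X_Gen l) ?f = (\<lambda>w. val (w ! (l - 1)) * ?f w)"
        using l by (auto simp: fun_eq_iff)
      have t: "transpose k (k + 1) l \<in> {1..n}" using k l by (auto simp: transpose_def)
      have "act ((tau k * xgen l - xgen (transpose k (k + 1) l) * tau k) * idem \<nu>) f w =
        tau_op k (gen_op (X_Gen l) ?f) w - val (w ! (transpose k (k + 1) l - 1)) * tau_op k ?f w"
        by (simp only: act_mult act_diff act_gen gen_op_Tau[OF tau_x(3)] gen_op.simps(2) t if_True)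
      also have "\<dots> = (if l = k + 1 \<and> col (w ! (k - 1)) = col (w ! k) then ?f w
         else if l = k \<and> col (w ! (k - 1)) = col (w ! k) then - ?f w else 0)"
        by (simp only: x tau_op_val[OF w k l] add_diff_cancel_left')
      finally have 1: "act ((tau k * xgen l - xgen (transpose k (k + 1) l) * tau k) * idem \<nu>) f w = \<dots>" .
      have 2: "act (if l = k + 1 \<and> entry \<nu> k = entry \<nu> (k + 1) then idem \<nu>
          else if l = k \<and> entry \<nu> k = entry \<nu> (k + 1) then - idem \<nu> else 0) f w =
        (if l = k + 1 \<and> entry \<nu> k = entry \<nu> (k + 1) then ?f w
         else if l = k \<and> entry \<nu> k = entry \<nu> (k + 1) then - ?f w else 0)"
        by (simp add: act_uminus)
      show "act p f w = 0"
        unfolding tau_x(1) act_diff 1 2 using e by (cases "map col w = \<nu>") auto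
    qed
  next
    case (tau_tau k l)
    have kl: "1 \<le> k" "k < n" "1 \<le> l" "l < n" using tau_tau by auto
    have "act p f w = tau_op k (tau_op l f) w - tau_op l (tau_op k f) w" for f w
      unfolding tau_tau(1) act_diff act_mult act_gen gen_op_Tau[OF tau_tau(2)] gen_op_Tau[OF tau_tau(3)] ..
    then show ?thesis
      using tau_op_commute[of _ k l] tau_op_commute[of _ l k] kl tau_tau(4)
      by (intro vanish) (metis diff_self)
  next
    case (braid \<nu> k)
    have k: "1 \<le> k" "k + 1 < n" using braid by auto
    let ?a = "entry \<nu> k" and ?b = "entry \<nu> (k + 1)" and ?c = "entry \<nu> (k + 2)"
    let ?g = "\<lambda>f w. if map col w = \<nu> \<and> ?a = ?c \<and> ?a \<noteq> ?b
      then bidivdiff id (D ?a ?b) (val (w ! (k + 1))) (val (w ! (k - 1))) (val (w ! k)) * f w else 0"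
    show ?thesis
    proof (rule eps)
      show "?g f \<in> lat" if "f \<in> lat" for f
        using k that
        by (intro lat_indicator[where P = "\<lambda>\<mu>. \<mu> = \<nu> \<and> ?a = ?c \<and> ?a \<noteq> ?b"] lat_mult lat_bidivdiff lat_val)
          (auto simp: R_D)
      fix f w assume w: "w \<in> W"
      let ?f = "gen_op (Idem_Gen \<nu>) f"
      have e: "?a = col (w ! (k - 1))" "?b = col (w ! k)" "?c = col (w ! (k + 1))" if "map col w = \<nu>"
        using that k W_length[OF w] entry_map_col[OF w, of k] entry_map_col[OF w, of "k + 1"]
          entry_map_col[OF w, of "k + 2"] by auto
      define x y z where "x = val (w ! (k - 1))" and "y = val (w ! k)" and "z = val (w ! (k + 1))"
      have ne: "z - x \<noteq> 0" if "map col w = \<nu>" "?a = ?c"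
        using val_inj[OF w, of "k + 1" "k - 1"] k e that by (simp add: x_def z_def)
      \<comment> \<open>The divided difference is taken of \<open>Q + eps D\<close>, so the error
        against the relation for \<open>Q\<close> is \<open>eps\<close> times the divided difference
        of \<open>D\<close>, again a polynomial expression in the values.\<close>
      have dd: "(Qt ?a ?b z y - Qt ?a ?b x y) / (z - x) = bidivdiff \<phi> (Q ?a ?b) z x y + eps * bidivdiff id (D ?a ?b) z x y"
        if "map col w = \<nu>" "?a = ?c"
      proof -
        have "(z - x) * (bidivdiff \<phi> (Q ?a ?b) z x y + eps * bidivdiff id (D ?a ?b) z x y) =
            (z - x) * bidivdiff \<phi> (Q ?a ?b) z x y + eps * ((z - x) * bidivdiff id (D ?a ?b) z x y)"
          by (simp add: algebra_simps)
        also have "\<dots> = Qt ?a ?b z y - Qt ?a ?b x y"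
          unfolding bidivdiff Qt_def right_diff_distrib by simp
        finally show ?thesis using ne[OF that] by (metis nonzero_mult_div_cancel_left)
      qed
      have dg: "bidivdiff \<phi> (Q ?a ?b) z x y = 0" if "?a = ?b"
        unfolding that Q_diag by (simp add: bidivdiff_def bicoeff_def)
      have "act ((tau (k + 1) * tau k * tau (k + 1) - tau k * tau (k + 1) * tau k) * idem \<nu>) f w =
        tau_op (k + 1) (tau_op k (tau_op (k + 1) ?f)) w - tau_op k (tau_op (k + 1) (tau_op k ?f)) w"
        by (simp only: act_mult act_diff act_gen gen_op_Tau[OF braid(3)] gen_op_Tau[OF braid(4)])
      also have "\<dots> = (if map col w = \<nu> \<and> ?a = ?c \<and> ?a \<noteq> ?b then (Qt ?a ?b z y - Qt ?a ?b x y) / (z - x) * f w else 0)"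
      proof (cases "map col w = \<nu>")
        case True
        show ?thesis
          unfolding tau_op_braid[OF w k] x_def y_def z_def e[OF True] using True by auto
      next
        case False
        then show ?thesis unfolding tau_op_braid[OF w k] by simp
      qed
      finally have 1: "act ((tau (k + 1) * tau k * tau (k + 1) - tau k * tau (k + 1) * tau k) * idem \<nu>) f w = \<dots>" .
      have 2: "act (if ?a = ?c then bidivdiff scalar (Q ?a ?b) (xgen (k + 2)) (xgen k) (xgen (k + 1)) * idem \<nu> else 0) f w
        = (if map col w = \<nu> \<and> ?a = ?c then bidivdiff \<phi> (Q ?a ?b) z x y * f w else 0)"
        using k by (simp add: act_mult act_bidivdiff x_def y_def z_def)
      show "act p f w = eps * ?g f w"
      proof (cases "map col w = \<nu> \<and> ?a = ?c")
        case True
        then have T: "map col w = \<nu>" "?a = ?c" by auto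
        show ?thesis
          unfolding braid(1) act_diff 1 2 dd[OF T] x_def[symmetric] y_def[symmetric] z_def[symmetric]
          using True dg by (cases "?a = ?b") (simp_all add: distrib_right)
      next
        case False
        then show ?thesis unfolding braid(1) act_diff 1 2 by auto
      qed
    qed
  qed
qed

end

section \<open>Root data and the polynomials \<open>Q\<^sub>i\<^sub>,\<^sub>j\<close>\<close>

lemma lookup_sum_list_simple:
  "Poly_Mapping.lookup (sum_list (map simple l)) a = int (count_list l a)"
  by (induction l) (auto simp: simple_def lookup_add lookup_single when_def)

lemma height_sum_list_simple: "height (sum_list (map simple l)) = length l"
proof -
  let ?g = "sum_list (map simple l)"
  have "Poly_Mapping.keys ?g = set l"
    by (auto simp: in_keys_iff lookup_sum_list_simple count_list_0_iff)
  then show ?thesis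
    by (simp add: height_def lookup_sum_list_simple sum_count_set flip: of_nat_sum)
qed

text \<open>Induction on the height, removing one simple root that occurs in the element.\<close>

lemma pos_cone_sum_list:
  assumes "\<gamma> \<in> pos_cone"
  shows "\<exists>l. \<gamma> = sum_list (map simple l)"
proof -
  define N where "N = (\<Sum>a\<in>Poly_Mapping.keys \<gamma>. nat (Poly_Mapping.lookup \<gamma> a))"
  from N_def assms show ?thesis
  proof (induction N arbitrary: \<gamma>)
    case 0
    then have "Poly_Mapping.lookup \<gamma> a \<le> 0" if "a \<in> Poly_Mapping.keys \<gamma>" for a
      using that by auto
    moreover have "0 \<le> Poly_Mapping.lookup \<gamma> a" for a using 0(2) by (simp add: pos_cone_def)
    ultimately have "Poly_Mapping.keys \<gamma> = {}"
      by (meson all_not_in_conv in_keys_iff order_antisym)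
    then show ?case by (intro exI[of _ "[]"]) simp
  next
    case (Suc N)
    then obtain a where a: "a \<in> Poly_Mapping.keys \<gamma>" by fastforce
    moreover have "0 \<le> Poly_Mapping.lookup \<gamma> a" using Suc(3) by (simp add: pos_cone_def)
    ultimately have pos: "Poly_Mapping.lookup \<gamma> a > 0"
      by (simp add: in_keys_iff)
    let ?d = "\<gamma> - simple a"
    have look: "Poly_Mapping.lookup ?d b = Poly_Mapping.lookup \<gamma> b - (if b = a then 1 else 0)" for b
      by (simp add: lookup_minus simple_def lookup_single when_def)
    have sub: "Poly_Mapping.keys ?d \<subseteq> Poly_Mapping.keys \<gamma>"
      using a by (auto simp: in_keys_iff look split: if_splits)
    have "(\<Sum>b\<in>Poly_Mapping.keys ?d. nat (Poly_Mapping.lookup ?d b)) =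
        (\<Sum>b\<in>Poly_Mapping.keys \<gamma>. nat (Poly_Mapping.lookup ?d b))"
      by (rule sum.mono_neutral_left) (use sub in \<open>auto simp: in_keys_iff\<close>)
    also have "\<dots> = nat (Poly_Mapping.lookup \<gamma> a) - 1 +
        (\<Sum>b\<in>Poly_Mapping.keys \<gamma> - {a}. nat (Poly_Mapping.lookup \<gamma> b))"
      using a by (subst sum.remove[of _ a]) (auto simp: look nat_diff_distrib)
    also have "\<dots> = N"
      using Suc(2) a pos by (subst (asm) sum.remove[of _ a]) auto
    finally have "N = (\<Sum>b\<in>Poly_Mapping.keys ?d. nat (Poly_Mapping.lookup ?d b))" ..
    moreover have "?d \<in> pos_cone"
      using Suc(3) pos by (auto simp: pos_cone_def look)
    ultimately obtain l where "?d = sum_list (map simple l)" using Suc(1) by blast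
    then have "\<gamma> = sum_list (map simple (a # l))" by (simp add: algebra_simps)
    then show ?case by blast
  qed
qed

lemma sum_count_list_times:
  fixes f :: "'a \<Rightarrow> int"
  assumes "finite A" "set l \<subseteq> A"
  shows "(\<Sum>j\<in>A. int (count_list l j) * f j) = sum_list (map f l)"
  using assms(2)
proof (induction l)
  case (Cons x l)
  have "(\<Sum>j\<in>A. int (count_list (x # l) j) * f j) =
      (\<Sum>j\<in>A. int (count_list l j) * f j + (if j = x then f j else 0))"
    by (rule sum.cong) (auto simp: algebra_simps)
  also have "\<dots> = sum_list (map f l) + f x"
    using Cons assms(1) by (simp add: sum.distrib)
  finally show ?case by simp
qed simp

lemma coroot_sum_list: "coroot B i (sum_list (map simple l)) = sum_list (map (cartan B i) l)"
proof -
  let ?g = "sum_list (map simple l)"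
  have "Poly_Mapping.keys ?g = set l"
    by (auto simp: in_keys_iff lookup_sum_list_simple count_list_0_iff)
  then have "coroot B i ?g = (\<Sum>j\<in>set l. int (count_list l j) * cartan B i j)"
    by (simp add: coroot_def lookup_sum_list_simple)
  also have "\<dots> = sum_list (map (cartan B i) l)"
    by (rule sum_count_list_times) simp_all
  finally show ?thesis .
qed

lemma sum_list_filter_partition:
  fixes f :: "'a \<Rightarrow> 'b::comm_monoid_add"
  shows "sum_list (map f l) = sum_list (map f (filter P l)) + sum_list (map f (filter (\<lambda>x. \<not> P x) l))"
  by (induction l) (auto simp: ac_simps)

text \<open>The coefficient of \<open>i\<close> in the reflected element is
  \<open>c - (2 c + \<Sum>j\<leftarrow>js. cartan B i j)\<close>; its being nonnegative is the
  stated bound on \<open>c\<close>.\<close>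

lemma pos_cone_decomposition:
  assumes B: "cartan_datum B" and \<beta>: "\<beta> \<in> pos_cone" "\<beta> \<noteq> 0" and s: "simple_reflection B i \<beta> \<in> pos_cone"
  obtains js c where "i \<notin> set js" "js \<noteq> []" "\<beta> = sum_list (map simple (js @ replicate c i))"
    "c \<le> (\<Sum>j\<leftarrow>js. nat (- cartan B i j))"
proof -
  obtain l where l: "\<beta> = sum_list (map simple l)" using pos_cone_sum_list[OF \<beta>(1)] by blast
  define js where "js = filter (\<lambda>x. x \<noteq> i) l"
  define c where "c = count_list l i"
  have rep: "filter (\<lambda>x. \<not> x \<noteq> i) l = replicate c i"
    unfolding c_def by (induction l) auto
  have sums: "sum_list (map f l) = sum_list (map f js) + sum_list (map f (replicate c i))"
    for f :: "'a \<Rightarrow> 'c::comm_monoid_add"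
    using sum_list_filter_partition[of f l "\<lambda>x. x \<noteq> i"] unfolding rep js_def .
  have i: "i \<notin> set js" by (simp add: js_def)
  have bb: "\<beta> = sum_list (map simple (js @ replicate c i))" using sums[of simple] l by simp
  have pos: "0 < B (simple i) (simple i)" using B by (simp add: cartan_datum_def)
  have cii: "cartan B i i = 2" using pos by (simp add: cartan_def)
  have "cartan B i j \<le> 0" if "j \<in> set js" for j
    using that i B unfolding cartan_datum_def by metis
  then have "(\<Sum>j\<leftarrow>js. cartan B i j) = - int (\<Sum>j\<leftarrow>js. nat (- cartan B i j))"
    by (induction js) auto
  then have "coroot B i \<beta> = - int (\<Sum>j\<leftarrow>js. nat (- cartan B i j)) + 2 * int c"
    unfolding l coroot_sum_list sums[of "cartan B i"] by (simp add: cii sum_list_replicate)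
  moreover have "Poly_Mapping.lookup \<beta> i = int c"
    by (simp add: l lookup_sum_list_simple c_def)
  moreover have "0 \<le> Poly_Mapping.lookup (simple_reflection B i \<beta>) i"
    using s by (simp add: pos_cone_def)
  ultimately have le: "c \<le> (\<Sum>j\<leftarrow>js. nat (- cartan B i j))"
    by (simp add: simple_reflection_def lookup_minus)
  \<comment> \<open>With no other letters the bound would force \<open>c = 0\<close> and so
    \<open>\<beta> = 0\<close>.\<close>
  have "js \<noteq> []"
  proof
    assume "js = []"
    then have "\<beta> = 0" using bb le by simp
    then show False using \<beta>(2) by simp
  qed
  then show thesis using that i bb le by blast
qed

section \<open>A unit coefficient in the polynomials \<open>Q j i\<close>\<close>

lemma cartan_neg_iff:
  assumes "cartan_datum B"
  shows "cartan B i j < 0 \<longleftrightarrow> B (simple i) (simple j) < 0"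
proof -
  have "0 < B (simple i) (simple i)" using assms by (simp add: cartan_datum_def)
  then show ?thesis by (simp add: cartan_def pos_imp_zdiv_neg_iff)
qed

lemma half_norm_cartan:
  assumes B: "cartan_datum B" and "i \<noteq> j"
  shows "half_norm B i * cartan B i j = B (simple i) (simple j)"
proof -
  have e: "even (B (simple i) (simple i))" "0 < B (simple i) (simple i)"
    and d: "B (simple i) (simple i) dvd 2 * B (simple i) (simple j)"
    using assms by (simp_all add: cartan_datum_def)
  have "2 * half_norm B i = B (simple i) (simple i)" using e by (simp add: half_norm_def)
  moreover have "B (simple i) (simple i) * cartan B i j = 2 * B (simple i) (simple j)"
    using d by (simp add: cartan_def)
  ultimately show ?thesis by (metis mult.assoc mult_cancel_left zero_neq_numeral)
qed

text \<open>A mixed monomial with this exponent of \<open>v\<close> would have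
  \<open>half_norm B j * int s = 0\<close> with \<open>s > 0\<close>, by homogeneity. So only the
  pure power of \<open>v\<close> contributes, and after \<open>u\<close> is specialized to any
  element of a field the polynomial in \<open>v\<close> still has at least this degree.\<close>

lemma klr_polynomials_coeff:
  assumes B: "cartan_datum B" and Q: "klr_polynomials B Q" and ij: "i \<noteq> j" and neg: "cartan B i j < 0"
  shows "\<exists>a. a dvd 1 \<and> Polynomial.coeff (Q j i) (nat (- cartan B i j)) = [:a:]"
proof -
  let ?m = "nat (- cartan B i j)"
  have sym: "B (simple j) (simple i) = B (simple i) (simple j)" using B by (simp add: cartan_datum_def)
  have neg': "cartan B j i < 0" using neg by (simp add: cartan_neg_iff[OF B] sym)
  let ?P = "\<lambda>\<theta> i j. \<theta> i j dvd 1 \<and> \<theta> j i dvd 1 \<and>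
        (\<exists>r. (\<forall>s t. bicoeff r s t \<noteq> 0 \<longrightarrow>
                0 < s \<and> 0 < t \<and>
                half_norm B i * int s + half_norm B j * int t = - B (simple i) (simple j)) \<and>
             Q i j = bimonom (\<theta> i j) (nat (- cartan B i j)) 0
                   + bimonom (\<theta> j i) 0 (nat (- cartan B j i)) + r)"
  have "\<exists>\<theta>. \<forall>i j. i \<noteq> j \<longrightarrow> cartan B i j < 0 \<longrightarrow> ?P \<theta> i j"
    using Q unfolding klr_polynomials_def by (elim conjE)
  then obtain \<theta> where "\<forall>i j. i \<noteq> j \<longrightarrow> cartan B i j < 0 \<longrightarrow> ?P \<theta> i j" ..
  then have "?P \<theta> j i" using ij neg' by simp
  then obtain r where u: "\<theta> i j dvd 1"
    and r: "\<forall>s t. bicoeff r s t \<noteq> 0 \<longrightarrow> 0 < s \<and> 0 < t \<and>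
       half_norm B j * int s + half_norm B i * int t = - B (simple j) (simple i)"
    and Qe: "Q j i = bimonom (\<theta> j i) (nat (- cartan B j i)) 0 + bimonom (\<theta> i j) 0 ?m + r"
    by (elim conjE exE) rule
  have "Polynomial.coeff (Polynomial.coeff r ?m) s = 0" for s
  proof (rule ccontr)
    assume "Polynomial.coeff (Polynomial.coeff r ?m) s \<noteq> 0"
    then have s: "0 < s" and eq: "half_norm B j * int s + half_norm B i * int ?m = - B (simple j) (simple i)"
      using r[rule_format, of s ?m] unfolding bicoeff_def by blast+
    have "half_norm B i * int ?m = - B (simple i) (simple j)"
      using half_norm_cartan[OF B ij] neg by simp
    then have "half_norm B j * int s = 0" using eq sym by simp
    moreover have "even (B (simple j) (simple j))" "0 < B (simple j) (simple j)"
      using B by (simp_all add: cartan_datum_def)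
    then have "half_norm B j \<noteq> 0" unfolding half_norm_def by (auto elim!: evenE)
    ultimately show False using s by simp
  qed
  then have "Polynomial.coeff r ?m = 0" by (simp add: poly_eq_iff)
  then have "Polynomial.coeff (Q j i) ?m = [:\<theta> i j:]"
    using neg unfolding Qe bimonom_def coeff_add coeff_monom by (simp add: monom_0)
  then show ?thesis using u by blast
qed

section \<open>Evaluation of polynomials in two variables\<close>

lemma bieval_superset:
  assumes "Polynomial.degree p \<le> M" "\<And>t. Polynomial.degree (Polynomial.coeff p t) \<le> N" "\<psi> 0 = 0"
  shows "bieval \<psi> p x y = (\<Sum>t\<le>M. \<Sum>s\<le>N. \<psi> (bicoeff p s t) * x ^ s * y ^ t)"
proof -
  have "(\<Sum>s\<le>Polynomial.degree (Polynomial.coeff p t). \<psi> (bicoeff p s t) * x ^ s * y ^ t) =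
      (\<Sum>s\<le>N. \<psi> (bicoeff p s t) * x ^ s * y ^ t)" for t
    by (rule sum.mono_neutral_left) (use assms in \<open>auto simp: bicoeff_def coeff_eq_0\<close>)
  then have "bieval \<psi> p x y = (\<Sum>t\<le>Polynomial.degree p. \<Sum>s\<le>N. \<psi> (bicoeff p s t) * x ^ s * y ^ t)"
    by (simp add: bieval_def)
  also have "\<dots> = (\<Sum>t\<le>M. \<Sum>s\<le>N. \<psi> (bicoeff p s t) * x ^ s * y ^ t)"
    by (rule sum.mono_neutral_left) (use assms in \<open>auto simp: bicoeff_def coeff_eq_0\<close>)
  finally show ?thesis .
qed

lemma poly_superset:
  fixes x :: "'a::comm_semiring_1"
  shows "Polynomial.degree p \<le> M \<Longrightarrow> poly p x = (\<Sum>t\<le>M. Polynomial.coeff p t * x ^ t)"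
  unfolding poly_altdef by (rule sum.mono_neutral_left) (auto simp: coeff_eq_0)

lemma bieval_poly:
  fixes x y :: "'r::comm_ring_1"
  assumes "\<psi> 0 = 0"
  shows "bieval \<psi> p x y = poly (map_poly (\<lambda>c. poly (map_poly \<psi> c) x) p) y"
proof -
  have 1: "poly (map_poly \<psi> c) x = (\<Sum>s\<le>Polynomial.degree c. \<psi> (Polynomial.coeff c s) * x ^ s)" for c
    by (subst poly_superset[OF map_poly_degree_leq]) (simp add: coeff_map_poly[of \<psi>, OF assms])
  let ?h = "\<lambda>c. poly (map_poly \<psi> c) x"
  have h0: "?h 0 = 0" by simp
  have "poly (map_poly ?h p) y = (\<Sum>t\<le>Polynomial.degree p. ?h (Polynomial.coeff p t) * y ^ t)"
    by (subst poly_superset[OF map_poly_degree_leq]) (simp add: coeff_map_poly[of ?h, OF h0])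
  then show ?thesis
    by (simp add: 1 bieval_def bicoeff_def sum_distrib_right)
qed

text \<open>Summing over one square of exponents that contains both supports permits the exchange of
  the two summations.\<close>

lemma bieval_swap:
  fixes x y :: "'r::comm_ring_1"
  assumes "\<psi> 0 = 0" "\<And>s t. bicoeff p s t = bicoeff q t s"
  shows "bieval \<psi> p x y = bieval \<psi> q y x"
proof -
  have bound: "\<exists>N. \<forall>t. Polynomial.degree (Polynomial.coeff r t) \<le> N" for r :: "'k::comm_ring_1 poly poly"
  proof -
    have "Polynomial.degree (Polynomial.coeff r t) \<le> Max ((\<lambda>t. Polynomial.degree (Polynomial.coeff r t)) ` {..Polynomial.degree r})" for t
    proof (cases "t \<le> Polynomial.degree r")
      case False
      then show ?thesis by (simp add: coeff_eq_0)
    qed auto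
    then show ?thesis by blast
  qed
  obtain N1 where N1: "\<And>t. Polynomial.degree (Polynomial.coeff p t) \<le> N1" using bound by blast
  obtain N2 where N2: "\<And>t. Polynomial.degree (Polynomial.coeff q t) \<le> N2" using bound by blast
  let ?N = "Max {N1, N2, Polynomial.degree p, Polynomial.degree q}"
  have N: "N1 \<le> ?N" "N2 \<le> ?N" "Polynomial.degree p \<le> ?N" "Polynomial.degree q \<le> ?N" by auto
  have "bieval \<psi> p x y = (\<Sum>t\<le>?N. \<Sum>s\<le>?N. \<psi> (bicoeff p s t) * x ^ s * y ^ t)"
    by (rule bieval_superset) (use N(3) le_trans[OF N1 N(1)] assms(1) in simp_all)
  also have "\<dots> = (\<Sum>s\<le>?N. \<Sum>t\<le>?N. \<psi> (bicoeff q t s) * y ^ t * x ^ s)"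
    unfolding assms(2) by (subst sum.swap) (simp add: mult.commute mult.left_commute)
  also have "\<dots> = bieval \<psi> q y x"
    by (rule bieval_superset[symmetric]) (use N(4) le_trans[OF N2 N(2)] assms(1) in simp_all)
  finally show ?thesis .
qed

text \<open>The product \<open>p(u) q(v)\<close>. It serves to interpolate in one variable while the
  polynomial in the other variable is prescribed.\<close>

definition tensor :: "'a::comm_ring_1 poly \<Rightarrow> 'a poly \<Rightarrow> 'a poly poly"
  where "tensor p q = map_poly (\<lambda>c. Polynomial.smult c p) q"

lemma bicoeff_tensor: "bicoeff (tensor p q) s t = Polynomial.coeff p s * Polynomial.coeff q t"
  by (simp add: tensor_def bicoeff_def coeff_map_poly mult.commute)

lemma bicoeff_sum: "bicoeff (\<Sum>a\<in>A. p a) s t = (\<Sum>a\<in>A. bicoeff (p a) s t)"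
  by (simp add: bicoeff_def coeff_sum)

lemma bieval_id: "bieval id p x y = poly (poly p [:y:]) x" for x y :: "'r::comm_ring_1"
proof -
  have "poly (map_poly (\<lambda>c. poly c x) p) y = poly (poly p [:y:]) x"
    by (induction p) (auto simp: map_poly_pCons mult.commute)
  then show ?thesis by (simp add: bieval_poly map_poly_id[unfolded id_def])
qed

lemma bieval_tensor: "bieval id (tensor p q) x y = poly p x * poly q y"
proof -
  have "poly (tensor p q) [:y:] = Polynomial.smult (poly q y) p" for y
    unfolding tensor_def by (induction q) (auto simp: map_poly_pCons smult_add_left mult.commute)
  then show ?thesis by (simp add: bieval_id mult.commute)
qed

lemma bieval_sum: "bieval id (\<Sum>a\<in>A. p a) x y = (\<Sum>a\<in>A. bieval id (p a) x y)" for x y :: "'r::comm_ring_1"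
  by (simp add: bieval_id poly_sum)

section \<open>Deformation of roots\<close>

text \<open>As long as fewer roots have been split off than the degree of \<open>q\<close>, the
  cofactor has positive degree and hence a root. A list is used because roots may repeat.\<close>

lemma alg_closed_split_off_roots:
  fixes q :: "'e::alg_closed_field poly"
  assumes "m \<le> Polynomial.degree q"
  shows "\<exists>g zs. length zs = m \<and> q = g * (\<Prod>z\<leftarrow>zs. [:- z, 1:])"
  using assms
proof (induction m)
  case 0
  then show ?case by (intro exI[of _ q] exI[of _ "[]"]) simp
next
  case (Suc m)
  then obtain g zs where g: "length zs = m" "q = g * (\<Prod>z\<leftarrow>zs. [:- z, 1:])" by auto
  have "Polynomial.degree (\<Prod>z\<leftarrow>zs. [:- z, 1:]) = length zs"
  proof (induction zs)
    case (Cons z zs)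
    have "Polynomial.degree ([:- z, 1:] * (\<Prod>z\<leftarrow>zs. [:- z, 1:])) = Suc (length zs)"
      using Cons by (subst degree_mult_eq) (auto simp: prod_list_zero_iff)
    then show ?case by simp
  qed simp
  moreover have "q \<noteq> 0" using Suc.prems by auto
  ultimately have "Polynomial.degree g + m = Polynomial.degree q" using g by (subst g(2), subst degree_mult_eq) auto
  then have "Polynomial.degree g > 0" using Suc.prems by simp
  then obtain z where "poly g z = 0" using alg_closed_imp_poly_has_root by blast
  then obtain g' where "g = [:- z, 1:] * g'" by (auto simp: poly_eq_0_iff_dvd elim!: dvdE)
  then have "q = g' * (\<Prod>z\<leftarrow>z # zs. [:- z, 1:])"
    using g(2) by (simp only: list.map prod_list.Cons mult_ac)
  then show ?case using g(1) by (metis length_Cons)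
qed

section \<open>Polynomials with coefficients in a subring\<close>

locale unital_subring =
  fixes R :: "'a::comm_ring_1 set"
  assumes one_mem: "1 \<in> R"
    and add_mem: "a \<in> R \<Longrightarrow> b \<in> R \<Longrightarrow> a + b \<in> R"
    and mult_mem: "a \<in> R \<Longrightarrow> b \<in> R \<Longrightarrow> a * b \<in> R"
    and uminus_mem: "a \<in> R \<Longrightarrow> - a \<in> R"
begin

lemma zero_mem: "0 \<in> R"
  using add_mem[OF one_mem uminus_mem[OF one_mem]] by simp

lemma sum_mem: "(\<And>a. a \<in> A \<Longrightarrow> f a \<in> R) \<Longrightarrow> sum f A \<in> R"
  by (induction A rule: infinite_finite_induct) (simp_all add: zero_mem add_mem)

lemma coeff_mult_mem:
  "(\<And>t. Polynomial.coeff p t \<in> R) \<Longrightarrow> (\<And>t. Polynomial.coeff q t \<in> R) \<Longrightarrow> Polynomial.coeff (p * q) t \<in> R"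
  unfolding coeff_mult by (intro sum_mem mult_mem)

lemma coeff_linear_mem: "a \<in> R \<Longrightarrow> Polynomial.coeff [:- a, 1:] t \<in> R"
  by (auto simp: coeff_pCons zero_mem one_mem uminus_mem split: nat.split)

lemma coeff_prod_linear_mem:
  fixes m :: nat
  shows "(\<And>k. k < m \<Longrightarrow> z k \<in> R) \<Longrightarrow> Polynomial.coeff (\<Prod>k<m. [:- z k, 1:]) t \<in> R"
proof (induction m arbitrary: t)
  case 0
  then show ?case by (simp add: coeff_pCons zero_mem one_mem split: nat.split)
next
  case (Suc m)
  show ?case
    unfolding prod.lessThan_Suc by (intro coeff_mult_mem Suc.IH coeff_linear_mem Suc.prems) simp_all
qed

text \<open>Shifting all roots by multiples of \<open>e\<close> changes the product by a multiple of
  \<open>e\<close>, and the quotient \<open>G\<close> still has coefficients in \<open>R\<close>;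
  this is what makes the deformation integral.\<close>

lemma perturb_product:
  fixes m :: nat
  assumes e: "e \<in> R" and z: "\<And>k. z k \<in> R" and c: "\<And>k. c k \<in> R"
  shows "\<exists>G. (\<forall>t. Polynomial.coeff G t \<in> R) \<and>
    (\<Prod>k<m. [:- (z k + e * c k), 1:]) = (\<Prod>k<m. [:- z k, 1:]) + Polynomial.smult e G"
proof (induction m)
  case 0
  show ?case by (rule exI[of _ 0]) (simp add: zero_mem)
next
  case (Suc m)
  then obtain G where G: "\<And>t. Polynomial.coeff G t \<in> R"
    "(\<Prod>k<m. [:- (z k + e * c k), 1:]) = (\<Prod>k<m. [:- z k, 1:]) + Polynomial.smult e G"
    by blast
  let ?P = "\<Prod>k<m. [:- z k, 1:]"
  let ?l = "[:- (z m + e * c m), 1:]"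
  \<comment> \<open>Read off from splitting the new factor as the old one minus
    \<open>e * c m\<close>: the error is \<open>G\<close> times the new factor, minus
    \<open>c m\<close> times the product of the old factors.\<close>
  let ?G = "G * ?l + Polynomial.smult (- c m) ?P"
  have "Polynomial.coeff (G * ?l) t \<in> R" for t
    by (intro coeff_mult_mem G(1) coeff_linear_mem add_mem mult_mem e z c)
  moreover have "Polynomial.coeff (Polynomial.smult (- c m) ?P) t \<in> R" for t
    unfolding coeff_smult by (intro mult_mem uminus_mem c coeff_prod_linear_mem z)
  ultimately have "Polynomial.coeff ?G t \<in> R" for t
    unfolding coeff_add by (intro add_mem)
  moreover have "(?P + Polynomial.smult e G) * ?l = ?P * [:- z m, 1:] + Polynomial.smult e ?G"
  proof -
    have "?l = [:- z m, 1:] + Polynomial.smult (e * - c m) 1" by (simp add: one_pCons)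
    then have "?P * ?l = ?P * [:- z m, 1:] + Polynomial.smult (e * - c m) ?P"
      by (simp only: distrib_left mult_smult_right mult_1_right)
    then show ?thesis
      by (simp only: distrib_right mult_smult_left smult_add_right smult_smult add.assoc) (simp only: add_ac)
  qed
  ultimately show ?case
    unfolding prod.lessThan_Suc G(2) by blast
qed

end

section \<open>Finite generation and the powers of the first value\<close>

context klr_points
begin

lemma last_idem_small:
  assumes "\<And>w. w \<in> Om \<Longrightarrow> w \<noteq> [] \<Longrightarrow> col (w ! 0) \<noteq> i"
  shows "(\<Sum>\<nu> | \<nu> \<in> seqs \<beta> \<and> \<nu> \<noteq> [] \<and> entry \<nu> 1 = i. idem \<nu>) \<in> small_ideal"
proof -
  let ?V = "{\<nu>. \<nu> \<in> seqs \<beta> \<and> \<nu> \<noteq> [] \<and> entry \<nu> 1 = i}"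
  have "act (\<Sum>\<nu>\<in>?V. idem \<nu>) f w = 0" if w: "w \<in> Om" for f w
  proof -
    have "map col w \<notin> ?V"
      using assms[OF w] by (cases w) (auto simp: entry_def)
    then show ?thesis unfolding act_sum by (intro sum.neutral) auto
  qed
  then show ?thesis
    using last_idem_sum_carrier by (auto simp: small_ideal_def intro!: small_zero)
qed

text \<open>The powers of \<open>x\<close> with index 1 act on the constant function 1, and the
  result is evaluated at \<open>w0\<close>. Modulo \<open>small_ideal\<close> each power is a
  combination of the finitely many \<open>r s\<close>, so each power of the first value is, modulo
  \<open>eps\<close>, a combination of the numbers \<open>v s\<close>.\<close>

lemma finitely_generated_values:
  assumes fg: "finitely_generated_module scalar_ring (klr_quotient Q \<beta> i)"
    and w0: "w0 \<in> Om" and Om_first: "\<And>w. w \<in> Om \<Longrightarrow> w \<noteq> [] \<Longrightarrow> col (w ! 0) \<noteq> i" and n: "1 \<le> n"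
  obtains S :: "('i klr_gen, 'k) free set set set" and v
  where "finite S" "\<And>m. \<exists>a. \<exists>g\<in>R. val (w0 ! 0) ^ m = (\<Sum>s\<in>S. \<phi> (a s) * v s) + eps * g"
proof -
  show thesis
  proof (rule finitely_generated_klr_quotientD[OF fg small_ideal_ideal klr_relations_small last_idem_small[OF Om_first]])
    fix S :: "('i klr_gen, 'k) free set set set" and r
    assume S: "finite S"
      and gen: "\<And>h. h \<in> carrier (free_algebra (klr_gens \<beta>)) \<Longrightarrow>
        \<exists>a. h - (\<Sum>s\<in>S. scalar (a s) * r s) \<in> small_ideal"
  have "\<exists>a. \<exists>g\<in>R. val (w0 ! 0) ^ m = (\<Sum>s\<in>S. \<phi> (a s) * act (r s) (\<lambda>_. 1) w0) + eps * g" for m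
  proof -
    have "xgen 1 ^ m \<in> carrier (free_algebra (klr_gens \<beta>))"
      using n by (intro free_carrier_power free_carrier(4)) (auto simp: klr_gens_def)
    from gen[OF this] obtain a where "xgen 1 ^ m - (\<Sum>s\<in>S. scalar (a s) * r s) \<in> small_ideal" by blast
    then have "small (act (xgen 1 ^ m - (\<Sum>s\<in>S. scalar (a s) * r s)) (\<lambda>_. 1))"
      using lat_const[OF R(1)] by (simp add: small_ideal_def)
    then obtain g where "g \<in> lat"
      and g: "act (xgen 1 ^ m - (\<Sum>s\<in>S. scalar (a s) * r s)) (\<lambda>_. 1) w0 = eps * g w0"
      using w0 by (auto simp: small_def)
    moreover have "act (xgen 1 ^ m) (\<lambda>_. 1) w0 = val (w0 ! 0) ^ m"
      using n by (simp add: act_x_power)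
    ultimately have "val (w0 ! 0) ^ m = (\<Sum>s\<in>S. \<phi> (a s) * act (r s) (\<lambda>_. 1) w0) + eps * g w0"
      by (simp add: act_diff act_sum act_mult diff_eq_eq add.commute)
    moreover have "g w0 \<in> R" using lat_R[OF \<open>g \<in> lat\<close>] w0 Om_W by blast
    ultimately show ?thesis by blast
  qed
  then show thesis by (rule that[OF S])
  qed simp_all
qed

end

abbreviation (input) fls_const_poly :: "'e::comm_ring_1 poly \<Rightarrow> 'e fls poly"
  where "fls_const_poly \<equiv> map_poly fls_const"

text \<open>The power series are viewed inside the field of Laurent series: divided differences need
  division, and integrality becomes membership in this range.\<close>

lemma unital_subring_fps: "unital_subring (range fps_to_fls :: 'e::comm_ring_1 fls set)"
proof
  show "1 \<in> range (fps_to_fls :: 'e fps \<Rightarrow> _)" by (rule range_eqI[of _ _ 1]) simp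
  fix a b :: "'e fls" assume "a \<in> range fps_to_fls"
  then obtain f where f: "a = fps_to_fls f" by blast
  show "- a \<in> range fps_to_fls" unfolding f by (rule range_eqI[of _ _ "- f"]) simp
  assume "b \<in> range fps_to_fls"
  then obtain g where g: "b = fps_to_fls g" by blast
  show "a + b \<in> range fps_to_fls" unfolding f g by (rule range_eqI[of _ _ "f + g"]) simp
  show "a * b \<in> range fps_to_fls"
    unfolding f g by (rule range_eqI[of _ _ "f * g"]) (simp add: fls_times_fps_to_fls)
qed

lemma fls_const_mem: "fls_const x \<in> range fps_to_fls"
  by (rule range_eqI[of _ _ "fps_const x"]) simp

lemma fls_X_mem: "fls_X \<in> range fps_to_fls"
  by (rule range_eqI[of _ _ fps_X]) simp

lemma fls_const_sum: "fls_const (sum f A) = (\<Sum>a\<in>A. fls_const (f a))"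
  by (induction A rule: infinite_finite_induct) (simp_all flip: fls_plus_const)

lemma fls_const_poly_mult: "fls_const_poly (p * q) = fls_const_poly p * fls_const_poly q"
  by (rule poly_eqI) (simp add: coeff_map_poly coeff_mult fls_const_sum)

lemma fls_const_poly_prod_linear:
  fixes m :: nat
  shows "fls_const_poly (\<Prod>k<m. [:- z k, 1:]) = (\<Prod>k<m. [:- fls_const (z k), 1:])"
  by (induction m) (simp_all only: prod.lessThan_Suc fls_const_poly_mult, simp_all add: map_poly_pCons one_pCons)

lemma poly_map_fls_const:
  "poly (fls_const_poly p) (fls_const x) = fls_const (poly p x)"
  by (induction p) (simp_all add: map_poly_pCons flip: fls_plus_const)

text \<open>The cofactor of the split-off roots times the product with shifted roots differs from
  \<open>q\<close> by \<open>fls_X\<close> times an integral polynomial. The shifts \<open>c\<close>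
  are arbitrary, so the caller can use them to separate equal roots.\<close>

lemma deform_roots:
  fixes q :: "'e::alg_closed_field poly"
  assumes "m \<le> Polynomial.degree q"
  shows "\<exists>G z. (\<forall>t. Polynomial.coeff G t \<in> range fps_to_fls) \<and>
    (\<forall>r<m. poly (fls_const_poly q) (fls_const (z r) + fls_X * fls_const (c r)) +
      fls_X * poly G (fls_const (z r) + fls_X * fls_const (c r)) = 0)"
proof -
  interpret unital_subring "range fps_to_fls :: 'e fls set" by (rule unital_subring_fps)
  obtain g zs where zs: "length zs = m" "q = g * (\<Prod>z\<leftarrow>zs. [:- z, 1:])"
    using alg_closed_split_off_roots[OF assms] by blast
  define z where "z r = zs ! r" for r
  have q: "q = g * (\<Prod>k<m. [:- z k, 1:])"
    unfolding zs(2) prod.list_conv_set_nth z_def by (simp add: zs(1) atLeast0LessThan)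
  obtain G where G: "\<And>t. Polynomial.coeff G t \<in> range fps_to_fls"
    "(\<Prod>k<m. [:- (fls_const (z k) + fls_X * fls_const (c k)), 1:]) =
       (\<Prod>k<m. [:- fls_const (z k), 1:]) + Polynomial.smult fls_X G"
    using perturb_product[OF fls_X_mem, of "\<lambda>k. fls_const (z k)" "\<lambda>k. fls_const (c k)" m] fls_const_mem
    by blast
  let ?z = "\<lambda>k. fls_const (z k) + fls_X * fls_const (c k)"
  have "fls_const_poly q + Polynomial.smult fls_X (fls_const_poly g * G) =
      fls_const_poly g * ((\<Prod>k<m. [:- fls_const (z k), 1:]) + Polynomial.smult fls_X G)"
    unfolding q fls_const_poly_mult fls_const_poly_prod_linear by (simp add: distrib_left)
  then have eq: "fls_const_poly q + Polynomial.smult fls_X (fls_const_poly g * G) =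
      fls_const_poly g * (\<Prod>k<m. [:- ?z k, 1:])"
    unfolding G(2) .
  have "poly (fls_const_poly q) (?z r) + fls_X * poly (fls_const_poly g * G) (?z r) = 0" if "r < m" for r
  proof -
    have "poly (\<Prod>k<m. [:- ?z k, 1:]) (?z r) = 0"
      unfolding poly_prod using that by (intro prod_zero bexI[of _ r]) auto
    then show ?thesis
      using arg_cong[OF eq, of "\<lambda>p. poly p (?z r)"] by simp
  qed
  moreover have "Polynomial.coeff (fls_const_poly g * G) t \<in> range fps_to_fls" for t
    by (intro coeff_mult_mem G(1)) (simp add: coeff_map_poly fls_const_mem)
  ultimately show ?thesis by blast
qed

lemma (in unital_subring) coeff_prod_mem:
  "(\<And>a t. a \<in> A \<Longrightarrow> Polynomial.coeff (p a) t \<in> R) \<Longrightarrow> Polynomial.coeff (prod p A) t \<in> R"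
proof (induction A arbitrary: t rule: infinite_finite_induct)
  case (insert a A)
  then show ?case by (simp add: coeff_mult_mem)
qed (simp_all add: coeff_pCons one_pCons zero_mem one_mem split: nat.split)

text \<open>The nodes are constants, so their differences are invertible already in the ground field
  and the interpolation polynomials have integral coefficients.\<close>

lemma lagrange_basis:
  fixes y :: "nat \<Rightarrow> 'e::field"
  assumes "inj_on y {..<N}"
  shows "\<exists>L. (\<forall>k<N. \<forall>t. Polynomial.coeff (L k) t \<in> range fps_to_fls) \<and>
    (\<forall>k<N. \<forall>l<N. poly (L k) (fls_const (y l)) = (if k = l then 1 else 0))"
proof -
  interpret unital_subring "range fps_to_fls :: 'e fls set" by (rule unital_subring_fps)
  let ?f = "\<lambda>k l. Polynomial.smult (fls_const (1 / (y k - y l))) [:- fls_const (y l), 1:]"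
  define L where "L k = (\<Prod>l\<in>{..<N} - {k}. ?f k l)" for k
  have "Polynomial.coeff (L k) t \<in> range fps_to_fls" for k t
    unfolding L_def coeff_smult
    by (intro coeff_prod_mem) (simp only: coeff_smult mult_mem coeff_linear_mem fls_const_mem)
  moreover have "poly (L k) (fls_const (y l)) = (if k = l then 1 else 0)" if "k < N" "l < N" for k l
  proof (cases "k = l")
    case True
    have "poly (?f k j) (fls_const (y k)) = 1" if "j \<in> {..<N} - {k}" for j
    proof -
      have "y k - y j \<noteq> 0" using that \<open>k < N\<close> assms by (auto simp: inj_on_def)
      then have "fls_const (1 / (y k - y j)) * (fls_const (y k) - fls_const (y j)) = 1"
        by (simp add: fls_minus_const)
      then show ?thesis by (simp add: algebra_simps)
    qed
    then show ?thesis using True by (simp only: L_def poly_prod prod.neutral_const cong: prod.cong) simp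
  next
    case False
    have "poly (L k) (fls_const (y l)) = 0"
      unfolding L_def poly_prod using False that by (intro prod_zero bexI[of _ l]) auto
    then show ?thesis using False by simp
  qed
  ultimately show ?thesis by blast
qed

text \<open>Used to decide, for each pair of different colours, which of the two directions of
  exchange carries the factor \<open>Qt\<close>.\<close>

lemma exists_linear_rel: "\<exists>lt :: 'a \<Rightarrow> 'a \<Rightarrow> bool. \<forall>a b. a \<noteq> b \<longrightarrow> lt a b \<longleftrightarrow> \<not> lt b a"
proof -
  obtain r :: "'a rel" where r: "well_order_on UNIV r" using well_order_on by blast
  then have "antisym r" "total r"
    by (auto simp: well_order_on_def linear_order_on_def partial_order_on_def)
  then have "\<forall>a b. a \<noteq> b \<longrightarrow> ((a, b) \<in> r \<longleftrightarrow> \<not> (b, a) \<in> r)"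
    by (auto simp: antisym_def total_on_def)
  then show ?thesis by (intro exI[of _ "\<lambda>a b. (a, b) \<in> r"])
qed

section \<open>The module\<close>

text \<open>The module of the overview is built over Laurent series, and its consequence for the
  powers of the first value is reduced to constant coefficients.\<close>

lemma finitely_generated_klr_quotient_values:
  fixes \<iota> :: "'k::comm_ring_1 \<Rightarrow> 'e::alg_closed_field" and Q :: "'i \<Rightarrow> 'i \<Rightarrow> 'k poly poly"
  assumes \<iota>: "comm_ring_hom \<iota>" and Y: "inj (\<lambda>m::nat. Y ^ m)"
    and B: "cartan_datum B" and Q: "klr_polynomials B Q"
    and \<beta>: "\<beta> \<in> pos_cone" "\<beta> \<noteq> 0" "simple_reflection B i \<beta> \<in> pos_cone"
    and fg: "finitely_generated_module scalar_ring (klr_quotient Q \<beta> i)"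
  obtains S :: "('i klr_gen, 'k) free set set set" and v :: "('i klr_gen, 'k) free set set \<Rightarrow> 'e"
  where "finite S" "\<And>m. \<exists>a. Y ^ m = (\<Sum>s\<in>S. \<iota> (a s) * v s)"
proof -
  interpret \<iota>: comm_ring_hom \<iota> by (rule \<iota>)
  interpret fps: unital_subring "range fps_to_fls :: 'e fls set" by (rule unital_subring_fps)
  obtain js c where i: "i \<notin> set js" and "js \<noteq> []" and \<beta>_eq: "\<beta> = sum_list (map simple (js @ replicate c i))"
    and c: "c \<le> (\<Sum>j\<leftarrow>js. nat (- cartan B i j))"
    by (rule pos_cone_decomposition[OF B \<beta>])
  define N where "N = length js"
  define \<phi> where "\<phi> = (\<lambda>x. fls_const (\<iota> x))"
  have \<phi>: "comm_ring_hom \<phi>"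
    by standard (simp_all add: \<phi>_def \<iota>.hom_add \<iota>.hom_mult \<iota>.hom_1 flip: fls_plus_const)
  interpret \<phi>: comm_ring_hom \<phi> by (rule \<phi>)
  \<comment> \<open>Powers of \<open>Y\<close> are distinct by assumption; the shift by one makes
    the first parent value \<open>Y\<close> itself.\<close>
  define y where "y k = Y ^ (k + 1)" for k :: nat
  have y_inj: "y k = y l \<longleftrightarrow> k = l" for k l
    using inj_eq[OF Y, of "k + 1" "l + 1"] by (simp add: y_def)
  define m where "m k = nat (- cartan B i (js ! k))" for k
  define q where "q k = map_poly (\<lambda>p. poly (map_poly \<iota> p) (y k)) (Q (js ! k) i)" for k
  have q_deg: "m k \<le> Polynomial.degree (q k)" if "k < N" for k
  proof (cases "cartan B i (js ! k) < 0")
    case True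
    have "i \<noteq> js ! k" using i that by (auto simp: N_def)
    from klr_polynomials_coeff[OF B Q this True] obtain a where a: "a dvd 1"
      "Polynomial.coeff (Q (js ! k) i) (m k) = [:a:]"
      unfolding m_def by blast
    obtain b where "1 = a * b" using a(1) by (rule dvdE)
    then have "\<iota> a * \<iota> b = 1" by (metis \<iota>.hom_mult \<iota>.hom_1)
    then have "\<iota> a \<noteq> 0" by auto
    moreover have "Polynomial.coeff (q k) (m k) = \<iota> a"
      by (simp add: q_def coeff_map_poly a(2) map_poly_pCons \<iota>.hom_zero)
    ultimately show ?thesis by (simp add: le_degree)
  qed (simp add: m_def)
  \<comment> \<open>the coefficients of \<open>\<epsilon>\<close> that separate the roots\<close>
  define e where "e k r = Y ^ prod_encode (k, r)" for k r :: nat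
  have "\<forall>k<N. \<exists>G z. (\<forall>t. Polynomial.coeff G t \<in> range fps_to_fls) \<and>
    (\<forall>r<m k. poly (fls_const_poly (q k)) (fls_const (z r) + fls_X * fls_const (e k r)) +
      fls_X * poly G (fls_const (z r) + fls_X * fls_const (e k r)) = 0)"
    using deform_roots q_deg by blast
  then obtain G z where G: "\<And>k t. k < N \<Longrightarrow> Polynomial.coeff (G k) t \<in> range fps_to_fls"
    and z: "\<And>k r. k < N \<Longrightarrow> r < m k \<Longrightarrow>
      poly (fls_const_poly (q k)) (fls_const (z k r) + fls_X * fls_const (e k r)) +
      fls_X * poly (G k) (fls_const (z k r) + fls_X * fls_const (e k r)) = 0"
    by metis
  have "inj_on y {..<N}" by (simp add: inj_on_def y_inj)
  then obtain L where L: "\<And>k t. k < N \<Longrightarrow> Polynomial.coeff (L k) t \<in> range fps_to_fls"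
    and L_eval: "\<And>k l. k < N \<Longrightarrow> l < N \<Longrightarrow> poly (L k) (fls_const (y l)) = (if k = l then 1 else 0)"
    using lagrange_basis[of y N] by metis
  \<comment> \<open>Lagrange interpolation in \<open>u\<close>: \<open>Q j i + \<epsilon> D j i\<close> at \<open>u = y k\<close> has the deformed roots\<close>
  define D where "D a b = (if b = i \<and> a \<noteq> i then \<Sum>k | k < N \<and> js ! k = a. tensor (L k) (G k)
    else if a = i \<and> b \<noteq> i then \<Sum>k | k < N \<and> js ! k = b. tensor (G k) (L k) else 0)" for a b
  obtain lt :: "'i \<Rightarrow> 'i \<Rightarrow> bool" where lt: "\<forall>a b. a \<noteq> b \<longrightarrow> lt a b \<longleftrightarrow> \<not> lt b a"
    using exists_linear_rel ..
  \<comment> \<open>Placing \<open>i\<close> last puts the factor on the exchange of a parent with a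
    root directly after it, the exchange that has to vanish.\<close>
  define prec where "prec a b \<longleftrightarrow> a \<noteq> i \<and> (b = i \<or> lt a b)" for a b
  \<comment> \<open>the point \<open>(k, 0)\<close> is the \<open>k\<close>-th parent, and \<open>(k, Suc r)\<close> is its \<open>r\<close>-th root\<close>
  define col where "col p = (case snd p of 0 \<Rightarrow> js ! fst p | Suc r \<Rightarrow> i)" for p :: "nat \<times> nat"
  define val where "val p = (case snd p of 0 \<Rightarrow> fls_const (y (fst p))
    | Suc r \<Rightarrow> fls_const (z (fst p) r) + fls_X * fls_const (e (fst p) r))" for p :: "nat \<times> nat"
  have col_simps: "col (k, 0) = js ! k" "col (k, Suc r) = i" for k r by (simp_all add: col_def)
  have val_simps: "val (k, 0) = fls_const (y k)" "val (k, Suc r) = fls_const (z k r) + fls_X * fls_const (e k r)"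
    for k r by (simp_all add: val_def)
  \<comment> \<open>All available roots, indexed by parent and position, so that multiple roots
    count separately. There are at least \<open>c\<close> of them, and \<open>c\<close> are chosen
    for the letters \<open>i\<close>.\<close>
  define slots where "slots = (\<lambda>(k, r). (k, Suc r)) ` (SIGMA k:{..<N}. {..<m k})"
  have "card slots = (\<Sum>k<N. m k)"
    unfolding slots_def by (subst card_image) (auto simp: inj_on_def)
  also have "\<dots> = (\<Sum>j\<leftarrow>js. nat (- cartan B i j))"
    by (simp add: sum_list_sum_nth N_def m_def atLeast0LessThan)
  finally have "c \<le> card slots" using c by simp
  then obtain C where C: "C \<subseteq> slots" "card C = c" "finite C" by (rule obtain_subset_with_card_n)
  obtain cs where cs: "set cs = C" "distinct cs" using finite_distinct_list[OF C(3)] by blast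
  have cs_len: "length cs = c" using cs C by (metis distinct_card)
  \<comment> \<open>All parents come first, so this ordering is admissible and its first value is
    \<open>Y\<close>.\<close>
  define w0 where "w0 = map (\<lambda>k. (k, 0)) [0..<N] @ cs"
  have w0_distinct: "distinct w0"
    using cs C(1) by (auto simp: w0_def distinct_map inj_on_def slots_def)
  have w0_parent: "(k, 0) \<in> set w0 \<longleftrightarrow> k < N" for k
    using cs C(1) by (auto simp: w0_def slots_def)
  have w0_child: "k < N \<and> r < m k" if "(k, Suc r) \<in> set w0" for k r
    using that cs C(1) by (auto simp: w0_def slots_def)
  have "map col cs = replicate c i"
  proof (rule replicate_eqI)
    fix x assume "x \<in> set (map col cs)"
    then show "x = i" using cs C(1) by (auto simp: slots_def col_def)
  qed (simp add: cs_len)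
  moreover have "map (\<lambda>k. col (k, 0)) [0..<N] = js"
    unfolding col_simps N_def by (rule map_nth)
  ultimately have map_w0: "map col w0 = js @ replicate c i" by (simp add: w0_def comp_def)
  have n: "height \<beta> = length w0"
    unfolding \<beta>_eq height_sum_list_simple by (simp add: w0_def N_def cs_len)
  define W where "W = {w. mset w = mset w0}"
  have W: "length w = length w0" "set w = set w0" "distinct w" if "w \<in> W" for w
    using that w0_distinct unfolding W_def
    by (auto dest: mset_eq_length mset_eq_setD mset_eq_imp_distinct_iff)
  define Om where "Om = {w \<in> W. \<forall>k r a b. a < length w \<longrightarrow> b < length w \<longrightarrow>
    w ! a = (k, Suc r) \<longrightarrow> w ! b = (k, 0) \<longrightarrow> b < a}"

  have val_eq: "val p \<noteq> val p'" if pp: "p \<in> set w0" "p' \<in> set w0" "p \<noteq> p'" "col p = col p'" for p p'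
  proof
    assume eq: "val p = val p'"
    obtain k r where p: "p = (k, r)" by fastforce
    obtain k' r' where p': "p' = (k', r')" by fastforce
    have pc: "col (k, 0) \<noteq> i" if "(k, 0) \<in> set w0" for k
      using that i w0_parent[of k] by (auto simp: col_simps N_def)
    have nth: "fls_nth (fls_const (z k r) + fls_X * fls_const (e k r)) 1 = e k r" for k r
      by (simp add: fls_X_times_conv_shift)
    show False
    proof (cases r)
      case 0
      then have "r' = 0" using pp pc[of k] unfolding p p' by (cases r') (auto simp: col_simps)
      then have "fls_const (y k) = fls_const (y k')" using eq 0 by (simp add: p p' val_simps)
      then have "y k = y k'" by (metis fls_const_nth)
      then show False using pp(3) p p' 0 \<open>r' = 0\<close> by (simp add: y_inj)
    next
      case (Suc s)
      then obtain s' where s': "r' = Suc s'" using pp pc[of k'] unfolding p p' by (cases r') (auto simp: col_simps)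
      \<comment> \<open>Roots may coincide in their constant terms, but the coefficient of
        \<epsilon> is a power of \<open>Y\<close> whose exponent encodes the pair
        \<open>(k, s)\<close>.\<close>
      have "e k s = e k' s'" using arg_cong[OF eq, of "\<lambda>f. fls_nth f 1"] unfolding p p' Suc s' val_simps nth .
      then have "prod_encode (k, s) = prod_encode (k', s')" using inj_eq[OF Y] by (simp add: e_def)
      then have "(k, s) = (k', s')" by (metis prod_encode_inverse)
      then show False using pp(3) p p' Suc s' by simp
    qed
  qed

  have Q_eval: "bieval \<phi> (Q (js ! k) i) (fls_const (y k)) x = poly (fls_const_poly (q k)) x" for k x
  proof -
    have "poly (map_poly \<phi> p) (fls_const (y k)) = fls_const (poly (map_poly \<iota> p) (y k))" for p
    proof -
      have "map_poly \<phi> p = fls_const_poly (map_poly \<iota> p)"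
        by (rule poly_eqI) (simp add: coeff_map_poly \<phi>_def \<iota>.hom_zero)
      then show ?thesis by (simp add: poly_map_fls_const)
    qed
    then have "map_poly (\<lambda>p. poly (map_poly \<phi> p) (fls_const (y k))) (Q (js ! k) i) = fls_const_poly (q k)"
      by (intro poly_eqI) (simp add: coeff_map_poly q_def)
    then show ?thesis by (simp add: bieval_poly \<phi>.hom_zero)
  qed
  \<comment> \<open>Several parents may share the colour \<open>js ! k\<close>; the Lagrange factors
    at \<open>y k\<close> leave only the summand that belongs to the parent
    \<open>k\<close>.\<close>
  have D_eval: "bieval id (D (js ! k) i) (fls_const (y k)) x = poly (G k) x" if k: "k < N" for k x
  proof -
    have "js ! k \<noteq> i" using i k by (auto simp: N_def)
    then have "bieval id (D (js ! k) i) (fls_const (y k)) x =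
        (\<Sum>l | l < N \<and> js ! l = js ! k. poly (L l) (fls_const (y k)) * poly (G l) x)"
      by (simp add: D_def bieval_sum bieval_tensor)
    also have "\<dots> = (\<Sum>l | l < N \<and> js ! l = js ! k. (if l = k then poly (G l) x else 0))"
      by (rule sum.cong) (simp_all add: L_eval k)
    also have "\<dots> = poly (G k) x" using k by (simp add: sum.delta)
    finally show ?thesis .
  qed

  interpret P: klr_points \<phi> Q \<beta> "range fps_to_fls" fls_X D prec col val W Om
  proof
    show "1 \<in> range (fps_to_fls :: 'e fps \<Rightarrow> _)" by (rule fps.one_mem)
    show "a + b \<in> range fps_to_fls" "a * b \<in> range fps_to_fls"
      if "a \<in> range fps_to_fls" "b \<in> range fps_to_fls" for a b :: "'e fls"
      using that by (rule fps.add_mem fps.mult_mem)+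
    show "- a \<in> range fps_to_fls" if "a \<in> range fps_to_fls" for a :: "'e fls"
      using that by (rule fps.uminus_mem)
    show "\<phi> x \<in> range fps_to_fls" for x by (simp only: \<phi>_def fls_const_mem)
    show "fls_X \<in> range (fps_to_fls :: 'e fps \<Rightarrow> _)" by (rule fls_X_mem)
    show "val p \<in> range fps_to_fls" for p
      by (cases p; cases "snd p")
        (auto simp only: snd_conv val_simps intro!: fps.add_mem fps.mult_mem fls_const_mem fls_X_mem)
    show "bicoeff (D a' b') s t \<in> range fps_to_fls" for a' b' s t
    proof -
      have 0: "bicoeff (0 :: 'e fls poly poly) s t \<in> range fps_to_fls"
        using fps.zero_mem by (simp add: bicoeff_def)
      show ?thesis
        unfolding D_def
        by (auto simp only: bicoeff_sum bicoeff_tensor split: if_splits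
            intro!: 0 fps.sum_mem fps.mult_mem G L)
    qed
    show "map col w \<in> seqs \<beta>" if "w \<in> W" for w
    proof -
      have "mset (map simple (map col w)) = mset (map simple (map col w0))"
        using that by (simp add: W_def)
      then have "sum_list (map simple (map col w)) = sum_list (map simple (map col w0))"
        by (metis sum_mset_sum_list)
      then show ?thesis using W(1)[OF that] n by (simp only: seqs_def mem_Collect_eq length_map map_w0 \<beta>_eq)
    qed
    show "swap_seq k w \<in> W" if "w \<in> W" "1 \<le> k" "k < height \<beta>" for w k
    proof -
      have "transpose (k - 1) k permutes {..<length w}"
        using that W(1)[OF that(1)] n by (intro permutes_swap_id) auto
      then show ?thesis using that by (simp add: W_def swap_seq_def mset_permute_list)
    qed
    show "val (w ! k) \<noteq> val (w ! l)"
      if w: "w \<in> W" and kl: "k < height \<beta>" "l < height \<beta>" "k \<noteq> l" and "col (w ! k) = col (w ! l)" for w k l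
    proof (rule val_eq)
      show "w ! k \<in> set w0" "w ! l \<in> set w0"
        using kl n W(1,2)[OF w] by (metis nth_mem)+
      show "w ! k \<noteq> w ! l" using kl n W(1,3)[OF w] by (simp add: nth_eq_iff_index_eq)
    qed fact
    show "Q j j = 0" for j using Q by (simp add: klr_polynomials_def)
    show "bieval \<phi> (Q a' b') x x' = bieval \<phi> (Q b' a') x' x" for a' b' x x'
    proof (rule bieval_swap)
      have "\<forall>i j s t. bicoeff (Q i j) s t = bicoeff (Q j i) t s"
        using Q unfolding klr_polynomials_def by (elim conjE)
      then show "bicoeff (Q a' b') s t = bicoeff (Q b' a') t s" for s t
        by (elim allE)
    qed (rule \<phi>.hom_zero)
    show "bieval id (D a' b') x x' = bieval id (D b' a') x' x" for a' b' x x'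
      by (simp add: D_def bieval_sum bieval_tensor bieval_zero mult.commute)
    show "prec a' b' \<longleftrightarrow> \<not> prec b' a'" if "a' \<noteq> b'" for a' b'
      using that lt[rule_format, OF that] by (auto simp: prec_def)
    show "Om \<subseteq> W" by (auto simp: Om_def)
  next
    fix w k
    assume w: "w \<in> Om" and k: "1 \<le> k" "k < height \<beta>" and "swap_seq k w \<notin> Om"
    have wW: "w \<in> W" using w by (simp add: Om_def)
    have len: "length w = length w0" by (rule W(1)[OF wW])
    have "transpose (k - 1) k permutes {..<length w}"
      using k len n by (intro permutes_swap_id) auto
    then have "swap_seq k w \<in> W" using wW by (simp add: W_def swap_seq_def mset_permute_list)
    with \<open>swap_seq k w \<notin> Om\<close> obtain k0 r a b where ab: "a < length w" "b < length w"
      "swap_seq k w ! a = (k0, Suc r)" "swap_seq k w ! b = (k0, 0)" "\<not> b < a"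
      unfolding Om_def by auto
    let ?t = "transpose (k - 1) k"
    have k': "k < length w" using k len n by simp
    have t: "w ! ?t a = (k0, Suc r)" "w ! ?t b = (k0, 0)"
      using ab k k' by (simp_all add: nth_swap_seq)
    have "?t a < length w" "?t b < length w"
      using ab k' by (auto intro!: transpose_less)
    \<comment> \<open>In \<open>w\<close> the parent precedes its root, after the exchange it does
      not. An exchange of neighbours reverses only the pair it moves, so this pair is exactly the
      parent and its root.\<close>
    then have "?t b < ?t a" using w t unfolding Om_def by blast
    moreover have "a < b" using ab by (metis linorder_neqE_nat old.prod.inject Zero_not_Suc)
    ultimately have "a = k - 1" "b = k" using k by (auto simp: transpose_def split: if_splits)
    then have p: "w ! (k - 1) = (k0, 0)" "w ! k = (k0, Suc r)" using t by simp_all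
    have "(k0, Suc r) \<in> set w0" using p k' W(2)[OF wW] by (metis nth_mem)
    then have kr: "k0 < N" "r < m k0" using w0_child by blast+
    have "js ! k0 \<noteq> i" using i kr(1) by (auto simp: N_def)
    then show "col (w ! (k - 1)) \<noteq> col (w ! k) \<and> prec (col (w ! (k - 1))) (col (w ! k)) \<and>
      bieval \<phi> (Q (col (w ! (k - 1))) (col (w ! k))) (val (w ! (k - 1))) (val (w ! k)) +
        fls_X * bieval id (D (col (w ! (k - 1))) (col (w ! k))) (val (w ! (k - 1))) (val (w ! k)) = 0"
      unfolding p col_simps val_simps Q_eval D_eval[OF kr(1)] using z[OF kr] by (simp add: prec_def)
  qed

  have N: "0 < N" using \<open>js \<noteq> []\<close> by (simp add: N_def)
  have w0_Om: "w0 \<in> Om"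
  proof -
    have "b < a" if "a < length w0" "b < length w0" "w0 ! a = (k, Suc r)" "w0 ! b = (k, 0)" for k r a b
    proof -
      have "N \<le> a" using that(3) by (cases "a < N") (auto simp: w0_def nth_append)
      moreover have "b < N"
      proof (rule ccontr)
        assume "\<not> b < N"
        then have "w0 ! b \<in> set cs" using that(2) by (auto simp: w0_def nth_append)
        then show False using that(4) cs C(1) by (auto simp: slots_def)
      qed
      ultimately show ?thesis by simp
    qed
    then show ?thesis by (auto simp: Om_def W_def)
  qed
  \<comment> \<open>Parents have colours different from \<open>i\<close>, so a first point of colour
    \<open>i\<close> would be a root with no room for its parent before it.\<close>
  have first: "col (w ! 0) \<noteq> i" if w: "w \<in> Om" "w \<noteq> []" for w
  proof
    assume ci: "col (w ! 0) = i"
    have wW: "w \<in> W" using w by (simp add: Om_def)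
    obtain k r where kr: "w ! 0 = (k, r)" by fastforce
    have in0: "(k, r) \<in> set w0" using kr w W(2)[OF wW] by (metis length_greater_0_conv nth_mem)
    show False
    proof (cases r)
      case 0
      then show False using in0 ci kr i w0_parent[of k] by (auto simp: col_simps N_def)
    next
      case (Suc s)
      then have "(k, 0) \<in> set w" using in0 w0_child w0_parent W(2)[OF wW] by blast
      then obtain b where "b < length w" "w ! b = (k, 0)" by (auto simp: in_set_conv_nth)
      then have "b < 0" using w kr Suc unfolding Om_def by blast
      then show False by simp
    qed
  qed
  have "1 \<le> height \<beta>" using N by (simp add: n w0_def)
  show thesis
  proof (rule P.finitely_generated_values[OF fg w0_Om first])
    fix S :: "('i klr_gen, 'k) free set set set" and v
    assume S: "finite S"
      and v: "\<And>m. \<exists>a. \<exists>g\<in>range fps_to_fls. val (w0 ! 0) ^ m = (\<Sum>s\<in>S. \<phi> (a s) * v s) + fls_X * g"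
    have val0: "val (w0 ! 0) = fls_const Y" using N by (simp add: w0_def nth_append val_simps y_def)
    \<comment> \<open>Comparison of the coefficients of degree 0. The coefficients
      \<open>\<phi> (a s)\<close> are constants, and the term \<open>fls_X * fps_to_fls g\<close>
      has no constant term.\<close>
    have "\<exists>a. Y ^ m = (\<Sum>s\<in>S. \<iota> (a s) * fls_nth (v s) 0)" for m
    proof -
      obtain a g where "val (w0 ! 0) ^ m = (\<Sum>s\<in>S. \<phi> (a s) * v s) + fls_X * fps_to_fls g"
        using v[of m] by blast
      then have "fls_nth (fls_const (Y ^ m)) 0 = fls_nth ((\<Sum>s\<in>S. \<phi> (a s) * v s) + fls_X * fps_to_fls g) 0"
        by (simp only: val0 fls_const_power)
      then have "Y ^ m = (\<Sum>s\<in>S. \<iota> (a s) * fls_nth (v s) 0)"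
        by (simp add: fls_X_times_conv_shift \<phi>_def fls_nth_sum)
      then show ?thesis by blast
    qed
    then show thesis by (rule that[OF S])
  qed (use \<open>1 \<le> height \<beta>\<close> in simp_all)
qed

section \<open>Transcendence of \<open>Y\<close> over the residue field\<close>

theorem proposition4p10:
  fixes B :: "'i lattice \<Rightarrow> 'i lattice \<Rightarrow> int"
    and Q :: "'i \<Rightarrow> 'i \<Rightarrow> 'k::comm_ring_1 poly poly"
    and i :: 'i and \<beta> :: "'i lattice"
  assumes "cartan_datum B"
    and "klr_polynomials B Q"
    and "\<beta> \<in> pos_cone" and "\<beta> \<noteq> 0"
    and "simple_reflection B i \<beta> \<in> pos_cone"
  shows "\<not> finitely_generated_module scalar_ring (klr_quotient Q \<beta> i)"
proof
  assume fg: "finitely_generated_module scalar_ring (klr_quotient Q \<beta> i)"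
  \<comment> \<open>The embedding of the residue field into the algebraic closure of its field of
    rational functions; the polynomial variable becomes \<open>Y\<close>.\<close>
  define h :: "'k residue \<Rightarrow> 'k residue poly fract alg_closure"
    where "h = (\<lambda>x. to_ac (to_fract [:x:]))"
  define \<iota> where "\<iota> = (\<lambda>x :: 'k. h (to_residue x))"
  define Y :: "'k residue poly fract alg_closure" where "Y = to_ac (to_fract [:0, 1:])"
  interpret r: comm_ring_hom "to_residue :: 'k \<Rightarrow> _" by (rule to_residue_hom)
  have h_add: "h (x + y) = h x + h y" and h_mult: "h (x * y) = h x * h y" and h_1: "h 1 = 1" for x y
    by (simp_all add: h_def flip: to_ac_add to_ac_mult to_fract_add to_fract_mult) (simp add: one_pCons[symmetric])
  have \<iota>: "comm_ring_hom \<iota>"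
    by standard (simp_all add: \<iota>_def h_add h_mult h_1 r.hom_add r.hom_mult r.hom_1)
  have Y_pow: "h x * Y ^ m = to_ac (to_fract (Polynomial.monom x m))" for x m
  proof (induction m)
    case 0
    show ?case by (simp add: h_def monom_0)
  next
    case (Suc m)
    have "Polynomial.monom x (Suc m) = [:0, 1:] * Polynomial.monom x m" by (simp add: monom_Suc)
    then have "to_ac (to_fract (Polynomial.monom x (Suc m))) = Y * to_ac (to_fract (Polynomial.monom x m))"
      by (simp only: to_fract_mult to_ac_mult Y_def)
    then show ?case using Suc by (simp add: mult.left_commute)
  qed
  have Y_inj: "inj (\<lambda>m::nat. Y ^ m)"
  proof (rule injI)
    fix m m' :: nat assume "Y ^ m = Y ^ m'"
    then have "to_ac (to_fract (Polynomial.monom 1 m)) = (to_ac (to_fract (Polynomial.monom 1 m')) :: 'k residue poly fract alg_closure)"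
      using Y_pow[of 1 m] Y_pow[of 1 m'] by (simp add: h_1)
    then have "Polynomial.monom (1 :: 'k residue) m = Polynomial.monom 1 m'" by simp
    then show "m = m'" by (metis degree_monom_eq one_neq_zero)
  qed
  \<comment> \<open>The algebraic closure as a vector space over the residue field, through
    \<open>h\<close>.\<close>
  interpret V: vector_space "\<lambda>x v. h x * v"
    by standard (simp_all add: algebra_simps h_add h_mult h_1)
  have indep: "V.independent (range (\<lambda>m. Y ^ m))"
    unfolding V.independent_explicit_module
  proof (intro allI impI)
    fix T u v assume T: "finite T" "T \<subseteq> range (\<lambda>m. Y ^ m)" "(\<Sum>v\<in>T. h (u v) * v) = 0" "v \<in> T"
    obtain M where M: "finite M" "T = (\<lambda>m. Y ^ m) ` M" using finite_subset_image[OF T(1,2)] by blast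
    obtain m where m: "m \<in> M" "v = Y ^ m" using M T by blast
    \<comment> \<open>A linear relation between powers of \<open>Y\<close> is the image of a
      polynomial under injective maps, so all its coefficients vanish.\<close>
    have "to_ac (to_fract (\<Sum>m\<in>M. Polynomial.monom (u (Y ^ m)) m)) = (\<Sum>m\<in>M. h (u (Y ^ m)) * Y ^ m)"
      by (simp add: Y_pow to_fract_sum to_ac_sum)
    also have "\<dots> = (\<Sum>v\<in>T. h (u v) * v)"
      unfolding M(2) by (rule sum.reindex_cong[symmetric, OF inj_on_subset[OF Y_inj]]) simp_all
    also have "\<dots> = 0" by (rule T(3))
    finally have "(\<Sum>m\<in>M. Polynomial.monom (u (Y ^ m)) m) = 0"
      by (simp only: to_ac_eq_0_iff to_fract_eq_0_iff)
    then have "Polynomial.coeff (\<Sum>m\<in>M. Polynomial.monom (u (Y ^ m)) m) m = 0" by simp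
    then show "u v = 0" using M(1) m by (simp add: coeff_sum coeff_monom)
  qed
  obtain S :: "('i klr_gen, 'k) free set set set" and v where S: "finite S"
    and v: "\<And>m. \<exists>a. Y ^ m = (\<Sum>s\<in>S. \<iota> (a s) * v s)"
    by (rule finitely_generated_klr_quotient_values[OF \<iota> Y_inj assms fg]) (rule that)
  \<comment> \<open>Finite generation puts infinitely many independent vectors into the span of a
    finite set, since scalars from \<open>K\<close> act through the residue field.\<close>
  have "range (\<lambda>m. Y ^ m) \<subseteq> V.span (v ` S)"
  proof
    fix x assume "x \<in> range (\<lambda>m. Y ^ m)"
    then obtain m where "x = Y ^ m" by blast
    then obtain a where x: "x = (\<Sum>s\<in>S. h (to_residue (a s)) * v s)" using v[of m] by (auto simp: \<iota>_def)
    show "x \<in> V.span (v ` S)"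
      unfolding x by (intro V.span_sum V.span_scale V.span_base imageI)
  qed
  moreover have "infinite (range (\<lambda>m. Y ^ m))" using Y_inj by (rule range_inj_infinite)
  ultimately show False
    using V.independent_span_bound[OF finite_imageI[OF S] indep] by blast
qed

end
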